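(* Let $\sigma=(\sigma_j)_{j\in\mathbb{N}_0}$ and $\tau=(\tau_j)_{j\in\mathbb{N}_0}$ be two admissible sequences, let $0<p_1,p_2<\infty$, $0<q_1,q_2\le\infty$, and let $q^\ast\in(0,\infty]$ be given by $\frac{1}{q^\ast}=\max\left(\frac{1}{q_2}-\frac{1}{q_1},0\right)$. (i) The embedding $\mathrm{id}: B^{\sigma}_{p_1,q_1}(\mathbb{R}^n)\to B^{\tau}_{p_2,q_2}(\mathbb{R}^n)$ exists and is bounded (i.e. $B^{\sigma}_{p_1,q_1}(\mathbb{R}^n)\subset B^{\tau}_{p_2,q_2}(\mathbb{R}^n)$ and the inclusion is continuous) if, and only if, $$p_1\le p_2\qquad\text{and}\qquad \left(\sigma_j^{-1}\,\tau_j\,2^{jn\left(\frac{1}{p_1}-\frac{1}{p_2}\right)}\right)_{j\in\mathbb{N}_0}\in\ell_{q^\ast}.$$ (ii) The embedding $\mathrm{id}: B^{\sigma}_{p_1,q_1}(\mathbb{R}^n)\to B^{\tau}_{p_2,q_2}(\mathbb{R}^n)$ is never compact.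
   Context: A sequence $\sigma=(\sigma_j)_{j\in\mathbb{N}_0}$ of positive numbers is called admissible if there are constants $d_0,d_1>0$ with $d_0\sigma_j\le\sigma_{j+1}\le d_1\sigma_j$ for all $j\in\mathbb{N}_0$. Convention: $1/\infty=0$ (so $q^\ast=\infty$ when $q_1\le q_2$). Besov spaces of generalised smoothness. Let $\varphi_0\in\mathcal{S}(\mathbb{R}^n)$ with $\varphi_0(x)=1$ if $|x|\le1$ and $\operatorname{supp}\varphi_0\subset\{|x|\le2\}$, and for $j\in\mathbb{N}$ let $\varphi_j(x)=\varphi_0(2^{-j}x)-\varphi_0(2^{-j+1}x)$. For an admissible sequence $\sigma$ and $0<p,q\le\infty$, $B^{\sigma}_{p,q}(\mathbb{R}^n)$ is the space of all $f\in\mathcal{S}'(\mathbb{R}^n)$ with $$\|f|B^{\sigma}_{p,q}(\mathbb{R}^n)\|=\Big(\sum_{j=0}^\infty\sigma_j^q\,\|\mathcal{F}^{-1}(\varphi_j\mathcal{F}f)\,|L_p(\mathbb{R}^n)\|^q\Big)^{1/q}<\infty$$ (supremum over $j$ if $q=\infty$), where $\mathcal{F}$ is the Fourier transform. This is a quasi-Banach space, independent of the choice of $\varphi_0$ up to equivalent quasi-norms. *)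

theory Defs
  imports "HOL-Probability.Essential_Supremum"
begin

text \<open>The Schwartz space.\<close>

definition partial_deriv :: "'n::finite \<Rightarrow> (real^'n \<Rightarrow> complex) \<Rightarrow> real^'n \<Rightarrow> complex"
  where "partial_deriv i f x = frechet_derivative f (at x) (axis i 1)"

text \<open>Multi-indices are given as lists of coordinate directions, so that the order of the
  derivative is the length of the list.\<close>

definition mixed_partial :: "'n::finite list \<Rightarrow> (real^'n \<Rightarrow> complex) \<Rightarrow> real^'n \<Rightarrow> complex"
  where "mixed_partial is f = foldr partial_deriv is f"

definition schwartz :: "(real^'n::finite \<Rightarrow> complex) set"
  where "schwartz = {f. \<forall>is. mixed_partial is f differentiable_on UNIV \<and>
           (\<forall>k. bounded (range (\<lambda>x. (1 + norm x) ^ k *\<^sub>R mixed_partial is f x)))}"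

definition schwartz_norm :: "nat \<Rightarrow> (real^'n::finite \<Rightarrow> complex) \<Rightarrow> real"
  where "schwartz_norm N f =
    (SUP (is, x) \<in> {is. length is \<le> N} \<times> UNIV. (1 + norm x) ^ N * norm (mixed_partial is f x))"

definition schwartz_topology :: "(real^'n::finite \<Rightarrow> complex) topology"
  where "schwartz_topology = topology (\<lambda>U. U \<subseteq> schwartz \<and>
    (\<forall>f\<in>U. \<exists>N. \<exists>e>0. {g \<in> schwartz. \<forall>k\<le>N. schwartz_norm k (\<lambda>x. g x - f x) < e} \<subseteq> U))"

text \<open>Tempered distributions. A functional on the Schwartz space is encoded as a total function
  that vanishes outside the Schwartz space, so that equality of distributions is HOL equality.\<close>

type_synonym 'n functional = "(real^'n \<Rightarrow> complex) \<Rightarrow> complex"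

definition tempered :: "('n::finite) functional set"
  where "tempered = {u.
     (\<forall>f. f \<notin> schwartz \<longrightarrow> u f = 0) \<and>
     (\<forall>f\<in>schwartz. \<forall>g\<in>schwartz. u (\<lambda>x. f x + g x) = u f + u g) \<and>
     (\<forall>c. \<forall>f\<in>schwartz. u (\<lambda>x. c * f x) = c * u f) \<and>
     continuous_map schwartz_topology euclidean u}"

definition fourier :: "(real^'n::finite \<Rightarrow> complex) \<Rightarrow> real^'n \<Rightarrow> complex"
  where "fourier f \<xi> = of_real ((2 * pi) powr (- real CARD('n) / 2)) *
           (LINT x|lborel. cis (- (x \<bullet> \<xi>)) * f x)"

definition inv_fourier :: "(real^'n::finite \<Rightarrow> complex) \<Rightarrow> real^'n \<Rightarrow> complex"
  where "inv_fourier f x = of_real ((2 * pi) powr (- real CARD('n) / 2)) *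
           (LINT \<xi>|lborel. cis (x \<bullet> \<xi>) * f \<xi>)"

definition distr_fourier :: "('n::finite) functional \<Rightarrow> 'n functional"
  where "distr_fourier u = (\<lambda>f. if f \<in> schwartz then u (fourier f) else 0)"

definition distr_inv_fourier :: "('n::finite) functional \<Rightarrow> 'n functional"
  where "distr_inv_fourier u = (\<lambda>f. if f \<in> schwartz then u (inv_fourier f) else 0)"

definition distr_mult :: "(real^'n::finite \<Rightarrow> complex) \<Rightarrow> 'n functional \<Rightarrow> 'n functional"
  where "distr_mult m u = (\<lambda>f. if f \<in> schwartz then u (\<lambda>x. m x * f x) else 0)"

text \<open>Quasi-norms with values in \<open>[0, \<infinity>]\<close>. Only positive exponents are used, both in
  \<open>ennreal_powr\<close> and for \<open>p\<close> and \<open>q\<close>.\<close>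

definition ennreal_powr :: "ennreal \<Rightarrow> real \<Rightarrow> ennreal"
  where "ennreal_powr a r = (if a = \<infinity> then \<infinity> else ennreal (enn2real a powr r))"

definition lq_norm :: "ereal \<Rightarrow> (nat \<Rightarrow> ennreal) \<Rightarrow> ennreal"
  where "lq_norm q a = (if q = \<infinity> then (SUP j. a j)
           else ennreal_powr (\<Sum>j. ennreal_powr (a j) (real_of_ereal q)) (1 / real_of_ereal q))"

definition Lp_norm :: "ereal \<Rightarrow> (real^'n::finite \<Rightarrow> complex) \<Rightarrow> ennreal"
  where "Lp_norm p h = (if p = \<infinity> then esssup lborel (\<lambda>x. ennreal (norm (h x)))
           else ennreal_powr (\<integral>\<^sup>+x. ennreal_powr (ennreal (norm (h x))) (real_of_ereal p) \<partial>lborel)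
                  (1 / real_of_ereal p))"

definition represents :: "(real^'n::finite \<Rightarrow> complex) \<Rightarrow> 'n functional \<Rightarrow> bool"
  where "represents h u \<longleftrightarrow> h \<in> borel_measurable lborel \<and>
           (\<forall>f\<in>schwartz. integrable lborel (\<lambda>x. h x * f x) \<and> u f = (LINT x|lborel. h x * f x))"

text \<open>The function representing a distribution is unique almost everywhere, so the infimum below
  is the \<open>L\<^sub>p\<close> quasi-norm of that function; it is \<open>\<infinity>\<close> if the distribution is not
  a function. In the Besov quasi-norm the distributions are band-limited, hence given by smooth
  functions of at most polynomial growth.\<close>

definition distr_Lp_norm :: "ereal \<Rightarrow> ('n::finite) functional \<Rightarrow> ennreal"
  where "distr_Lp_norm p u = (INF h \<in> {h. represents h u}. Lp_norm p h)"

text \<open>Besov spaces of generalised smoothness.\<close>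

definition admissible :: "(nat \<Rightarrow> real) \<Rightarrow> bool"
  where "admissible \<sigma> \<longleftrightarrow> (\<forall>j. 0 < \<sigma> j) \<and>
    (\<exists>d0>0. \<exists>d1>0. \<forall>j. d0 * \<sigma> j \<le> \<sigma> (Suc j) \<and> \<sigma> (Suc j) \<le> d1 * \<sigma> j)"

definition LP_generator :: "(real^'n::finite \<Rightarrow> complex) \<Rightarrow> bool"
  where "LP_generator \<phi>0 \<longleftrightarrow> \<phi>0 \<in> schwartz \<and> (\<forall>x. norm x \<le> 1 \<longrightarrow> \<phi>0 x = 1) \<and>
    closure (support_on UNIV \<phi>0) \<subseteq> cball 0 2"

definition LP_partition :: "(real^'n::finite \<Rightarrow> complex) \<Rightarrow> nat \<Rightarrow> real^'n \<Rightarrow> complex"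
  where "LP_partition \<phi>0 j x = (if j = 0 then \<phi>0 x
    else \<phi>0 ((2 powr (- real j)) *\<^sub>R x) - \<phi>0 ((2 powr (- real j + 1)) *\<^sub>R x))"

definition besov_norm ::
    "(real^'n::finite \<Rightarrow> complex) \<Rightarrow> (nat \<Rightarrow> real) \<Rightarrow> ereal \<Rightarrow> ereal \<Rightarrow> 'n functional \<Rightarrow> ennreal"
  where "besov_norm \<phi>0 \<sigma> p q u = lq_norm q (\<lambda>j. ennreal (\<sigma> j) *
    distr_Lp_norm p (distr_inv_fourier (distr_mult (LP_partition \<phi>0 j) (distr_fourier u))))"

definition besov ::
    "(real^'n::finite \<Rightarrow> complex) \<Rightarrow> (nat \<Rightarrow> real) \<Rightarrow> ereal \<Rightarrow> ereal \<Rightarrow> 'n functional set"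
  where "besov \<phi>0 \<sigma> p q = {u \<in> tempered. besov_norm \<phi>0 \<sigma> p q u < \<infinity>}"

text \<open>The topology of the quasi-norm. For a quasi-norm the balls are neighbourhoods of their
  centres but need not be open.\<close>

definition besov_topology ::
    "(real^'n::finite \<Rightarrow> complex) \<Rightarrow> (nat \<Rightarrow> real) \<Rightarrow> ereal \<Rightarrow> ereal \<Rightarrow> 'n functional topology"
  where "besov_topology \<phi>0 \<sigma> p q = topology (\<lambda>U. U \<subseteq> besov \<phi>0 \<sigma> p q \<and>
    (\<forall>u\<in>U. \<exists>e>0. {v \<in> besov \<phi>0 \<sigma> p q. besov_norm \<phi>0 \<sigma> p q (\<lambda>f. v f - u f) < ennreal e} \<subseteq> U))"

definition besov_embedding_continuous ::
    "(real^'n::finite \<Rightarrow> complex) \<Rightarrow> (nat \<Rightarrow> real) \<Rightarrow> ereal \<Rightarrow> ereal \<Rightarrow>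
       (nat \<Rightarrow> real) \<Rightarrow> ereal \<Rightarrow> ereal \<Rightarrow> bool"
  where "besov_embedding_continuous \<phi>0 \<sigma> p1 q1 \<tau> p2 q2 \<longleftrightarrow>
    besov \<phi>0 \<sigma> p1 q1 \<subseteq> besov \<phi>0 \<tau> p2 q2 \<and>
    continuous_map (besov_topology \<phi>0 \<sigma> p1 q1) (besov_topology \<phi>0 \<tau> p2 q2) id"

text \<open>A linear map is compact if the image of the unit ball is relatively compact.\<close>

definition besov_embedding_compact ::
    "(real^'n::finite \<Rightarrow> complex) \<Rightarrow> (nat \<Rightarrow> real) \<Rightarrow> ereal \<Rightarrow> ereal \<Rightarrow>
       (nat \<Rightarrow> real) \<Rightarrow> ereal \<Rightarrow> ereal \<Rightarrow> bool"
  where "besov_embedding_compact \<phi>0 \<sigma> p1 q1 \<tau> p2 q2 \<longleftrightarrow>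
    besov \<phi>0 \<sigma> p1 q1 \<subseteq> besov \<phi>0 \<tau> p2 q2 \<and>
    compactin (besov_topology \<phi>0 \<tau> p2 q2)
      (besov_topology \<phi>0 \<tau> p2 q2 closure_of
         (id ` {u \<in> besov \<phi>0 \<sigma> p1 q1. besov_norm \<phi>0 \<sigma> p1 q1 u \<le> 1}))"

text \<open>The two topologies above are given by predicates that do define topologies.\<close>

lemma openin_schwartz_topology:
  fixes U :: "(real^'n::finite \<Rightarrow> complex) set"
  shows "openin schwartz_topology U \<longleftrightarrow> U \<subseteq> schwartz \<and>
    (\<forall>f\<in>U. \<exists>N. \<exists>e>0. {g \<in> schwartz. \<forall>k\<le>N. schwartz_norm k (\<lambda>x. g x - f x) < e} \<subseteq> U)"
proof -
  let ?B = "\<lambda>(f :: real^'n \<Rightarrow> complex) N e. {g \<in> schwartz. \<forall>k\<le>N. schwartz_norm k (\<lambda>x. g x - f x) < e}"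
  let ?P = "\<lambda>U :: (real^'n \<Rightarrow> complex) set. U \<subseteq> schwartz \<and> (\<forall>f\<in>U. \<exists>N. \<exists>e>0. ?B f N e \<subseteq> U)"
  have "istopology ?P"
    unfolding istopology_def
  proof (intro conjI allI impI)
    fix S T :: "(real^'n \<Rightarrow> complex) set" assume S: "?P S" and T: "?P T"
    show "S \<inter> T \<subseteq> schwartz" using S by blast
    show "\<forall>f\<in>S \<inter> T. \<exists>N. \<exists>e>0. ?B f N e \<subseteq> S \<inter> T"
    proof
      fix f assume f: "f \<in> S \<inter> T"
      obtain N e where 1: "e > 0" "?B f N e \<subseteq> S" using S f by blast
      obtain M d where 2: "d > 0" "?B f M d \<subseteq> T" using T f by blast
      have "?B f (max N M) (min e d) \<subseteq> ?B f N e \<inter> ?B f M d" by auto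
      then show "\<exists>N. \<exists>e>0. ?B f N e \<subseteq> S \<inter> T"
        using 1 2 by (intro exI[of _ "max N M"] exI[of _ "min e d"]) auto
    qed
  next
    fix K :: "(real^'n \<Rightarrow> complex) set set" assume K: "\<forall>S\<in>K. ?P S"
    show "\<Union>K \<subseteq> schwartz" using K by blast
    show "\<forall>f\<in>\<Union>K. \<exists>N. \<exists>e>0. ?B f N e \<subseteq> \<Union>K"
    proof
      fix f assume "f \<in> \<Union>K"
      then obtain S where S: "S \<in> K" "f \<in> S" by blast
      then obtain N e where "e > 0" "?B f N e \<subseteq> S" using K by blast
      then show "\<exists>N. \<exists>e>0. ?B f N e \<subseteq> \<Union>K" using S by blast
    qed
  qed
  then show ?thesis by (simp add: schwartz_topology_def)
qed

lemma openin_besov_topology: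
  "openin (besov_topology \<phi>0 \<sigma> p q) U \<longleftrightarrow> U \<subseteq> besov \<phi>0 \<sigma> p q \<and>
    (\<forall>u\<in>U. \<exists>e>0. {v \<in> besov \<phi>0 \<sigma> p q. besov_norm \<phi>0 \<sigma> p q (\<lambda>f. v f - u f) < ennreal e} \<subseteq> U)"
proof -
  let ?X = "besov \<phi>0 \<sigma> p q"
  let ?B = "\<lambda>u e. {v \<in> ?X. besov_norm \<phi>0 \<sigma> p q (\<lambda>f. v f - u f) < ennreal e}"
  let ?P = "\<lambda>U. U \<subseteq> ?X \<and> (\<forall>u\<in>U. \<exists>e>0. ?B u e \<subseteq> U)"
  have "istopology ?P"
    unfolding istopology_def
  proof (intro conjI allI impI)
    fix S T assume S: "?P S" and T: "?P T"
    show "S \<inter> T \<subseteq> ?X" using S by blast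
    show "\<forall>u\<in>S \<inter> T. \<exists>e>0. ?B u e \<subseteq> S \<inter> T"
    proof
      fix u assume u: "u \<in> S \<inter> T"
      obtain e where 1: "e > 0" "?B u e \<subseteq> S" using S u by blast
      obtain d where 2: "d > 0" "?B u d \<subseteq> T" using T u by blast
      have "ennreal (min e d) \<le> ennreal e" "ennreal (min e d) \<le> ennreal d"
        by (auto intro: ennreal_leI)
      then have "?B u (min e d) \<subseteq> ?B u e \<inter> ?B u d" by (auto dest: order.strict_trans2)
      then show "\<exists>e>0. ?B u e \<subseteq> S \<inter> T"
        using 1 2 by (intro exI[of _ "min e d"]) auto
    qed
  next
    fix K assume K: "\<forall>S\<in>K. ?P S"
    show "\<Union>K \<subseteq> ?X" using K by blast
    show "\<forall>u\<in>\<Union>K. \<exists>e>0. ?B u e \<subseteq> \<Union>K"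
    proof
      fix u assume "u \<in> \<Union>K"
      then obtain S where S: "S \<in> K" "u \<in> S" by blast
      then obtain e where "e > 0" "?B u e \<subseteq> S" using K by blast
      then show "\<exists>e>0. ?B u e \<subseteq> \<Union>K" using S by blast
    qed
  qed
  then show ?thesis by (simp add: besov_topology_def)
qed

lemma topspace_schwartz_topology [simp]: "topspace schwartz_topology = schwartz"
proof (rule antisym)
  show "topspace schwartz_topology \<subseteq> schwartz"
    using openin_schwartz_topology openin_topspace by blast
  have "openin schwartz_topology schwartz"
    unfolding openin_schwartz_topology by (auto intro!: exI[of _ "1::real"])
  then show "schwartz \<subseteq> topspace schwartz_topology" by (rule openin_subset)
qed

lemma topspace_besov_topology [simp]: "topspace (besov_topology \<phi>0 \<sigma> p q) = besov \<phi>0 \<sigma> p q"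
proof (rule antisym)
  show "topspace (besov_topology \<phi>0 \<sigma> p q) \<subseteq> besov \<phi>0 \<sigma> p q"
    using openin_besov_topology openin_topspace by blast
  have "openin (besov_topology \<phi>0 \<sigma> p q) (besov \<phi>0 \<sigma> p q)"
    unfolding openin_besov_topology by (auto intro!: exI[of _ "1::real"])
  then show "besov \<phi>0 \<sigma> p q \<subseteq> topspace (besov_topology \<phi>0 \<sigma> p q)" by (rule openin_subset)
qed

end

theory Submission
  imports Defs "HOL-Probability.Probability"
begin

text \<open>Sufficiency rests on Nikolskii's inequality: the block \<open>u\<^sub>j\<close> has spectrum in a ball of radius
  comparable to \<open>2\<^sup>j\<close>, so it is reproduced by convolution with a kernel of size \<open>2\<^bsup>jn\<^esup>\<close> and bounded
  \<open>L\<^sub>1\<close> norm; this bounds its supremum, and hence its \<open>L\<^sub>p\<close> norm for \<open>p = p2\<close>, by its \<open>L\<^sub>p\<close> norm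
  for \<open>p = p1\<close>. The sequence spaces are then compared by Hoelder's inequality.

  For necessity, continuity gives a bound between the quasi-norms. Dilating a function with spectrum
  in the unit ball, where only the block \<open>j = 0\<close> contributes, forces \<open>p1 \<le> p2\<close>. Sums
  of dilated bumps with spectra in the annuli \<open>2\<^sup>j < |\<xi>| < 2\<^bsup>j+1\<^esup>\<close>, where \<open>j\<close> runs over a set
  without consecutive elements, turn the bound into a multiplier estimate between sequence spaces,
  which is tested on powers of the multiplier. Translates that move apart stay separated in the
  target space, so the embedding is not compact.\<close>

section \<open>The Schwartz space\<close>

text \<open>Exponents below 1 shape the estimates. A block is given by a function \<open>h\<close>
  of which only measurability, integrability against Schwartz functions and a finite integral of
  \<open>|h|^p\<close> are known. For \<open>p < 1\<close> the reproducing kernel bounds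
  \<open>sup |h|\<close> by a multiple of \<open>(sup |h|)^(1-p)\<close>, which says something only
  once the supremum is known to be finite. A cutoff with small spectrum supplies finiteness, with
  constants uniform in its dilation. The gaps between indices answer the generality of
  \<open>\<phi>0\<close>, which is arbitrary at radii between 1 and 2: a bump in one annulus may be
  seen by two consecutive blocks, so bumps at consecutive scales could cancel. Even and odd indices
  together recover the full sequence norm. The exponent in the condition comes from scaling: a bump
  of height 1 dilated by \<open>2^j\<close> in frequency has an inverse transform of
  \<open>L_p\<close> size \<open>2^(jn(1-1/p))\<close>, and the quotient of these sizes for
  \<open>p2\<close> and \<open>p1\<close> is \<open>2^(jn(1/p1-1/p2))\<close>.\<close>

definition rapidly_decreasing :: "(real^'n::finite \<Rightarrow> complex) \<Rightarrow> bool"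
  where "rapidly_decreasing f \<longleftrightarrow> (\<forall>k. \<exists>C. \<forall>x. (1 + norm x) ^ k * norm (f x) \<le> C)"

lemma mixed_partial_simps [simp]:
  "mixed_partial [] f = f"
  "mixed_partial (i # is) f = partial_deriv i (mixed_partial is f)"
  by (simp_all add: mixed_partial_def)

text \<open>\<open>foldr\<close> applies the head of the list last, so the last entry is the
  derivative taken first. Peeling it off shows that a partial derivative inherits every condition on
  mixed partials.\<close>

lemma mixed_partial_snoc: "mixed_partial (is @ [i]) f = mixed_partial is (partial_deriv i f)"
  by (simp add: mixed_partial_def)

lemma schwartz_iff:
  fixes f :: "real^'n::finite \<Rightarrow> complex"
  shows
  "f \<in> schwartz \<longleftrightarrow>
    (\<forall>is x. mixed_partial is f differentiable (at x)) \<and> (\<forall>is. rapidly_decreasing (mixed_partial is f))"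
proof -
  have "bounded (range (\<lambda>x. (1 + norm x) ^ k *\<^sub>R g x)) \<longleftrightarrow> (\<exists>C. \<forall>x. (1 + norm x) ^ k * norm (g x) \<le> C)"
    for g :: "real^'n \<Rightarrow> complex" and k
    by (simp add: bounded_iff)
  then show ?thesis
    by (auto simp: schwartz_def rapidly_decreasing_def differentiable_on_def)
qed

lemma schwartz_differentiable: "f \<in> schwartz \<Longrightarrow> f differentiable (at x)"
  using mixed_partial_simps(1) by (metis schwartz_iff)

lemma schwartz_rapidly_decreasing: "f \<in> schwartz \<Longrightarrow> rapidly_decreasing f"
  using mixed_partial_simps(1) by (metis schwartz_iff)

lemma schwartz_partial_deriv: "f \<in> schwartz \<Longrightarrow> partial_deriv i f \<in> schwartz"
  by (metis schwartz_iff mixed_partial_snoc)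

lemma schwartz_continuous: "f \<in> schwartz \<Longrightarrow> continuous_on A f"
  by (meson continuous_at_imp_continuous_on differentiable_imp_continuous_within schwartz_differentiable)

lemma schwartz_measurable [measurable_dest]: "f \<in> schwartz \<Longrightarrow> f \<in> borel_measurable borel"
  using schwartz_continuous[of f UNIV] by (rule borel_measurable_continuous_onI)

lemma schwartz_decay:
  assumes "f \<in> schwartz"
  obtains C where "C > 0" "\<And>x. (1 + norm x) ^ k * norm (f x) \<le> C"
proof -
  obtain C where "\<And>x. (1 + norm x) ^ k * norm (f x) \<le> C"
    using schwartz_rapidly_decreasing[OF assms] by (auto simp: rapidly_decreasing_def)
  then show thesis
    by (intro that[of "max C 1"]) (auto simp: max_def intro: order_trans)
qed

lemma schwartz_bounded:
  assumes "f \<in> schwartz"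
  obtains C where "C > 0" "\<And>x. norm (f x) \<le> C"
  using schwartz_decay[OF assms, of 0] by auto

text \<open>The conditions at all multi-indices follow by induction once the class \<open>X\<close>
  is stable under single partial derivatives. Closure properties are then proved by naming an
  invariant class, which replaces Leibniz formulas for multi-indices.\<close>

lemma schwartz_coinduct [consumes 1]:
  assumes "X f"
    and diff: "\<And>f x. X f \<Longrightarrow> f differentiable (at x)"
    and dec: "\<And>f. X f \<Longrightarrow> rapidly_decreasing f"
    and partial: "\<And>f i. X f \<Longrightarrow> X (partial_deriv i f)"
  shows "f \<in> schwartz"
proof -
  have "X (mixed_partial is f)" for "is"
    by (induction "is") (auto simp: assms(1) partial)
  then show ?thesis
    by (auto simp: schwartz_iff diff dec)
qed

lemma rapidly_decreasing_add:
  assumes "rapidly_decreasing f" "rapidly_decreasing g"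
  shows "rapidly_decreasing (\<lambda>x. f x + g x)"
  unfolding rapidly_decreasing_def
proof
  fix k
  obtain C D where C: "\<And>x. (1 + norm x) ^ k * norm (f x) \<le> C" and D: "\<And>x. (1 + norm x) ^ k * norm (g x) \<le> D"
    using assms unfolding rapidly_decreasing_def by meson
  have "(1 + norm x) ^ k * norm (f x + g x) \<le> C + D" for x
  proof -
    have "(1 + norm x) ^ k * norm (f x + g x) \<le> (1 + norm x) ^ k * (norm (f x) + norm (g x))"
      by (intro mult_left_mono norm_triangle_ineq) auto
    then show ?thesis using C[of x] D[of x] by (simp add: distrib_left)
  qed
  then show "\<exists>C. \<forall>x. (1 + norm x) ^ k * norm (f x + g x) \<le> C" by blast
qed

text \<open>A factor growing like the \<open>m\<close>-th power of the weight is paid for by the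
  decay of \<open>f\<close> of order \<open>k + m\<close>.\<close>

lemma rapidly_decreasing_dominated:
  assumes f: "rapidly_decreasing f" and g: "\<And>x. norm (g x) \<le> B * (1 + norm x) ^ m * norm (f x)"
  shows "rapidly_decreasing g"
  unfolding rapidly_decreasing_def
proof
  fix k
  obtain C where C: "\<And>x. (1 + norm x) ^ (k + m) * norm (f x) \<le> C"
    using f unfolding rapidly_decreasing_def by meson
  have "(1 + norm x) ^ k * norm (g x) \<le> \<bar>B\<bar> * C" for x
  proof -
    have "(1 + norm x) ^ k * norm (g x) \<le> (1 + norm x) ^ k * (\<bar>B\<bar> * (1 + norm x) ^ m * norm (f x))"
      by (intro mult_left_mono order_trans[OF g] mult_right_mono) auto
    also have "\<dots> = \<bar>B\<bar> * ((1 + norm x) ^ (k + m) * norm (f x))"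
      by (simp add: power_add mult_ac)
    finally show ?thesis using C[of x] by (meson abs_ge_zero mult_left_mono order_trans)
  qed
  then show "\<exists>C. \<forall>x. (1 + norm x) ^ k * norm (g x) \<le> C" by blast
qed

lemma rapidly_decreasing_bounded_mult:
  assumes "rapidly_decreasing f" "\<And>x. norm (g x) \<le> B"
  shows "rapidly_decreasing (\<lambda>x. g x * f x)"
  by (rule rapidly_decreasing_dominated[OF assms(1), of _ B 0]) (auto simp: norm_mult assms(2) mult_right_mono)

section \<open>Rules for partial derivatives\<close>

lemma partial_deriv_eq: "(f has_derivative D) (at x) \<Longrightarrow> partial_deriv i f x = D (axis i 1)"
  by (simp add: partial_deriv_def frechet_derivative_at[symmetric])

lemma partial_deriv_add:
  assumes "f differentiable (at x)" "g differentiable (at x)"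
  shows "partial_deriv i (\<lambda>x. f x + g x) x = partial_deriv i f x + partial_deriv i g x"
  using assms[unfolded frechet_derivative_works]
  by (subst partial_deriv_eq[OF has_derivative_add]) (auto simp: partial_deriv_def)

lemma partial_deriv_mult:
  assumes "f differentiable (at x)" "g differentiable (at x)"
  shows "partial_deriv i (\<lambda>x. f x * g x) x = f x * partial_deriv i g x + partial_deriv i f x * g x"
  using assms[unfolded frechet_derivative_works]
  by (subst partial_deriv_eq[OF has_derivative_mult]) (auto simp: partial_deriv_def)

lemma partial_deriv_const [simp]: "partial_deriv i (\<lambda>x. c) = (\<lambda>x. 0)"
  by (rule ext) (subst partial_deriv_eq[OF has_derivative_const], simp)

lemma partial_deriv_cmult:
  assumes "f differentiable (at x)"
  shows "partial_deriv i (\<lambda>x. c * f x) x = c * partial_deriv i f x"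
  using assms by (subst partial_deriv_mult) auto

lemma partial_deriv_cnj:
  assumes "f differentiable (at x)"
  shows "partial_deriv i (\<lambda>x. cnj (f x)) x = cnj (partial_deriv i f x)"
  using assms[unfolded frechet_derivative_works]
  by (subst partial_deriv_eq[OF bounded_linear.has_derivative[OF bounded_linear_cnj]])
    (auto simp: partial_deriv_def)

lemma has_derivative_coord: "((\<lambda>x. complex_of_real (x $ i)) has_derivative (\<lambda>h. complex_of_real (h $ i))) (at x)"
  by (intro bounded_linear_imp_has_derivative bounded_linear_compose[OF bounded_linear_of_real]
      bounded_linear_vec_nth)

lemma partial_deriv_coord:
  "partial_deriv j (\<lambda>x. complex_of_real (x $ i)) x = (if i = j then 1 else 0)"
  by (subst partial_deriv_eq[OF has_derivative_coord]) (auto simp: axis_def)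

lemma has_derivative_affine:
  assumes "f differentiable (at (a *\<^sub>R x + b))"
  shows "((\<lambda>x. f (a *\<^sub>R x + b)) has_derivative (\<lambda>h. frechet_derivative f (at (a *\<^sub>R x + b)) (a *\<^sub>R h))) (at x)"
proof -
  have "((\<lambda>x. a *\<^sub>R x + b) has_derivative (\<lambda>h. a *\<^sub>R h)) (at x)"
    by (auto intro!: derivative_eq_intros)
  from has_derivative_compose[OF this assms[unfolded frechet_derivative_works]] show ?thesis .
qed

lemma partial_deriv_affine:
  assumes "f differentiable (at (a *\<^sub>R x + b))"
  shows "partial_deriv i (\<lambda>x. f (a *\<^sub>R x + b)) x = of_real a * partial_deriv i f (a *\<^sub>R x + b)"
proof -
  have "linear (frechet_derivative f (at (a *\<^sub>R x + b)))"
    using assms by (rule linear_frechet_derivative)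
  then show ?thesis
    by (subst partial_deriv_eq[OF has_derivative_affine[OF assms]])
      (simp add: linear_scale partial_deriv_def scaleR_conv_of_real[where 'a = complex] del: scaleR_conv_of_real)
qed

text \<open>The product rule leaves the class of products but stays within its finite sums. The
  class \<open>Y\<close> of such sums is stable under derivatives, and
  \<open>schwartz_coinduct\<close> applies to it.\<close>

lemma schwartz_coinduct_add [consumes 1]:
  assumes "X f"
    and diff: "\<And>f x. X f \<Longrightarrow> f differentiable (at x)"
    and dec: "\<And>f. X f \<Longrightarrow> rapidly_decreasing f"
    and partial: "\<And>f i. X f \<Longrightarrow> \<exists>g h. X g \<and> X h \<and> partial_deriv i f = (\<lambda>x. g x + h x)"
  shows "f \<in> schwartz"
proof -
  \<comment> \<open>Sums over \<open>k<Suc m\<close> are never empty, so membership of the zero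
    function in \<open>X\<close> is not presupposed.\<close>
  define Y where "Y f \<longleftrightarrow> (\<exists>m. \<exists>F :: nat \<Rightarrow> real^'a \<Rightarrow> complex. (\<forall>k<Suc m. X (F k)) \<and> f = (\<lambda>x. \<Sum>k<Suc m. F k x))" for f
  have Y1: "Y f" if "X f" for f
    using that unfolding Y_def by (intro exI[of _ 0] exI[of _ "\<lambda>_. f"]) auto
  have Y_add1: "Y (\<lambda>x. f x + g x)" if "Y f" "X g" for f g
  proof -
    obtain m F where F: "\<forall>k<Suc m. X (F k)" "f = (\<lambda>x. \<Sum>k<Suc m. F k x)" using \<open>Y f\<close> Y_def by blast
    show ?thesis unfolding Y_def
      by (rule exI[of _ "Suc m"], rule exI[of _ "F (Suc m := g)"])
        (use F that in \<open>auto simp: less_Suc_eq\<close>)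
  qed
  have sum_in: "(\<forall>k<Suc m. X (F k)) \<Longrightarrow> (\<lambda>x. \<Sum>k<Suc m. F k x) differentiable (at x)
     \<and> rapidly_decreasing (\<lambda>x. \<Sum>k<Suc m. F k x) \<and> Y (partial_deriv i (\<lambda>x. \<Sum>k<Suc m. F k x))"
    for m :: nat and F x i
  proof (induction m)
    case 0
    then obtain g h where gh: "X g" "X h" "partial_deriv i (F 0) = (\<lambda>x. g x + h x)"
      using partial[of "F 0" i] by auto
    then have "Y (partial_deriv i (F 0))" using Y_add1[OF Y1] by metis
    moreover have "(\<lambda>x. \<Sum>k<Suc 0. F k x) = F 0" by auto
    ultimately show ?case using diff dec 0 by auto
  next
    case (Suc m)
    let ?f = "\<lambda>x. \<Sum>k<Suc m. F k x" and ?g = "F (Suc m)"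
    have eq: "(\<lambda>x. \<Sum>k<Suc (Suc m). F k x) = (\<lambda>x. ?f x + ?g x)" by auto
    have g: "X ?g" using Suc by auto
    have f: "\<And>x. ?f differentiable (at x)" "rapidly_decreasing ?f" "Y (partial_deriv i ?f)"
    proof -
      have "\<forall>k<Suc m. X (F k)" using Suc.prems by auto
      then have X: "\<And>k x. k < Suc m \<Longrightarrow> F k differentiable (at x)" using diff by blast
      then show "\<And>x. ?f differentiable (at x)" by (intro differentiable_sum) auto
      show "rapidly_decreasing ?f" "Y (partial_deriv i ?f)" using Suc by auto
    qed
    have pd: "partial_deriv i (\<lambda>x. ?f x + ?g x) = (\<lambda>x. partial_deriv i ?f x + partial_deriv i ?g x)"
      using f diff[OF g] by (intro ext partial_deriv_add) auto
    obtain a b where ab: "X a" "X b" "partial_deriv i ?g = (\<lambda>x. a x + b x)"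
      using partial[OF g] by blast
    have "Y (partial_deriv i (\<lambda>x. ?f x + ?g x))"
      unfolding pd ab(3) using Y_add1[OF Y_add1[OF f(3) ab(1)] ab(2)] by (simp add: add.assoc)
    then show ?case
      unfolding eq using f diff[OF g] dec[OF g] by (auto intro!: rapidly_decreasing_add differentiable_add)
  qed
  have "Y f" using Y1 assms(1) by blast
  then show ?thesis
  proof (rule schwartz_coinduct)
    show "f differentiable (at x)" "rapidly_decreasing f" if "Y f" for f x
      using that sum_in unfolding Y_def by blast+
    show "Y (partial_deriv i f)" if "Y f" for f i
    proof -
      obtain m F where "\<forall>k<Suc m. X (F k)" "f = (\<lambda>x. \<Sum>k<Suc m. F k x)" using Y_def \<open>Y f\<close> by blast
      then show ?thesis using sum_in[of m F] by blast
    qed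
  qed
qed

section \<open>Closure properties of the Schwartz space\<close>

lemma schwartz_add:
  assumes "f \<in> schwartz" "g \<in> schwartz"
  shows "(\<lambda>x. f x + g x) \<in> schwartz"
proof -
  define X where "X h \<longleftrightarrow> (\<exists>f\<in>schwartz. \<exists>g\<in>schwartz. h = (\<lambda>x. f x + g x))" for h :: "real^'a \<Rightarrow> complex"
  have "X (\<lambda>x. f x + g x)" using assms by (auto simp: X_def)
  then show ?thesis
  proof (rule schwartz_coinduct)
    fix h i assume "X h"
    then obtain f g where fg: "f \<in> schwartz" "g \<in> schwartz" "h = (\<lambda>x. f x + g x)" by (auto simp: X_def)
    then have "partial_deriv i h = (\<lambda>x. partial_deriv i f x + partial_deriv i g x)"
      using schwartz_differentiable by (auto intro!: ext partial_deriv_add)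
    then show "X (partial_deriv i h)" using fg schwartz_partial_deriv by (auto simp: X_def)
  qed (auto simp: X_def schwartz_differentiable schwartz_rapidly_decreasing rapidly_decreasing_add)
qed

lemma schwartz_cmult:
  assumes "f \<in> schwartz"
  shows "(\<lambda>x. c * f x) \<in> schwartz"
proof -
  define X where "X h \<longleftrightarrow> (\<exists>f\<in>schwartz. h = (\<lambda>x. c * f x))" for h :: "real^'a \<Rightarrow> complex"
  have "X (\<lambda>x. c * f x)" using assms by (auto simp: X_def)
  then show ?thesis
  proof (rule schwartz_coinduct)
    fix h i assume "X h"
    then obtain f where f: "f \<in> schwartz" "h = (\<lambda>x. c * f x)" by (auto simp: X_def)
    then have "partial_deriv i h = (\<lambda>x. c * partial_deriv i f x)"
      using schwartz_differentiable by (auto intro!: ext partial_deriv_cmult)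
    then show "X (partial_deriv i h)" using f schwartz_partial_deriv by (auto simp: X_def)
  next
    fix h assume "X h"
    then show "rapidly_decreasing h"
      by (auto simp: X_def schwartz_rapidly_decreasing intro!: rapidly_decreasing_bounded_mult[where B = "norm c"])
  qed (auto simp: X_def simp: schwartz_differentiable intro!: differentiable_mult)
qed

lemma schwartz_zero [simp]: "(\<lambda>x. 0) \<in> schwartz"
  by (rule schwartz_coinduct[where X = "\<lambda>f. f = (\<lambda>x. 0)"]) (auto simp: rapidly_decreasing_def)

lemma schwartz_diff:
  assumes "f \<in> schwartz" "g \<in> schwartz"
  shows "(\<lambda>x. f x - g x) \<in> schwartz"
  using schwartz_add[OF assms(1) schwartz_cmult[OF assms(2), of "-1"]] by simp

lemma schwartz_sum:
  "(\<And>i. i \<in> I \<Longrightarrow> f i \<in> schwartz) \<Longrightarrow> (\<lambda>x. \<Sum>i\<in>I. f i x) \<in> schwartz"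
  by (induction I rule: infinite_finite_induct) (auto intro: schwartz_add)

lemma schwartz_cnj:
  assumes "f \<in> schwartz"
  shows "(\<lambda>x. cnj (f x)) \<in> schwartz"
proof -
  define X where "X h \<longleftrightarrow> (\<exists>f\<in>schwartz. h = (\<lambda>x. cnj (f x)))" for h :: "real^'a \<Rightarrow> complex"
  have "X (\<lambda>x. cnj (f x))" using assms by (auto simp: X_def)
  then show ?thesis
  proof (rule schwartz_coinduct)
    fix h i assume "X h"
    then obtain f where f: "f \<in> schwartz" "h = (\<lambda>x. cnj (f x))" by (auto simp: X_def)
    then have "partial_deriv i h = (\<lambda>x. cnj (partial_deriv i f x))"
      using schwartz_differentiable by (auto intro!: ext partial_deriv_cnj)
    then show "X (partial_deriv i h)" using f schwartz_partial_deriv by (auto simp: X_def)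
  next
    fix h x assume "X h"
    then show "h differentiable (at x)"
      using bounded_linear.has_derivative[OF bounded_linear_cnj] schwartz_differentiable
      unfolding X_def differentiable_def by blast
  next
    fix h assume "X h"
    then show "rapidly_decreasing h"
      unfolding X_def by (auto dest!: schwartz_rapidly_decreasing simp: rapidly_decreasing_def)
  qed
qed

lemma schwartz_mult:
  assumes "f \<in> schwartz" "g \<in> schwartz"
  shows "(\<lambda>x. f x * g x) \<in> schwartz"
proof -
  define X where "X h \<longleftrightarrow> (\<exists>f\<in>schwartz. \<exists>g\<in>schwartz. h = (\<lambda>x. f x * g x))" for h :: "real^'a \<Rightarrow> complex"
  have "X (\<lambda>x. f x * g x)" using assms by (auto simp: X_def)
  then show ?thesis
  proof (rule schwartz_coinduct_add)
    fix h i assume "X h"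
    then obtain f g where fg: "f \<in> schwartz" "g \<in> schwartz" "h = (\<lambda>x. f x * g x)" by (auto simp: X_def)
    then have "partial_deriv i h = (\<lambda>x. f x * partial_deriv i g x + partial_deriv i f x * g x)"
      using schwartz_differentiable by (auto intro!: ext partial_deriv_mult)
    moreover have "X (\<lambda>x. f x * partial_deriv i g x)" "X (\<lambda>x. partial_deriv i f x * g x)"
      using fg schwartz_partial_deriv by (auto simp: X_def)
    ultimately show "\<exists>g ha. X g \<and> X ha \<and> partial_deriv i h = (\<lambda>x. g x + ha x)" by blast
  next
    fix h assume "X h"
    then obtain f g where fg: "f \<in> schwartz" "g \<in> schwartz" "h = (\<lambda>x. f x * g x)" by (auto simp: X_def)
    obtain C where "\<And>x. norm (f x) \<le> C" using schwartz_bounded[OF fg(1)] by blast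
    then show "rapidly_decreasing h"
      unfolding fg(3) by (rule rapidly_decreasing_bounded_mult[OF schwartz_rapidly_decreasing[OF fg(2)]])
  qed (auto simp: X_def simp: schwartz_differentiable intro!: differentiable_mult)
qed

lemma schwartz_coord_mult:
  assumes "f \<in> schwartz"
  shows "(\<lambda>x. complex_of_real (x $ i) * f x) \<in> schwartz"
proof -
  \<comment> \<open>Differentiating the factor \<open>x $ i\<close> leaves a bare \<open>f\<close>,
    so the class has to contain the Schwartz functions themselves.\<close>
  define X where "X h \<longleftrightarrow> h \<in> schwartz \<or> (\<exists>f\<in>schwartz. h = (\<lambda>x. complex_of_real (x $ i) * f x))" for h :: "real^'a \<Rightarrow> complex"
  have diff: "(\<lambda>x. complex_of_real (x $ i)) differentiable (at x)" for x :: "real^'a"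
    using has_derivative_coord differentiable_def by blast
  have "X (\<lambda>x. complex_of_real (x $ i) * f x)" using assms by (auto simp: X_def)
  then show ?thesis
  proof (rule schwartz_coinduct_add)
    fix h j assume "X h"
    then consider "h \<in> schwartz" | f where "f \<in> schwartz" "h = (\<lambda>x. complex_of_real (x $ i) * f x)"
      by (auto simp: X_def)
    then show "\<exists>g ha. X g \<and> X ha \<and> partial_deriv j h = (\<lambda>x. g x + ha x)"
    proof cases
      case 1
      then show ?thesis
        by (intro exI[of _ "partial_deriv j h"] exI[of _ "\<lambda>x. 0"]) (auto simp: X_def schwartz_partial_deriv)
    next
      case 2
      have "partial_deriv j h = (\<lambda>x. complex_of_real (x $ i) * partial_deriv j f x + (if i = j then 1 else 0) * f x)"
        unfolding 2(2) by (rule ext, subst partial_deriv_mult)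
          (auto simp: diff schwartz_differentiable[OF 2(1)] partial_deriv_coord)
      moreover have "X (\<lambda>x. complex_of_real (x $ i) * partial_deriv j f x)"
        "X (\<lambda>x. (if i = j then 1 else 0) * f x)"
        using 2(1) schwartz_partial_deriv[OF 2(1)] schwartz_cmult[OF 2(1)] by (auto simp: X_def)
      ultimately show ?thesis by blast
    qed
  next
    fix h assume "X h"
    moreover have "rapidly_decreasing (\<lambda>x. complex_of_real (x $ i) * f x)" if "f \<in> schwartz" for f
      by (rule rapidly_decreasing_dominated[OF schwartz_rapidly_decreasing[OF that], of _ 1 1])
        (auto simp: norm_mult intro!: mult_right_mono order_trans[OF component_le_norm_cart])
    ultimately show "rapidly_decreasing h" by (auto simp: X_def schwartz_rapidly_decreasing)
  qed (auto simp: X_def simp: schwartz_differentiable intro!: differentiable_mult diff)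
qed

text \<open>Solving for \<open>x\<close> bounds its norm by that of the image point; the factor then
  lets decay at the image point be read as decay in \<open>x\<close>.\<close>

lemma norm_affine_bound:
  fixes x b :: "'a::real_normed_vector"
  assumes "a \<noteq> 0"
  shows "1 + norm x \<le> (1 + (1 + norm b) / \<bar>a\<bar>) * (1 + norm (a *\<^sub>R x + b))"
proof -
  have "norm (a *\<^sub>R x) \<le> norm (a *\<^sub>R x + b) + norm b"
    using norm_triangle_ineq4[of "a *\<^sub>R x + b" b] by simp
  then have "norm x \<le> (norm (a *\<^sub>R x + b) + norm b) / \<bar>a\<bar>"
    using assms by (simp add: field_simps)
  also have "\<dots> \<le> (1 + norm b) / \<bar>a\<bar> * (1 + norm (a *\<^sub>R x + b))"
    using assms by (simp add: field_simps)
  finally have "norm x \<le> (1 + norm b) / \<bar>a\<bar> * (1 + norm (a *\<^sub>R x + b))" .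
  moreover have "1 \<le> 1 + norm (a *\<^sub>R x + b)" by simp
  ultimately show ?thesis unfolding distrib_right mult_1_left by (rule add_mono[rotated])
qed

lemma schwartz_affine:
  assumes "f \<in> schwartz" and "a \<noteq> 0"
  shows "(\<lambda>x. f (a *\<^sub>R x + b)) \<in> schwartz"
proof -
  define X where "X h \<longleftrightarrow> (\<exists>f\<in>schwartz. h = (\<lambda>x. f (a *\<^sub>R x + b)))" for h :: "real^'a \<Rightarrow> complex"
  have "X (\<lambda>x. f (a *\<^sub>R x + b))" using assms by (auto simp: X_def)
  then show ?thesis
  proof (rule schwartz_coinduct)
    fix h i assume "X h"
    then obtain f where f: "f \<in> schwartz" "h = (\<lambda>x. f (a *\<^sub>R x + b))" by (auto simp: X_def)
    then have "partial_deriv i h = (\<lambda>x. (\<lambda>y. of_real a * partial_deriv i f y) (a *\<^sub>R x + b))"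
      using schwartz_differentiable by (auto intro!: ext partial_deriv_affine)
    then show "X (partial_deriv i h)" unfolding X_def
      by (rule bexI[of _ "\<lambda>y. of_real a * partial_deriv i f y"])
        (auto intro!: schwartz_cmult schwartz_partial_deriv f(1))
  next
    fix h x assume "X h"
    then show "h differentiable (at x)"
      using has_derivative_affine schwartz_differentiable unfolding X_def differentiable_def by blast
  next
    fix h assume "X h"
    then obtain f where f: "f \<in> schwartz" "h = (\<lambda>x. f (a *\<^sub>R x + b))" by (auto simp: X_def)
    show "rapidly_decreasing h"
      unfolding rapidly_decreasing_def
    proof
      fix k
      obtain C where C: "\<And>x. (1 + norm x) ^ k * norm (f x) \<le> C" using schwartz_decay[OF f(1)] by blast
      let ?K = "1 + (1 + norm b) / \<bar>a\<bar>"
      have "(1 + norm x) ^ k * norm (h x) \<le> ?K ^ k * C" for x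
      proof -
        have "(1 + norm x) ^ k \<le> (?K * (1 + norm (a *\<^sub>R x + b))) ^ k"
          using assms by (intro power_mono norm_affine_bound) auto
        then have "(1 + norm x) ^ k * norm (h x) \<le> ?K ^ k * ((1 + norm (a *\<^sub>R x + b)) ^ k * norm (h x))"
          by (metis mult.assoc mult_right_mono norm_ge_zero power_mult_distrib)
        also have "\<dots> \<le> ?K ^ k * C"
          unfolding f(2) by (intro mult_left_mono C) auto
        finally show ?thesis .
      qed
      then show "\<exists>C. \<forall>x. (1 + norm x) ^ k * norm (h x) \<le> C" by blast
    qed
  qed
qed

section \<open>Integration\<close>

text \<open>Each factor \<open>1 + (x \<bullet> b)\<^sup>2\<close> over the basis is at most
  \<open>(1 + norm x)\<^sup>2\<close>, so the weight lies below a product of one-dimensional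
  functions \<open>1 / (1 + t\<^sup>2)\<close> with finite integral. The exponent
  \<open>2 * CARD('n)\<close> counts these factors.\<close>

lemma integrable_weight:
  "integrable lborel (\<lambda>x::real^'n::finite. inverse ((1 + norm x) ^ (2 * CARD('n))))"
proof -
  have S: "integrable lborel (\<lambda>x::real. inverse (1 + x\<^sup>2))"
    using integrable_inverse_1_plus_square by (simp add: set_integrable_def)
  have fin: "(\<integral>\<^sup>+(x::real). ennreal (inverse (1 + x\<^sup>2)) \<partial>lborel) < \<infinity>"
    using S by (auto simp: integrable_iff_bounded)
  have "(\<integral>\<^sup>+(x::real^'n). (\<Prod>b\<in>Basis. ennreal (inverse (1 + (x \<bullet> b)\<^sup>2))) \<partial>lborel)
      = (\<Prod>b\<in>(Basis::(real^'n) set). (\<integral>\<^sup>+(x::real). ennreal (inverse (1 + x\<^sup>2)) \<partial>lborel))"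
    by (rule nn_integral_lborel_prod) auto
  also have "\<dots> < \<infinity>"
    using fin by (simp add: power_less_top_ennreal)
  finally have fin': "(\<integral>\<^sup>+(x::real^'n). (\<Prod>b\<in>Basis. ennreal (inverse (1 + (x \<bullet> b)\<^sup>2))) \<partial>lborel) < \<infinity>" .
  have le: "ennreal (inverse ((1 + norm x) ^ (2 * CARD('n)))) \<le> (\<Prod>b\<in>Basis. ennreal (inverse (1 + (x \<bullet> b)\<^sup>2)))"
    for x :: "real^'n"
  proof -
    have *: "1 + (x \<bullet> b)\<^sup>2 \<le> (1 + norm x)\<^sup>2" if "b \<in> Basis" for b
    proof -
      have "(x \<bullet> b)\<^sup>2 \<le> (norm x)\<^sup>2" using Basis_le_norm[OF that, of x] by (metis abs_norm_cancel abs_le_square_iff)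
      then have "(x \<bullet> b)\<^sup>2 \<le> (norm x)\<^sup>2 + 2 * norm x" using norm_ge_zero[of x] by linarith
      then show ?thesis by (simp add: power2_sum)
    qed
    have "(\<Prod>b\<in>(Basis::(real^'n) set). 1 + (x \<bullet> b)\<^sup>2) \<le> (\<Prod>b\<in>(Basis::(real^'n) set). (1 + norm x)\<^sup>2)"
      by (intro prod_mono) (auto simp: * intro: add_nonneg_nonneg)
    also have "\<dots> = (1 + norm x) ^ (2 * CARD('n))" by (simp add: power_mult)
    finally have "inverse ((1 + norm x) ^ (2 * CARD('n))) \<le> inverse (\<Prod>b\<in>(Basis::(real^'n) set). 1 + (x \<bullet> b)\<^sup>2)"
      by (intro le_imp_inverse_le prod_pos) (auto intro: add_pos_nonneg)
    also have "\<dots> = (\<Prod>b\<in>(Basis::(real^'n) set). inverse (1 + (x \<bullet> b)\<^sup>2))"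
      using prod_inversef[of "\<lambda>b. 1 + (x \<bullet> b)\<^sup>2" "Basis::(real^'n) set"] by (simp add: o_def)
    finally show ?thesis by (subst prod_ennreal) (auto intro: ennreal_leI add_nonneg_nonneg)
  qed
  show ?thesis
  proof (rule integrableI_bounded)
    have "(\<integral>\<^sup>+(x::real^'n). ennreal (norm (inverse ((1 + norm x) ^ (2 * CARD('n))))) \<partial>lborel) \<le>
       (\<integral>\<^sup>+(x::real^'n). (\<Prod>b\<in>Basis. ennreal (inverse (1 + (x \<bullet> b)\<^sup>2))) \<partial>lborel)"
      by (rule nn_integral_mono) (use le in auto)
    with fin' show "(\<integral>\<^sup>+(x::real^'n). ennreal (norm (inverse ((1 + norm x) ^ (2 * CARD('n))))) \<partial>lborel) < \<infinity>"
      by (rule le_less_trans[rotated])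
  qed measurable
qed

lemma rapidly_decreasing_integrable:
  fixes f :: "real^'n::finite \<Rightarrow> complex"
  assumes "rapidly_decreasing f" and [measurable]: "f \<in> borel_measurable borel"
  shows "integrable lborel (\<lambda>x. (1 + norm x) ^ m *\<^sub>R f x)"
proof -
  obtain C where C: "\<And>x. (1 + norm x) ^ (m + 2 * CARD('n)) * norm (f x) \<le> C"
    using assms unfolding rapidly_decreasing_def by meson
  have "integrable lborel (\<lambda>x::real^'n. C * inverse ((1 + norm x) ^ (2 * CARD('n))))"
    by (intro integrable_mult_right integrable_weight)
  then show ?thesis
  proof (rule Bochner_Integration.integrable_bound, measurable, intro AE_I2)
    fix x :: "real^'n"
    have "norm ((1 + norm x) ^ m *\<^sub>R f x) = (1 + norm x) ^ m * norm (f x)" by simp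
    also have "\<dots> \<le> C * inverse ((1 + norm x) ^ (2 * CARD('n)))"
      using C[of x] by (simp add: power_add pos_le_divide_eq divide_inverse[symmetric] mult_ac add_pos_nonneg)
    also have "\<dots> \<le> norm (C * inverse ((1 + norm x) ^ (2 * CARD('n))))" by simp
    finally show "norm ((1 + norm x) ^ m *\<^sub>R f x) \<le> norm (C * inverse ((1 + norm x) ^ (2 * CARD('n))))" .
  qed
qed

lemma schwartz_integrable_weight:
  "f \<in> schwartz \<Longrightarrow> integrable lborel (\<lambda>x. (1 + norm x) ^ m *\<^sub>R f x)"
  by (intro rapidly_decreasing_integrable schwartz_rapidly_decreasing schwartz_measurable)

lemma schwartz_integrable: "f \<in> schwartz \<Longrightarrow> integrable lborel f"
  using schwartz_integrable_weight[of f 0] by simp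

lemma schwartz_integrable_norm_mult:
  assumes "f \<in> schwartz"
  shows "integrable lborel (\<lambda>x. norm x ^ m * norm (f x))"
proof (rule Bochner_Integration.integrable_bound[OF schwartz_integrable_weight[OF assms, of m]])
  have [measurable]: "f \<in> borel_measurable borel" using assms by measurable
  show "(\<lambda>x. norm x ^ m * norm (f x)) \<in> borel_measurable lborel" by measurable
  show "AE x in lborel. norm (norm x ^ m * norm (f x)) \<le> norm ((1 + norm x) ^ m *\<^sub>R f x)"
    by (intro AE_I2) (auto intro!: mult_right_mono power_mono)
qed

lemma integrable_bounded_mult:
  fixes f g :: "'a \<Rightarrow> complex"
  assumes "integrable M f" "g \<in> borel_measurable M" "\<And>x. norm (g x) \<le> B"
  shows "integrable M (\<lambda>x. g x * f x)"
proof (rule Bochner_Integration.integrable_bound)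
  show "integrable M (\<lambda>x. B * norm (f x))" using assms(1) by auto
  show "(\<lambda>x. g x * f x) \<in> borel_measurable M" using assms by auto
  show "AE x in M. norm (g x * f x) \<le> norm (B * norm (f x))"
    using assms(3) by (intro AE_I2) (auto simp: norm_mult intro!: mult_right_mono order_trans[OF _ abs_ge_self])
qed

lemma
  fixes f :: "'a::euclidean_space \<Rightarrow> 'b::{banach, second_countable_topology}"
  assumes "a \<noteq> 0"
  shows lborel_integrable_affine_iff: "f \<in> borel_measurable borel \<Longrightarrow>
      integrable lborel (\<lambda>x. f (b + a *\<^sub>R x)) \<longleftrightarrow> integrable lborel f"
    and lborel_integral_affine: "f \<in> borel_measurable borel \<Longrightarrow>
      (LINT x|lborel. f (b + a *\<^sub>R x)) = (LINT x|lborel. f x) /\<^sub>R \<bar>a\<bar> ^ DIM('a)"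
proof -
  assume [measurable]: "f \<in> borel_measurable borel"
  show "integrable lborel (\<lambda>x. f (b + a *\<^sub>R x)) \<longleftrightarrow> integrable lborel f"
  proof -
    have "integrable lborel f \<longleftrightarrow> integrable lborel (\<lambda>x. \<bar>a\<bar> ^ DIM('a) *\<^sub>R f (b + a *\<^sub>R x))"
      using assms by (subst lborel_affine[of a b]) (auto simp: integrable_density integrable_distr_eq)
    also have "\<dots> \<longleftrightarrow> integrable lborel (\<lambda>x. f (b + a *\<^sub>R x))"
      using assms integrable_scaleR_right[of "inverse (\<bar>a\<bar> ^ DIM('a))" lborel "\<lambda>x. \<bar>a\<bar> ^ DIM('a) *\<^sub>R f (b + a *\<^sub>R x)"]
      by auto
    finally show ?thesis by simp
  qed
  have "(LINT x|lborel. f x) = \<bar>a\<bar> ^ DIM('a) *\<^sub>R (LINT x|lborel. f (b + a *\<^sub>R x))"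
    using assms by (subst lborel_affine[of a b]) (auto simp: integral_density integral_distr)
  then show "(LINT x|lborel. f (b + a *\<^sub>R x)) = (LINT x|lborel. f x) /\<^sub>R \<bar>a\<bar> ^ DIM('a)"
    using assms by simp
qed

lemma lborel_nn_integral_affine:
  fixes f :: "'a::euclidean_space \<Rightarrow> ennreal"
  assumes "a \<noteq> 0" and [measurable]: "f \<in> borel_measurable borel"
  shows "(\<integral>\<^sup>+x. f x \<partial>lborel) = ennreal (\<bar>a\<bar> ^ DIM('a)) * (\<integral>\<^sup>+x. f (b + a *\<^sub>R x) \<partial>lborel)"
  using assms by (subst lborel_affine[of a b]) (auto simp: nn_integral_density nn_integral_distr nn_integral_cmult)

lemma lborel_integral_translate:
  fixes f :: "'a::euclidean_space \<Rightarrow> 'b::{banach, second_countable_topology}"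
  shows "f \<in> borel_measurable borel \<Longrightarrow> (LINT x|lborel. f (x + b)) = (LINT x|lborel. f x)"
  using lborel_integral_affine[of 1 f b] by (simp add: add.commute)

section \<open>The Fourier transform on the Schwartz space\<close>

lemma cis_measurable [measurable]:
  "f \<in> borel_measurable M \<Longrightarrow> (\<lambda>x. cis (f x)) \<in> borel_measurable M"
  unfolding cis_conv_exp by measurable

lemma fourier_integrable:
  fixes f :: "real^'n::finite \<Rightarrow> complex"
  assumes "integrable lborel f"
  shows "integrable lborel (\<lambda>x. cis (- (x \<bullet> \<xi>)) * f x)"
  by (rule integrable_bounded_mult[OF assms, where B = 1]) auto

lemma inv_fourier_eq: "inv_fourier f x = fourier f (- x)"
  by (simp add: inv_fourier_def fourier_def inner_commute)

lemma fourier_cmult: "fourier (\<lambda>x. c * f x) \<xi> = c * fourier f \<xi>"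
proof -
  have "(LINT x|lborel. cis (- (x \<bullet> \<xi>)) * (c * f x)) = (LINT x|lborel. c * (cis (- (x \<bullet> \<xi>)) * f x))"
    by (simp add: mult_ac)
  then show ?thesis by (simp add: fourier_def)
qed

lemma fourier_add:
  "integrable lborel f \<Longrightarrow> integrable lborel g \<Longrightarrow> fourier (\<lambda>x. f x + g x) \<xi> = fourier f \<xi> + fourier g \<xi>"
  by (simp add: fourier_def distrib_left fourier_integrable)

lemma fourier_translate:
  fixes f :: "real^'n::finite \<Rightarrow> complex"
  assumes [measurable]: "f \<in> borel_measurable borel"
  shows "fourier (\<lambda>x. f (x + b)) \<xi> = cis (b \<bullet> \<xi>) * fourier f \<xi>"
proof -
  have "(LINT x|lborel. cis (- (x \<bullet> \<xi>)) * f (x + b)) = (LINT x|lborel. cis (b \<bullet> \<xi>) * (cis (- ((x + b) \<bullet> \<xi>)) * f (x + b)))"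
    by (simp add: mult.assoc[symmetric] cis_mult inner_add_left)
  also have "\<dots> = cis (b \<bullet> \<xi>) * (LINT x|lborel. cis (- ((x + b) \<bullet> \<xi>)) * f (x + b))"
    by simp
  also have "(LINT x|lborel. cis (- ((x + b) \<bullet> \<xi>)) * f (x + b)) = (LINT x|lborel. cis (- (x \<bullet> \<xi>)) * f x)"
    by (rule lborel_integral_translate) measurable
  finally show ?thesis by (simp add: fourier_def)
qed

lemma fourier_scale:
  fixes f :: "real^'n::finite \<Rightarrow> complex"
  assumes "a \<noteq> 0" and [measurable]: "f \<in> borel_measurable borel"
  shows "fourier (\<lambda>x. f (a *\<^sub>R x)) \<xi> = fourier f (\<xi> /\<^sub>R a) / of_real (\<bar>a\<bar> ^ CARD('n))"
proof -
  have "(LINT x|lborel. cis (- (x \<bullet> \<xi>)) * f (a *\<^sub>R x)) = (LINT x|lborel. (\<lambda>y. cis (- (y \<bullet> (\<xi> /\<^sub>R a))) * f y) (0 + a *\<^sub>R x))"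
    using assms(1) by (simp add: mult.assoc[symmetric])
  also have "\<dots> = (LINT x|lborel. cis (- (x \<bullet> (\<xi> /\<^sub>R a))) * f x) /\<^sub>R \<bar>a\<bar> ^ CARD('n)"
  proof -
    have "(\<lambda>y. cis (- (y \<bullet> (\<xi> /\<^sub>R a))) * f y) \<in> borel_measurable borel" by measurable
    from lborel_integral_affine[OF assms(1) this, of 0] show ?thesis by simp
  qed
  finally show ?thesis by (simp add: fourier_def scaleR_conv_of_real field_simps)
qed

lemma norm_fourier_le:
  fixes f :: "real^'n::finite \<Rightarrow> complex"
  shows "norm (fourier f \<xi>) \<le> (2 * pi) powr (- real CARD('n) / 2) * (LINT x|lborel. norm (f x))"
proof -
  have "norm (LINT x|lborel. cis (- (x \<bullet> \<xi>)) * f x) \<le> (LINT x|lborel. norm (cis (- (x \<bullet> \<xi>)) * f x))"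
    by (rule integral_norm_bound)
  also have "\<dots> = (LINT x|lborel. norm (f x))" by (simp add: norm_mult)
  finally show ?thesis by (simp add: fourier_def norm_mult mult_left_mono)
qed

lemma norm_cis_remainder: "norm (cis t - 1 - \<i> * of_real t) \<le> t\<^sup>2 / 2"
  using iexp_approx1[of t 1] by (simp add: cis_conv_exp numeral_2_eq_2 algebra_simps power2_eq_square abs_mult)

text \<open>Differentiation under the integral with an explicit remainder: the second-order Taylor
  error of \<open>cis\<close> is quadratic in \<open>x \<bullet> (y - \<xi>)\<close>, and the second
  moment of \<open>norm (f x)\<close> is finite. This gives the total derivative directly, not only
  its partials.\<close>

lemma fourier_has_derivative:
  fixes f :: "real^'n::finite \<Rightarrow> complex"
  assumes f: "f \<in> schwartz"
  shows "(fourier f has_derivative (\<lambda>h. fourier (\<lambda>x. - \<i> * of_real (x \<bullet> h) * f x) \<xi>)) (at \<xi>)"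
proof -
  note [measurable] = schwartz_measurable[OF f]
  define c where "c = (2 * pi) powr (- real CARD('n) / 2)"
  have c0: "c \<ge> 0" by (simp add: c_def)
  have int_h: "integrable lborel (\<lambda>x. - \<i> * of_real (x \<bullet> h) * f x)" for h
  proof (rule Bochner_Integration.integrable_bound)
    show "integrable lborel (\<lambda>x. norm h * (norm x ^ 1 * norm (f x)))"
      by (intro integrable_mult_right schwartz_integrable_norm_mult f)
    show "(\<lambda>x. - \<i> * complex_of_real (x \<bullet> h) * f x) \<in> borel_measurable lborel" by measurable
    have "\<bar>x \<bullet> h\<bar> * norm (f x) \<le> norm h * (norm x * norm (f x))" for x
      using mult_right_mono[OF Cauchy_Schwarz_ineq2[of x h], of "norm (f x)"] by (simp add: mult_ac)
    then show "AE x in lborel. norm (- \<i> * complex_of_real (x \<bullet> h) * f x) \<le> norm (norm h * (norm x ^ 1 * norm (f x)))"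
      by (intro AE_I2) (simp add: norm_mult)
  qed
  let ?D = "\<lambda>h. fourier (\<lambda>x. - \<i> * of_real (x \<bullet> h) * f x) \<xi>"
  show ?thesis
  proof (rule has_derivativeI_sandwich[where e = 1])
    show "bounded_linear ?D"
    proof (rule bounded_linear_intro)
      show "?D (h + k) = ?D h + ?D k" for h k
        by (subst fourier_add[OF int_h int_h, symmetric]) (simp add: inner_add_right algebra_simps)
      show "?D (r *\<^sub>R h) = r *\<^sub>R ?D h" for r h
        unfolding scaleR_conv_of_real
        by (subst fourier_cmult[symmetric]) (simp add: algebra_simps of_real_def)
      show "norm (?D h) \<le> norm h * (c * (LINT x|lborel. norm x * norm (f x)))" for h
      proof -
        have "(LINT x|lborel. norm (- \<i> * of_real (x \<bullet> h) * f x)) \<le> (LINT x|lborel. norm h * (norm x * norm (f x)))"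
        proof (rule integral_mono)
          show "integrable lborel (\<lambda>x. norm (- \<i> * of_real (x \<bullet> h) * f x))" using int_h by (rule integrable_norm)
          show "integrable lborel (\<lambda>x. norm h * (norm x * norm (f x)))"
            using schwartz_integrable_norm_mult[OF f, of 1] by (intro integrable_mult_right) simp
          show "norm (- \<i> * of_real (x \<bullet> h) * f x) \<le> norm h * (norm x * norm (f x))" for x
            using mult_right_mono[OF Cauchy_Schwarz_ineq2[of x h], of "norm (f x)"] by (simp add: norm_mult mult_ac)
        qed
        then have "c * (LINT x|lborel. norm (- \<i> * of_real (x \<bullet> h) * f x)) \<le> c * (norm h * (LINT x|lborel. norm x * norm (f x)))"
          using c0 by (intro mult_left_mono) auto
        from order_trans[OF norm_fourier_le[of "\<lambda>x. - \<i> * of_real (x \<bullet> h) * f x" \<xi>, folded c_def] this]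
        show ?thesis by (simp only: mult_ac)
      qed
    qed
    \<comment> \<open>The remainder is at most \<open>K\<close> times the squared distance, so its
      quotient by the distance tends to 0.\<close>
    define K where "K = c * (LINT x|lborel. norm x ^ 2 * norm (f x))"
    show "norm ((fourier f y - fourier f \<xi>) - ?D (y - \<xi>)) / norm (y - \<xi>) \<le> K * norm (y - \<xi>)" if "y \<noteq> \<xi>" for y
    proof -
      let ?r = "\<lambda>x. cis (- (x \<bullet> y)) - cis (- (x \<bullet> \<xi>)) - cis (- (x \<bullet> \<xi>)) * (- \<i> * of_real (x \<bullet> (y - \<xi>)))"
      have r: "norm (?r x) \<le> norm (y - \<xi>) ^ 2 * norm x ^ 2" for x
      proof -
        let ?t = "- (x \<bullet> (y - \<xi>))"
        have "cis (- (x \<bullet> y)) = cis (- (x \<bullet> \<xi>)) * cis ?t" by (simp add: cis_mult inner_diff_right)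
        then have "?r x = cis (- (x \<bullet> \<xi>)) * (cis ?t - 1 - \<i> * of_real ?t)" by (simp add: algebra_simps)
        then have "norm (?r x) \<le> ?t\<^sup>2 / 2" using norm_cis_remainder[of ?t] by (simp add: norm_mult)
        also have "\<dots> \<le> ?t\<^sup>2" by simp
        also have "\<dots> \<le> (norm x * norm (y - \<xi>))\<^sup>2"
          using Cauchy_Schwarz_ineq2[of x "y - \<xi>"] by (subst abs_le_square_iff[symmetric]) (simp add: abs_mult)
        finally show ?thesis by (simp add: power_mult_distrib mult.commute)
      qed
      have "fourier f y - fourier f \<xi> - ?D (y - \<xi>) = of_real c * (LINT x|lborel. ?r x * f x)"
      proof -
        have "(LINT x|lborel. ?r x * f x) = (LINT x|lborel. (cis (- (x \<bullet> y)) * f x - cis (- (x \<bullet> \<xi>)) * f x) -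
            cis (- (x \<bullet> \<xi>)) * (- \<i> * of_real (x \<bullet> (y - \<xi>)) * f x))"
          by (intro Bochner_Integration.integral_cong) (auto simp: algebra_simps)
        also have int_r: "\<dots> = (LINT x|lborel. cis (- (x \<bullet> y)) * f x) - (LINT x|lborel. cis (- (x \<bullet> \<xi>)) * f x) -
           (LINT x|lborel. cis (- (x \<bullet> \<xi>)) * (- \<i> * of_real (x \<bullet> (y - \<xi>)) * f x))"
          by (simp only: Bochner_Integration.integral_diff Bochner_Integration.integrable_diff
              fourier_integrable schwartz_integrable f int_h)
        finally show ?thesis unfolding fourier_def c_def[symmetric] by (simp only: right_diff_distrib)
      qed
      also have "norm \<dots> \<le> c * (norm (y - \<xi>) ^ 2 * (LINT x|lborel. norm x ^ 2 * norm (f x)))"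
      proof -
        have "norm (LINT x|lborel. ?r x * f x) \<le> (LINT x|lborel. norm (y - \<xi>) ^ 2 * (norm x ^ 2 * norm (f x)))"
        proof (rule Bochner_Integration.integral_norm_bound_integral)
          show int: "integrable lborel (\<lambda>x. (norm (y - \<xi>))\<^sup>2 * ((norm x)\<^sup>2 * norm (f x)))"
            by (intro integrable_mult_right schwartz_integrable_norm_mult f)
          show bd: "norm (?r x * f x) \<le> (norm (y - \<xi>))\<^sup>2 * ((norm x)\<^sup>2 * norm (f x))" for x
            using mult_right_mono[OF r, of "norm (f x)"] by (simp add: norm_mult mult.assoc)
          show "integrable lborel (\<lambda>x. ?r x * f x)"
            by (rule Bochner_Integration.integrable_bound[OF int], measurable) (use bd in \<open>auto intro!: AE_I2\<close>)
        qed
        then show ?thesis using c0 by (simp add: norm_mult mult_left_mono)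
      qed
      finally show ?thesis using that by (simp add: K_def divide_le_eq power2_eq_square mult_ac)
    qed
    show "((\<lambda>y. K * norm (y - \<xi>)) \<longlongrightarrow> 0) (at \<xi>)"
      by (auto intro!: tendsto_eq_intros)
  qed simp
qed

section \<open>Exchange of derivatives and coordinate factors under the Fourier transform\<close>

lemma partial_deriv_fourier:
  fixes f :: "real^'n::finite \<Rightarrow> complex"
  assumes "f \<in> schwartz"
  shows "partial_deriv i (fourier f) = fourier (\<lambda>x. - \<i> * (of_real (x $ i) * f x))"
  by (rule ext, subst partial_deriv_eq[OF fourier_has_derivative[OF assms]])
    (simp add: inner_axis mult.assoc)

lemma schwartz_has_vector_derivative_axis:
  assumes "f \<in> schwartz"
  shows "((\<lambda>s. f (x + s *\<^sub>R axis i 1)) has_vector_derivative partial_deriv i f (x + s *\<^sub>R axis i 1)) (at s within A)"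
proof -
  have 1: "((\<lambda>s. x + s *\<^sub>R axis i 1) has_derivative (\<lambda>h. h *\<^sub>R axis i 1)) (at s)"
    by (auto intro!: derivative_eq_intros)
  let ?D = "frechet_derivative f (at (x + s *\<^sub>R axis i 1))"
  have d: "f differentiable (at (x + s *\<^sub>R axis i 1))" by (rule schwartz_differentiable[OF assms])
  have lin: "?D (h *\<^sub>R axis i 1) = h *\<^sub>R ?D (axis i 1)" for h
    using linear_frechet_derivative[OF d] by (rule linear_scale)
  from has_derivative_compose[OF 1 d[unfolded frechet_derivative_works]]
  show ?thesis unfolding has_vector_derivative_def partial_deriv_def lin
    by (rule has_derivative_at_withinI)
qed

text \<open>Steps \<open>1 / Suc m\<close> make the derivative a limit of a sequence, the form in
  which dominated convergence is applied to it.\<close>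

lemma difference_quotient_LIMSEQ:
  fixes g :: "real \<Rightarrow> 'a::real_normed_vector"
  assumes "(g has_vector_derivative D) (at 0)"
  shows "(\<lambda>m. real (Suc m) *\<^sub>R (g (1 / real (Suc m)) - g 0)) \<longlonglongrightarrow> D"
proof -
  have "(\<lambda>h. norm (g (0 + h) - g 0 - h *\<^sub>R D) / norm h) \<midarrow>0\<rightarrow> 0"
    using assms unfolding has_vector_derivative_def has_derivative_at by auto
  moreover have "filterlim (\<lambda>m. 1 / real (Suc m)) (at 0) sequentially"
    unfolding filterlim_at using LIMSEQ_inverse_real_of_nat by (simp add: inverse_eq_divide)
  ultimately have "(\<lambda>m. norm (g (0 + 1 / real (Suc m)) - g 0 - (1 / real (Suc m)) *\<^sub>R D) / norm (1 / real (Suc m))) \<longlonglongrightarrow> 0"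
    by (rule filterlim_compose)
  moreover have "norm (g (0 + 1 / real (Suc m)) - g 0 - (1 / real (Suc m)) *\<^sub>R D) / norm (1 / real (Suc m))
      = norm (real (Suc m) *\<^sub>R (g (1 / real (Suc m)) - g 0) - D)" for m
  proof -
    have "real (Suc m) *\<^sub>R (g (1 / real (Suc m)) - g 0) - D
        = real (Suc m) *\<^sub>R (g (0 + 1 / real (Suc m)) - g 0 - (1 / real (Suc m)) *\<^sub>R D)"
      by (simp add: scaleR_diff_right del: of_nat_Suc)
    then have "norm (real (Suc m) *\<^sub>R (g (1 / real (Suc m)) - g 0) - D)
       = norm (g (0 + 1 / real (Suc m)) - g 0 - (1 / real (Suc m)) *\<^sub>R D) * real (Suc m)"
      by (simp del: of_nat_Suc)
    then show ?thesis by (simp del: of_nat_Suc)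
  qed
  ultimately have "(\<lambda>m. norm (real (Suc m) *\<^sub>R (g (1 / real (Suc m)) - g 0) - D)) \<longlonglongrightarrow> 0" by simp
  then have "(\<lambda>m. real (Suc m) *\<^sub>R (g (1 / real (Suc m)) - g 0) - D) \<longlonglongrightarrow> 0"
    by (rule tendsto_norm_zero_cancel)
  then show ?thesis by (rule LIM_zero_cancel)
qed

lemma norm_schwartz_difference_le:
  assumes f: "f \<in> schwartz" and "0 \<le> t"
    and B: "\<And>s. 0 \<le> s \<Longrightarrow> s \<le> t \<Longrightarrow> norm (partial_deriv i f (x + s *\<^sub>R axis i 1)) \<le> B"
  shows "norm (f (x + t *\<^sub>R axis i 1) - f x) \<le> B * t"
proof -
  have "norm ((\<lambda>s. f (x + s *\<^sub>R axis i 1)) t - (\<lambda>s. f (x + s *\<^sub>R axis i 1)) 0) \<le> B * norm (t - 0)"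
  proof (rule differentiable_bound[of "{0..t}"])
    show "((\<lambda>s. f (x + s *\<^sub>R axis i 1)) has_derivative (\<lambda>h. h *\<^sub>R partial_deriv i f (x + s *\<^sub>R axis i 1))) (at s within {0..t})" for s
      using schwartz_has_vector_derivative_axis[OF f] unfolding has_vector_derivative_def .
    show "onorm (\<lambda>h. h *\<^sub>R partial_deriv i f (x + s *\<^sub>R axis i 1)) \<le> B" if "s \<in> {0..t}" for s
      by (rule onorm_le) (use B[of s] that in \<open>auto simp: mult.commute[of B] intro!: mult_left_mono\<close>)
  qed (use assms in auto)
  then show ?thesis using assms by simp
qed

text \<open>The derivative is approximated by difference quotients \<open>g m\<close>. Their
  transforms are explicit by the translation rule, and dominated convergence passes to the limit
  under the integral.\<close>

lemma fourier_partial_deriv: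
  fixes f :: "real^'n::finite \<Rightarrow> complex"
  assumes f: "f \<in> schwartz"
  shows "fourier (partial_deriv i f) \<xi> = \<i> * of_real (\<xi> $ i) * fourier f \<xi>"
proof -
  note [measurable] = schwartz_measurable[OF f] schwartz_measurable[OF schwartz_partial_deriv[OF f]]
  define t where "t m = 1 / real (Suc m)" for m
  have t: "0 < t m" "t m \<le> 1" for m by (auto simp: t_def)
  define g where "g m x = real (Suc m) *\<^sub>R (f (x + t m *\<^sub>R axis i 1) - f x)" for m x
  have [measurable]: "g m \<in> borel_measurable borel" for m unfolding g_def by measurable
  obtain C where C: "C > 0" "\<And>x. (1 + norm x) ^ (2 * CARD('n)) * norm (partial_deriv i f x) \<le> C"
    using schwartz_decay[OF schwartz_partial_deriv[OF f]] by metis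
  \<comment> \<open>Intermediate points lie within distance 1 of \<open>x\<close>, so the weight at
    \<open>x\<close> is at most twice the weight there. This yields a majorant independent of
    \<open>m\<close>.\<close>
  have gb: "norm (g m x) \<le> C * 2 ^ (2 * CARD('n)) * inverse ((1 + norm x) ^ (2 * CARD('n)))" for m x
  proof -
    let ?B = "C * 2 ^ (2 * CARD('n)) * inverse ((1 + norm x) ^ (2 * CARD('n)))"
    have "norm (f (x + t m *\<^sub>R axis i 1) - f x) \<le> ?B * t m"
    proof (rule norm_schwartz_difference_le[OF f])
      fix s assume s: "0 \<le> s" "s \<le> t m"
      let ?y = "x + s *\<^sub>R axis i 1"
      have "norm x \<le> norm ?y + norm (s *\<^sub>R (axis i 1 :: real^'n))" using norm_triangle_ineq4[of ?y "s *\<^sub>R axis i 1"] by simp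
      also have "norm (s *\<^sub>R (axis i 1 :: real^'n)) \<le> 1" using s t[of m] by (simp add: norm_axis_1)
      finally have "norm x \<le> norm ?y + 1" by simp
      then have "1 + norm x \<le> 1 + (norm ?y + 1)" by simp
      also have "\<dots> \<le> 2 * (1 + norm ?y)" by simp
      finally have "1 + norm x \<le> 2 * (1 + norm ?y)" .
      then have "(1 + norm x) ^ (2 * CARD('n)) \<le> (2 * (1 + norm ?y)) ^ (2 * CARD('n))" by (intro power_mono) auto
      then have "(1 + norm x) ^ (2 * CARD('n)) * norm (partial_deriv i f ?y) \<le> 2 ^ (2 * CARD('n)) * ((1 + norm ?y) ^ (2 * CARD('n)) * norm (partial_deriv i f ?y))"
        unfolding power_mult_distrib mult.assoc[symmetric] by (intro mult_right_mono) auto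
      also have "\<dots> \<le> 2 ^ (2 * CARD('n)) * C" by (intro mult_left_mono C) auto
      finally show "norm (partial_deriv i f ?y) \<le> ?B"
        by (simp add: field_simps add_pos_nonneg)
    qed (use t in \<open>auto simp: less_imp_le\<close>)
    then have "real (Suc m) * norm (f (x + t m *\<^sub>R axis i 1) - f x) \<le> real (Suc m) * (?B * t m)"
      by (intro mult_left_mono) auto
    also have "\<dots> = ?B" by (simp add: t_def)
    finally show ?thesis by (simp add: g_def)
  qed
  have lim1: "(\<lambda>m. LINT x|lborel. cis (- (x \<bullet> \<xi>)) * g m x) \<longlonglongrightarrow> (LINT x|lborel. cis (- (x \<bullet> \<xi>)) * partial_deriv i f x)"
  proof (rule integral_dominated_convergence[where w = "\<lambda>x. C * 2 ^ (2 * CARD('n)) * inverse ((1 + norm x) ^ (2 * CARD('n)))"])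
    show "integrable lborel (\<lambda>x::real^'n. C * 2 ^ (2 * CARD('n)) * inverse ((1 + norm x) ^ (2 * CARD('n))))"
      by (intro integrable_mult_right integrable_weight)
    show "AE x in lborel. (\<lambda>m. cis (- (x \<bullet> \<xi>)) * g m x) \<longlonglongrightarrow> cis (- (x \<bullet> \<xi>)) * partial_deriv i f x"
    proof (intro AE_I2 tendsto_mult tendsto_const)
      fix x
      show "(\<lambda>m. g m x) \<longlonglongrightarrow> partial_deriv i f x"
        using difference_quotient_LIMSEQ[OF schwartz_has_vector_derivative_axis[OF f, of x i 0 UNIV, simplified]]
        by (simp add: g_def t_def)
    qed
    show "AE x in lborel. norm (cis (- (x \<bullet> \<xi>)) * g m x) \<le> C * 2 ^ (2 * CARD('n)) * inverse ((1 + norm x) ^ (2 * CARD('n)))" for m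
      using gb by (intro AE_I2) (simp add: norm_mult)
  qed measurable
  have Fg: "fourier (g m) \<xi> = real (Suc m) *\<^sub>R (cis (t m * \<xi> $ i) - 1) * fourier f \<xi>" for m
  proof -
    have "fourier (g m) \<xi> = fourier (\<lambda>x. of_real (real (Suc m)) * (f (x + t m *\<^sub>R axis i 1) + (-1) * f x)) \<xi>"
      by (simp add: g_def[abs_def] scaleR_conv_of_real del: of_nat_Suc)
    also have "\<dots> = of_real (real (Suc m)) * (fourier (\<lambda>x. f (x + t m *\<^sub>R axis i 1)) \<xi> + (-1) * fourier f \<xi>)"
    proof -
      have i1: "integrable lborel (\<lambda>x. f (x + t m *\<^sub>R axis i 1))"
        using lborel_integrable_affine_iff[of 1 f "t m *\<^sub>R axis i 1"] schwartz_integrable[OF f] by (simp add: add.commute)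
      show ?thesis
        unfolding fourier_cmult by (subst fourier_add) (use i1 schwartz_integrable[OF f] in \<open>auto simp: fourier_cmult[of "-1", simplified]\<close>)
    qed
    also have "fourier (\<lambda>x. f (x + t m *\<^sub>R axis i 1)) \<xi> = cis (t m * \<xi> $ i) * fourier f \<xi>"
      by (subst fourier_translate) (simp_all add: inner_axis')
    finally show ?thesis
      by (simp add: scaleR_conv_of_real algebra_simps del: of_nat_Suc)
  qed
  have "((\<lambda>s. cis (s * \<xi> $ i)) has_vector_derivative \<i> * of_real (\<xi> $ i)) (at 0)"
    using exp_scaleR_has_vector_derivative_right[of "\<i> * of_real (\<xi> $ i)" 0 UNIV]
    by (simp add: cis_conv_exp scaleR_conv_of_real mult_ac)
  from difference_quotient_LIMSEQ[OF this]
  have "(\<lambda>m. real (Suc m) *\<^sub>R (cis (t m * \<xi> $ i) - 1)) \<longlonglongrightarrow> \<i> * of_real (\<xi> $ i)"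
    by (simp add: t_def)
  then have "(\<lambda>m. fourier (g m) \<xi>) \<longlonglongrightarrow> \<i> * of_real (\<xi> $ i) * fourier f \<xi>"
    unfolding Fg by (intro tendsto_mult tendsto_const)
  moreover have "(\<lambda>m. fourier (g m) \<xi>) \<longlonglongrightarrow> fourier (partial_deriv i f) \<xi>"
    unfolding fourier_def by (intro tendsto_mult tendsto_const lim1)
  ultimately show ?thesis using LIMSEQ_unique by blast
qed

lemma norm_le_sum_coords: "norm (x :: real^'n::finite) \<le> (\<Sum>i\<in>UNIV. \<bar>x $ i\<bar>)"
  by (rule norm_le_l1_cart)

text \<open>Each power of the weight costs one derivative: \<open>norm \<xi>\<close> is at most the
  sum of the \<open>\<bar>\<xi> $ i\<bar>\<close>, and multiplying the transform by a coordinate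
  amounts to transforming a partial derivative. The induction therefore runs over all Schwartz
  functions at once.\<close>

lemma rapidly_decreasing_fourier:
  fixes f :: "real^'n::finite \<Rightarrow> complex"
  assumes "f \<in> schwartz"
  shows "rapidly_decreasing (fourier f)"
  unfolding rapidly_decreasing_def
proof
  fix k
  show "\<exists>C. \<forall>\<xi>. (1 + norm \<xi>) ^ k * norm (fourier f \<xi>) \<le> C"
    using assms
  proof (induction k arbitrary: f)
    case 0
    then show ?case using norm_fourier_le[of f] by auto
  next
    case (Suc k)
    obtain C where C: "\<And>\<xi>. (1 + norm \<xi>) ^ k * norm (fourier f \<xi>) \<le> C" using Suc by blast
    have "\<exists>C. \<forall>\<xi>. (1 + norm \<xi>) ^ k * norm (fourier (partial_deriv i f) \<xi>) \<le> C" for i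
      using Suc schwartz_partial_deriv by blast
    then obtain D where D: "\<And>i \<xi>. (1 + norm \<xi>) ^ k * norm (fourier (partial_deriv i f) \<xi>) \<le> D i" by metis
    have "(1 + norm \<xi>) ^ Suc k * norm (fourier f \<xi>) \<le> C + (\<Sum>i\<in>UNIV. D i)" for \<xi>
    proof -
      let ?w = "(1 + norm \<xi>) ^ k" and ?F = "norm (fourier f \<xi>)"
      have "(1 + norm \<xi>) ^ Suc k * ?F = ?w * ?F + norm \<xi> * (?w * ?F)" by (simp add: algebra_simps)
      also have "\<dots> \<le> ?w * ?F + (\<Sum>i\<in>UNIV. \<bar>\<xi> $ i\<bar>) * (?w * ?F)"
        by (intro add_left_mono mult_right_mono norm_le_sum_coords) auto
      also have "\<dots> = ?w * ?F + (\<Sum>i\<in>UNIV. ?w * norm (fourier (partial_deriv i f) \<xi>))"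
        using Suc.prems by (simp add: fourier_partial_deriv norm_mult sum_distrib_left sum_distrib_right mult_ac)
      also have "\<dots> \<le> C + (\<Sum>i\<in>UNIV. D i)" by (intro add_mono C sum_mono D)
      finally show ?thesis .
    qed
    then show ?case by blast
  qed
qed

text \<open>Transforms of Schwartz functions form an invariant class: a derivative is again a
  transform, with a coordinate factor on the original function.\<close>

lemma schwartz_fourier:
  fixes f :: "real^'n::finite \<Rightarrow> complex"
  assumes "f \<in> schwartz"
  shows "fourier f \<in> schwartz"
proof -
  define X where "X h \<longleftrightarrow> (\<exists>f\<in>schwartz. h = fourier f)" for h :: "real^'n \<Rightarrow> complex"
  have "X (fourier f)" using assms by (auto simp: X_def)
  then show ?thesis
  proof (rule schwartz_coinduct)
    fix h i assume "X h"
    then obtain f where f: "f \<in> schwartz" "h = fourier f" by (auto simp: X_def)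
    show "X (partial_deriv i h)" unfolding f(2) partial_deriv_fourier[OF f(1)] X_def
      using f(1) schwartz_cmult[OF schwartz_coord_mult[OF f(1)]] by blast
  next
    fix h x assume "X h"
    then show "h differentiable (at x)"
      using fourier_has_derivative unfolding X_def differentiable_def by blast
  qed (auto simp: X_def rapidly_decreasing_fourier)
qed

lemma schwartz_reflect: "f \<in> schwartz \<Longrightarrow> (\<lambda>x. f (- x)) \<in> schwartz"
  using schwartz_affine[of f "-1" 0] by simp

lemma schwartz_inv_fourier: "f \<in> schwartz \<Longrightarrow> inv_fourier f \<in> schwartz"
  unfolding inv_fourier_eq[abs_def] by (intro schwartz_reflect schwartz_fourier)

section \<open>Fourier inversion\<close>

text \<open>Bounded kernels against integrable functions cover the later exchanges of integrals: the
  characters in the Fourier formulas, the mollifier and the reproducing kernel.\<close>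

lemma lborel_Fubini_kernel:
  fixes a b :: "'a::euclidean_space \<Rightarrow> complex"
  assumes a: "integrable lborel a" and b: "integrable lborel b"
    and k [measurable]: "case_prod k \<in> borel_measurable (borel \<Otimes>\<^sub>M borel)"
    and B: "\<And>x y. norm (k x y) \<le> B"
  shows "(LINT x|lborel. a x * (LINT y|lborel. k x y * b y)) = (LINT y|lborel. b y * (LINT x|lborel. k x y * a x))"
proof -
  have [measurable]: "a \<in> borel_measurable borel" "b \<in> borel_measurable borel"
    using a b by (auto dest: borel_measurable_integrable)
  have k': "case_prod k \<in> borel_measurable (lborel \<Otimes>\<^sub>M lborel)"
    using k by (simp cong: measurable_cong_sets)
  have *: "integrable (lborel \<Otimes>\<^sub>M lborel) (\<lambda>(x, y). a x * (k x y * b y))"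
  proof (rule lborel_pair.Fubini_integrable)
    show meas: "(\<lambda>(x, y). a x * (k x y * b y)) \<in> borel_measurable (lborel \<Otimes>\<^sub>M lborel)"
      using k' by measurable
    have kx: "integrable lborel (\<lambda>y. k x y * b y)" for x
      by (rule integrable_bounded_mult[OF b _ B]) measurable
    show "AE x in lborel. integrable lborel (\<lambda>y. case (x, y) of (x, y) \<Rightarrow> a x * (k x y * b y))"
      using kx by (intro AE_I2) simp
    have le: "(LINT y|lborel. norm (k x y * b y)) \<le> B * (LINT y|lborel. norm (b y))" for x
    proof -
      have "(LINT y|lborel. norm (k x y * b y)) \<le> (LINT y|lborel. B * norm (b y))"
        using b by (intro integral_mono[OF integrable_norm[OF kx]]) (auto simp: norm_mult B mult_right_mono)
      then show ?thesis by simp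
    qed
    show "integrable lborel (\<lambda>x. LINT y|lborel. norm (case (x, y) of (x, y) \<Rightarrow> a x * (k x y * b y)))"
    proof (rule Bochner_Integration.integrable_bound)
      show "integrable lborel (\<lambda>x. norm (a x) * (B * (LINT y|lborel. norm (b y))))"
        using a by (intro integrable_mult_left integrable_norm)
      show "(\<lambda>x. LINT y|lborel. norm (case (x, y) of (x, y) \<Rightarrow> a x * (k x y * b y))) \<in> borel_measurable lborel"
        using meas by (intro lborel.borel_measurable_lebesgue_integral) (simp add: case_prod_beta')
      have "\<bar>LINT y|lborel. norm (k x y * b y)\<bar> \<le> \<bar>B * (LINT y|lborel. norm (b y))\<bar>" for x
        using integral_nonneg_AE[where M = lborel and f = "\<lambda>y. norm (k x y * b y)"] le[of x] by simp
      then show "AE x in lborel. norm (LINT y|lborel. norm (case (x, y) of (x, y) \<Rightarrow> a x * (k x y * b y)))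
          \<le> norm (norm (a x) * (B * (LINT y|lborel. norm (b y))))"
        by (intro AE_I2) (simp add: norm_mult[of "a _"] abs_mult mult_left_mono)
    qed
  qed
  from lborel_pair.Fubini_integral[OF this]
  have "(LINT y|lborel. LINT x|lborel. a x * (k x y * b y)) = (LINT x|lborel. LINT y|lborel. a x * (k x y * b y))" .
  moreover have "(LINT x|lborel. a x * (k x y * b y)) = b y * (LINT x|lborel. k x y * a x)" for y
    by (subst integral_mult_right_zero[symmetric]) (simp add: mult_ac)
  ultimately show ?thesis by simp
qed

lemma cis_inner_measurable:
  "(\<lambda>(x, y). cis (- (x \<bullet> y))) \<in> borel_measurable ((borel :: 'a::euclidean_space measure) \<Otimes>\<^sub>M borel)"
  "(\<lambda>(x, y). cis (x \<bullet> y)) \<in> borel_measurable ((borel :: 'a::euclidean_space measure) \<Otimes>\<^sub>M borel)"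
  by measurable

text \<open>This symmetry is what justifies \<open>distr_fourier\<close> being defined by
  transposition; it moves transforms between a function and its test function.\<close>

lemma fourier_multiplication_formula:
  fixes f g :: "real^'n::finite \<Rightarrow> complex"
  assumes "integrable lborel f" "integrable lborel g"
  shows "(LINT x|lborel. f x * fourier g x) = (LINT x|lborel. fourier f x * g x)"
proof -
  define c where "c = complex_of_real ((2 * pi) powr (- real CARD('n) / 2))"
  define I where "I x = (LINT y|lborel. cis (- (x \<bullet> y)) * g y)" for x
  define J where "J y = (LINT x|lborel. cis (- (x \<bullet> y)) * f x)" for y
  have "(LINT x|lborel. f x * I x) = (LINT y|lborel. g y * J y)"
    unfolding I_def J_def
    by (rule lborel_Fubini_kernel[where B = 1]) (use assms cis_inner_measurable in auto)
  moreover have "fourier g x = c * I x" "fourier f x = c * J x" for x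
    by (simp_all add: fourier_def I_def J_def c_def inner_commute)
  moreover have "(\<lambda>x. f x * (c * I x)) = (\<lambda>x. c * (f x * I x))" "(\<lambda>x. (c * J x) * g x) = (\<lambda>x. c * (g x * J x))"
    by (simp_all add: mult_ac)
  ultimately show ?thesis by (simp only: integral_mult_right_zero)
qed

text \<open>The convolution theorem in the shape in which blocks use it: a multiplier acting on the
  inverse transform of a test function is convolution with the transform of the multiplier. Both
  sides are one double integral against characters.\<close>

lemma fourier_mult_inv_fourier:
  fixes f \<Phi> :: "real^'n::finite \<Rightarrow> complex"
  assumes f: "integrable lborel f" and \<Phi>: "integrable lborel \<Phi>"
  shows "fourier (\<lambda>\<xi>. \<Phi> \<xi> * inv_fourier f \<xi>) y =
    of_real ((2 * pi) powr (- real CARD('n) / 2)) * (LINT x|lborel. f x * fourier \<Phi> (y - x))"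
proof -
  define c where "c = complex_of_real ((2 * pi) powr (- real CARD('n) / 2))"
  define I where "I \<xi> = (LINT x|lborel. cis (\<xi> \<bullet> x) * f x)" for \<xi>
  define J where "J x = (LINT \<xi>|lborel. cis (\<xi> \<bullet> x) * (cis (- (\<xi> \<bullet> y)) * \<Phi> \<xi>))" for x
  have eq: "(LINT \<xi>|lborel. (cis (- (\<xi> \<bullet> y)) * \<Phi> \<xi>) * I \<xi>) = (LINT x|lborel. f x * J x)"
    unfolding I_def J_def
    by (rule lborel_Fubini_kernel[where B = 1]) (use assms cis_inner_measurable fourier_integrable in auto)
  have "J x = (LINT \<xi>|lborel. cis (- (\<xi> \<bullet> (y - x))) * \<Phi> \<xi>)" for x
    unfolding J_def by (intro Bochner_Integration.integral_cong refl)
      (simp add: mult.assoc[symmetric] cis_mult inner_diff_right)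
  then have J: "fourier \<Phi> (y - x) = c * J x" for x
    by (simp add: fourier_def c_def)
  have I: "inv_fourier f \<xi> = c * I \<xi>" for \<xi>
    by (simp add: inv_fourier_def I_def c_def inner_commute)
  have "fourier (\<lambda>\<xi>. \<Phi> \<xi> * inv_fourier f \<xi>) y = c * (LINT \<xi>|lborel. cis (- (\<xi> \<bullet> y)) * (\<Phi> \<xi> * (c * I \<xi>)))"
    by (simp add: fourier_def c_def I)
  also have "(\<lambda>\<xi>. cis (- (\<xi> \<bullet> y)) * (\<Phi> \<xi> * (c * I \<xi>))) = (\<lambda>\<xi>. c * ((cis (- (\<xi> \<bullet> y)) * \<Phi> \<xi>) * I \<xi>))"
    by (simp add: mult_ac)
  also have "c * (LINT \<xi>|lborel. c * ((cis (- (\<xi> \<bullet> y)) * \<Phi> \<xi>) * I \<xi>)) = c * (LINT x|lborel. c * (f x * J x))"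
    by (simp only: integral_mult_right_zero eq)
  also have "(\<lambda>x. c * (f x * J x)) = (\<lambda>x. f x * fourier \<Phi> (y - x))"
    unfolding J by (intro ext) (rule mult.left_commute)
  finally show ?thesis unfolding c_def .
qed

text \<open>Multiplication by a function with spectrum \<open>G\<close> convolves the other spectrum
  with \<open>G\<close>. This controls how far a band-limited cutoff spreads frequencies.\<close>

lemma inv_fourier_mult_fourier:
  fixes G k :: "real^'n::finite \<Rightarrow> complex"
  assumes G: "integrable lborel G" and k: "integrable lborel k"
  shows "inv_fourier (\<lambda>x. fourier G x * k x) \<xi> =
    of_real ((2 * pi) powr (- real CARD('n) / 2)) * (LINT \<eta>|lborel. G \<eta> * inv_fourier k (\<xi> - \<eta>))"
proof -
  define c where "c = complex_of_real ((2 * pi) powr (- real CARD('n) / 2))"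
  define I where "I x = (LINT \<eta>|lborel. cis (- (x \<bullet> \<eta>)) * G \<eta>)" for x
  define J where "J \<eta> = (LINT x|lborel. cis (- (x \<bullet> \<eta>)) * (cis (x \<bullet> \<xi>) * k x))" for \<eta>
  have i: "integrable lborel (\<lambda>x. cis (x \<bullet> \<xi>) * k x)"
    by (rule integrable_bounded_mult[OF k, where B = 1]) auto
  have eq: "(LINT x|lborel. (cis (x \<bullet> \<xi>) * k x) * I x) = (LINT \<eta>|lborel. G \<eta> * J \<eta>)"
    unfolding I_def J_def
    by (rule lborel_Fubini_kernel[where B = 1]) (use assms cis_inner_measurable i in auto)
  have "J \<eta> = (LINT x|lborel. cis ((\<xi> - \<eta>) \<bullet> x) * k x)" for \<eta>
    unfolding J_def by (intro Bochner_Integration.integral_cong refl)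
      (simp add: mult.assoc[symmetric] cis_mult inner_diff_right inner_commute[of "\<xi> - \<eta>"])
  then have J: "inv_fourier k (\<xi> - \<eta>) = c * J \<eta>" for \<eta>
    by (simp add: inv_fourier_def c_def)
  have I: "fourier G x = c * I x" for x
    by (simp add: fourier_def I_def c_def inner_commute)
  have "inv_fourier (\<lambda>x. fourier G x * k x) \<xi> = c * (LINT x|lborel. cis (\<xi> \<bullet> x) * (c * I x * k x))"
    by (simp add: inv_fourier_def c_def I)
  also have "(\<lambda>x. cis (\<xi> \<bullet> x) * (c * I x * k x)) = (\<lambda>x. c * ((cis (x \<bullet> \<xi>) * k x) * I x))"
    by (simp add: mult_ac inner_commute)
  also have "c * (LINT x|lborel. c * ((cis (x \<bullet> \<xi>) * k x) * I x)) = c * (LINT \<eta>|lborel. c * (G \<eta> * J \<eta>))"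
    by (simp only: integral_mult_right_zero eq)
  also have "(\<lambda>\<eta>. c * (G \<eta> * J \<eta>)) = (\<lambda>\<eta>. G \<eta> * inv_fourier k (\<xi> - \<eta>))"
    unfolding J by (intro ext) (rule mult.left_commute)
  finally show ?thesis unfolding c_def .
qed

section \<open>Products of one-dimensional integrals and the Gaussian\<close>

lemma
  fixes f :: "'a::euclidean_space \<Rightarrow> real \<Rightarrow> complex"
  assumes "\<And>b. b \<in> Basis \<Longrightarrow> integrable lborel (f b)"
  shows lborel_integrable_prod: "integrable lborel (\<lambda>x. \<Prod>b\<in>Basis. f b (x \<bullet> b))"
    and lborel_integral_prod: "(LINT x|lborel. (\<Prod>b\<in>Basis. f b (x \<bullet> b))) = (\<Prod>b\<in>Basis. (LINT s|lborel. f b s))"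
proof -
  interpret product_sigma_finite "\<lambda>b::'a. lborel :: real measure" by standard
  have [measurable]: "f b \<in> borel_measurable borel" if "b \<in> Basis" for b
    using assms[OF that] by (auto dest: borel_measurable_integrable)
  have m: "(\<lambda>x. \<Prod>b\<in>Basis. f b (x \<bullet> b)) \<in> borel_measurable borel" by measurable
  have T: "(\<lambda>g. \<Sum>b\<in>Basis. g b *\<^sub>R b) \<in> measurable (\<Pi>\<^sub>M b\<in>(Basis::'a set). (lborel :: real measure)) borel"
    by measurable
  have eq: "(\<Prod>b\<in>Basis. f b ((\<Sum>b\<in>Basis. g b *\<^sub>R b) \<bullet> b)) = (\<Prod>b\<in>Basis. f b (g b))" for g
    by (intro prod.cong refl) simp
  show "integrable lborel (\<lambda>x. \<Prod>b\<in>Basis. f b (x \<bullet> b))"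
    unfolding lborel_eq[where 'a = 'a] using product_integrable_prod[OF finite_Basis assms]
    by (subst integrable_distr_eq[OF T m]) (simp add: eq)
  show "(LINT x|lborel. (\<Prod>b\<in>Basis. f b (x \<bullet> b))) = (\<Prod>b\<in>Basis. (LINT s|lborel. f b s))"
    unfolding lborel_eq[where 'a = 'a] using product_integral_prod[OF finite_Basis assms]
    by (subst integral_distr[OF T m]) (simp add: eq)
qed

text \<open>Up to normalisation this is the characteristic function of the standard normal
  distribution.\<close>

lemma
  shows integrable_cis_gaussian: "integrable lborel (\<lambda>s. cis (t * s) * of_real (exp (- s\<^sup>2 / 2)))"
    and integral_cis_gaussian: "(LINT s|lborel. cis (t * s) * of_real (exp (- s\<^sup>2 / 2))) = of_real (sqrt (2 * pi) * exp (- t\<^sup>2 / 2))"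
proof -
  have "integrable lborel (\<lambda>s. sqrt (2 * pi) * std_normal_density s)"
    by (intro integrable_mult_right integrable_normal_density) simp
  then have "integrable lborel (\<lambda>s. complex_of_real (exp (- s\<^sup>2 / 2)))"
    by (intro integrable_of_real) (simp add: std_normal_density_def)
  then show "integrable lborel (\<lambda>s. cis (t * s) * of_real (exp (- s\<^sup>2 / 2)))"
    by (rule integrable_bounded_mult[where B = 1]) auto
  have "complex_of_real (exp (- t\<^sup>2 / 2)) = (LINT s|std_normal_distribution. iexp (t * s))"
    using char_std_normal_distribution by (simp add: char_def fun_eq_iff)
  also have "\<dots> = (LINT s|lborel. std_normal_density s *\<^sub>R iexp (t * s))"
    by (subst integral_density) auto
  also have "\<dots> = (LINT s|lborel. complex_of_real (1 / sqrt (2 * pi)) * (cis (t * s) * of_real (exp (- s\<^sup>2 / 2))))"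
    by (simp add: std_normal_density_def cis_conv_exp scaleR_conv_of_real mult_ac)
  also have "\<dots> = complex_of_real (1 / sqrt (2 * pi)) * (LINT s|lborel. cis (t * s) * of_real (exp (- s\<^sup>2 / 2)))"
    by (rule integral_mult_right_zero)
  finally show "(LINT s|lborel. cis (t * s) * of_real (exp (- s\<^sup>2 / 2))) = of_real (sqrt (2 * pi) * exp (- t\<^sup>2 / 2))"
    by (simp add: field_simps)
qed

definition gaussian :: "real^'n::finite \<Rightarrow> complex"
  where "gaussian x = of_real (exp (- (x \<bullet> x) / 2))"

lemma gaussian_measurable [measurable]: "gaussian \<in> borel_measurable borel"
  unfolding gaussian_def[abs_def] by measurable

lemma gaussian_eq_prod: "gaussian x = (\<Prod>b\<in>Basis. of_real (exp (- (x \<bullet> b)\<^sup>2 / 2)))"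
proof -
  have "- (x \<bullet> x) / 2 = (\<Sum>b\<in>Basis. - (x \<bullet> b)\<^sup>2 / 2)"
    by (subst euclidean_inner) (simp add: power2_eq_square sum_negf sum_divide_distrib)
  then show ?thesis by (simp add: gaussian_def exp_sum)
qed

lemma integrable_gaussian: "integrable lborel (gaussian :: real^'n::finite \<Rightarrow> complex)"
  unfolding gaussian_eq_prod[abs_def]
  using integrable_cis_gaussian[of 0] by (intro lborel_integrable_prod) simp

lemma cis_sum: "finite I \<Longrightarrow> cis (\<Sum>i\<in>I. f i) = (\<Prod>i\<in>I. cis (f i))"
  by (induction I rule: finite_induct) (auto simp: cis_mult[symmetric])

text \<open>In coordinates the integrand splits into one-dimensional factors. The powers of
  \<open>sqrt (2 * pi)\<close> that they produce cancel the normalisation of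
  \<open>fourier\<close>.\<close>

lemma fourier_gaussian: "fourier gaussian = (gaussian :: real^'n::finite \<Rightarrow> complex)"
proof
  fix \<xi> :: "real^'n"
  have "cis (- (x \<bullet> \<xi>)) * gaussian x = (\<Prod>b\<in>Basis. cis (- (\<xi> \<bullet> b) * (x \<bullet> b)) * of_real (exp (- (x \<bullet> b)\<^sup>2 / 2)))" for x
  proof -
    have "- (x \<bullet> \<xi>) = (\<Sum>b\<in>Basis. - (\<xi> \<bullet> b) * (x \<bullet> b))"
      by (subst euclidean_inner) (simp add: sum_negf mult.commute)
    then show ?thesis by (simp only: gaussian_eq_prod prod.distrib cis_sum finite_Basis)
  qed
  then have "(LINT x|lborel. cis (- (x \<bullet> \<xi>)) * gaussian x) = (\<Prod>b\<in>(Basis :: (real^'n) set). of_real (sqrt (2 * pi) * exp (- (- (\<xi> \<bullet> b))\<^sup>2 / 2)))"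
    by (simp only: lborel_integral_prod[where f = "\<lambda>b s. cis (- (\<xi> \<bullet> b) * s) * of_real (exp (- s\<^sup>2 / 2))"]
        integrable_cis_gaussian integral_cis_gaussian)
  also have "\<dots> = of_real (sqrt (2 * pi) ^ CARD('n)) * gaussian \<xi>"
    by (simp add: prod.distrib gaussian_eq_prod)
  also have "sqrt (2 * pi) ^ CARD('n) = (2 * pi) powr (real CARD('n) / 2)"
    by (simp add: powr_half_sqrt[symmetric] powr_realpow[symmetric] powr_powr)
  finally have "fourier gaussian \<xi> = of_real ((2 * pi) powr (- real CARD('n) / 2) * (2 * pi) powr (real CARD('n) / 2)) * gaussian \<xi>"
    by (simp add: fourier_def)
  also have "(2 * pi) powr (- real CARD('n) / 2) * (2 * pi) powr (real CARD('n) / 2) = 1"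
    by (simp add: powr_add[symmetric])
  finally show "fourier gaussian \<xi> = gaussian \<xi>" by simp
qed

lemma gaussian_0 [simp]: "gaussian 0 = 1"
  by (simp add: gaussian_def)

lemma norm_gaussian_le: "norm (gaussian x) \<le> 1"
  by (simp add: gaussian_def)

lemma LIMSEQ_scaleR_Suc: "(\<lambda>m. (1 / real (Suc m)) *\<^sub>R x) \<longlonglongrightarrow> (0::'a::real_normed_vector)"
  using tendsto_scaleR[OF LIMSEQ_inverse_real_of_nat tendsto_const[of x]] by (simp add: inverse_eq_divide)

lemma gaussian_tendsto: "(\<lambda>m. gaussian ((1 / real (Suc m)) *\<^sub>R x)) \<longlonglongrightarrow> 1"
proof -
  have "isCont gaussian (0::real^'a)" unfolding gaussian_def[abs_def] by (intro continuous_intros) auto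
  from isCont_tendsto_compose[OF this LIMSEQ_scaleR_Suc] show ?thesis by simp
qed

text \<open>Gaussian regularisation of the integral in the inversion formula at the origin.\<close>

lemma integral_fourier:
  fixes f :: "real^'n::finite \<Rightarrow> complex"
  assumes f: "f \<in> schwartz"
  shows "of_real ((2 * pi) powr (- real CARD('n) / 2)) * (LINT \<xi>|lborel. fourier f \<xi>) = f 0"
proof -
  note [measurable] = schwartz_measurable[OF f] schwartz_measurable[OF schwartz_fourier[OF f]]
  define t where "t m = 1 / real (Suc m)" for m
  have t: "t m > 0" for m by (simp add: t_def)
  obtain C where C: "\<And>x. norm (f x) \<le> C" using schwartz_bounded[OF f] by metis
  have int_t: "integrable lborel (\<lambda>x::real^'n. gaussian (t m *\<^sub>R x))" for m
    using lborel_integrable_affine_iff[of "t m" "gaussian :: real^'n \<Rightarrow> complex" 0] t[of m] integrable_gaussian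
    by simp
  \<comment> \<open>The multiplication formula shifts the regularising Gaussian onto
    \<open>f\<close>, where it concentrates at 0; the substitution by \<open>t m\<close> absorbs the
    resulting normalisation.\<close>
  have eq: "(LINT \<xi>|lborel. fourier f \<xi> * gaussian (t m *\<^sub>R \<xi>)) = (LINT y|lborel. f (t m *\<^sub>R y) * gaussian y)" for m
  proof -
    have "(LINT \<xi>|lborel. fourier f \<xi> * gaussian (t m *\<^sub>R \<xi>)) = (LINT y|lborel. f y * fourier (\<lambda>x. gaussian (t m *\<^sub>R x)) y)"
      by (rule fourier_multiplication_formula[symmetric]) (use schwartz_integrable[OF f] int_t in auto)
    also have "\<dots> = (LINT y|lborel. f y * gaussian (y /\<^sub>R t m)) / of_real (t m ^ CARD('n))"
      using t[of m] by (simp add: fourier_scale fourier_gaussian)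
    also have "(LINT y|lborel. f y * gaussian (y /\<^sub>R t m)) = (LINT y|lborel. f (0 + t m *\<^sub>R y) * gaussian ((0 + t m *\<^sub>R y) /\<^sub>R t m)) * of_real (t m ^ CARD('n))"
      using t[of m] by (subst lborel_integral_affine[of "t m" "\<lambda>y. f y * gaussian (y /\<^sub>R t m)" 0])
        (auto simp: scaleR_conv_of_real[where 'a = complex])
    finally show ?thesis using t[of m] by simp
  qed
  have "(\<lambda>m. LINT \<xi>|lborel. fourier f \<xi> * gaussian (t m *\<^sub>R \<xi>)) \<longlonglongrightarrow> (LINT \<xi>|lborel. fourier f \<xi> * 1)"
  proof (rule integral_dominated_convergence[where w = "\<lambda>\<xi>. norm (fourier f \<xi>)"])
    show "integrable lborel (\<lambda>\<xi>. norm (fourier f \<xi>))" using schwartz_integrable[OF schwartz_fourier[OF f]] by simp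
    show "AE x in lborel. (\<lambda>m. fourier f x * gaussian (t m *\<^sub>R x)) \<longlonglongrightarrow> fourier f x * 1"
      unfolding t_def by (intro AE_I2 tendsto_mult tendsto_const gaussian_tendsto)
    show "AE x in lborel. norm (fourier f x * gaussian (t m *\<^sub>R x)) \<le> norm (fourier f x)" for m
      by (intro AE_I2) (simp add: norm_mult mult_left_le norm_gaussian_le)
  qed measurable
  moreover have "(\<lambda>m. LINT y|lborel. f (t m *\<^sub>R y) * gaussian y) \<longlonglongrightarrow> (LINT y|lborel. f 0 * gaussian (y :: real^'n))"
  proof (rule integral_dominated_convergence[where w = "\<lambda>y. C * norm (gaussian y)"])
    show "integrable lborel (\<lambda>y::real^'n. C * norm (gaussian y))" using integrable_gaussian by auto
    have "isCont f 0" using schwartz_differentiable[OF f] differentiable_imp_continuous_within by blast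
    then show "AE x in lborel. (\<lambda>m. f (t m *\<^sub>R x) * gaussian x) \<longlonglongrightarrow> f 0 * gaussian x"
      unfolding t_def by (intro AE_I2 tendsto_mult tendsto_const isCont_tendsto_compose[OF _ LIMSEQ_scaleR_Suc])
    show "AE x in lborel. norm (f (t m *\<^sub>R x) * gaussian x) \<le> C * norm (gaussian x)" for m
      using C by (intro AE_I2) (auto simp: norm_mult intro: mult_right_mono)
  qed measurable
  ultimately have "(LINT \<xi>|lborel. fourier f \<xi> * 1) = (LINT y|lborel. f 0 * gaussian (y :: real^'n))"
    unfolding eq by (rule LIMSEQ_unique)
  \<comment> \<open>The remaining constant is \<open>fourier gaussian 0\<close>, which the
    fixed-point property identifies as 1.\<close>
  moreover have "of_real ((2 * pi) powr (- real CARD('n) / 2)) * (LINT y|lborel. gaussian (y :: real^'n)) = 1"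
    using fourier_gaussian[THEN fun_cong, of "0 :: real^'n"] by (simp add: fourier_def)
  ultimately show ?thesis by (simp add: mult_ac)
qed

text \<open>Translating \<open>f\<close> by \<open>x\<close> moves the evaluation point to the
  origin and produces exactly the character \<open>cis (x \<bullet> \<xi>)\<close> of the inverse
  transform.\<close>

theorem inv_fourier_fourier:
  assumes f: "f \<in> schwartz"
  shows "inv_fourier (fourier f) = f"
proof
  fix x
  have g: "(\<lambda>y. f (y + x)) \<in> schwartz" using schwartz_affine[OF f, of 1 x] by simp
  have "inv_fourier (fourier f) x = of_real ((2 * pi) powr (- real CARD('a) / 2)) * (LINT \<xi>|lborel. fourier (\<lambda>y. f (y + x)) \<xi>)"
    using schwartz_measurable[OF f] by (simp add: inv_fourier_def fourier_translate)
  also have "\<dots> = f (0 + x)" by (rule integral_fourier[OF g])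
  finally show "inv_fourier (fourier f) x = f x" by simp
qed

text \<open>The inverse transform is the transform followed by a reflection, and reflections commute
  with \<open>fourier\<close>; this reduces the claim to \<open>inv_fourier_fourier\<close>.\<close>

theorem fourier_inv_fourier:
  assumes f: "f \<in> schwartz"
  shows "fourier (inv_fourier f) = f"
proof
  fix \<xi>
  have "fourier (\<lambda>x. fourier f ((- 1) *\<^sub>R x)) \<xi> = fourier (fourier f) (\<xi> /\<^sub>R (- 1)) / of_real (\<bar>- 1\<bar> ^ CARD('a))"
    by (rule fourier_scale) (use schwartz_measurable[OF schwartz_fourier[OF f]] in auto)
  also have "\<dots> = inv_fourier (fourier f) \<xi>" by (simp add: inv_fourier_eq)
  moreover have "inv_fourier f = (\<lambda>x. fourier f ((- 1) *\<^sub>R x))"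
    by (simp add: fun_eq_iff inv_fourier_eq)
  ultimately show "fourier (inv_fourier f) \<xi> = f \<xi>"
    by (simp only: inv_fourier_fourier[OF f])
qed

section \<open>Tempered distributions given by functions\<close>

lemma null_sets_cbox_diff_box: "cbox a b - box a b \<in> null_sets (lborel :: 'a::euclidean_space measure)"
  using negligible_frontier_interval[of a b]
  by (simp add: negligible_iff_null_sets null_sets_completion_iff)

text \<open>Mollify the indicator of the box by \<open>\<theta>\<close>. By Fubini the mollified
  indicator is a superposition of translated and dilated copies of \<open>\<theta>\<close>, against
  each of which \<open>h\<close> integrates to 0. Off the null boundary it converges to the
  indicator times the integral of \<open>\<theta>\<close>, so that integral has to be
  nonzero.\<close>

lemma lborel_integral_box_eq_0:
  fixes h \<theta> :: "real^'n::finite \<Rightarrow> complex"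
  assumes h: "integrable lborel h" and zero: "\<And>f. f \<in> schwartz \<Longrightarrow> (LINT x|lborel. h x * f x) = 0"
    and \<theta>: "\<theta> \<in> schwartz" "(LINT x|lborel. \<theta> x) \<noteq> 0"
  shows "(LINT x|lborel. indicator (box a b) x *\<^sub>R h x) = 0"
proof -
  note [measurable] = schwartz_measurable[OF \<theta>(1)]
  have [measurable]: "h \<in> borel_measurable borel" using h by (auto dest: borel_measurable_integrable)
  define I where "I x = complex_of_real (indicator (box a b) x)" for x :: "real^'n"
  have I_int: "integrable lborel I"
    unfolding I_def[abs_def] by (intro integrable_of_real integrable_real_indicator) (auto simp: emeasure_lborel_box_eq)
  have [measurable]: "I \<in> borel_measurable borel" unfolding I_def[abs_def] by measurable
  have I_le: "norm (I x) \<le> 1" for x by (auto simp: I_def indicator_def)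
  obtain C where C: "\<And>x. norm (\<theta> x) \<le> C" using schwartz_bounded[OF \<theta>(1)] by metis
  define t where "t m = 1 / real (Suc m)" for m
  have t: "t m > 0" for m by (simp add: t_def)
  define g where "g m x = (LINT z|lborel. I (x + t m *\<^sub>R z) * \<theta> z)" for m x
  have [measurable]: "(\<lambda>(x, z). I (x + t m *\<^sub>R z) * \<theta> z) \<in> borel_measurable (borel \<Otimes>\<^sub>M lborel)" for m
    by measurable
  have [measurable]: "g m \<in> borel_measurable borel" for m
    unfolding g_def[abs_def] by (intro lborel.borel_measurable_lebesgue_integral) measurable
  have g0: "(LINT x|lborel. h x * g m x) = 0" for m
  proof -
    let ?k = "\<lambda>y x. \<theta> ((y - x) /\<^sub>R t m)"
    have "(LINT y|lborel. I y * (LINT x|lborel. ?k y x * h x)) = (LINT x|lborel. h x * (LINT y|lborel. ?k y x * I y))"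
      by (rule lborel_Fubini_kernel[OF I_int h _ C]) measurable
    moreover have "(LINT x|lborel. ?k y x * h x) = 0" for y
    proof -
      have "(\<lambda>x. \<theta> ((- inverse (t m)) *\<^sub>R x + y /\<^sub>R t m)) \<in> schwartz"
        using t[of m] by (intro schwartz_affine \<theta>) auto
      from zero[OF this] show ?thesis by (simp add: mult.commute scaleR_diff_right)
    qed
    moreover have "(LINT y|lborel. ?k y x * I y) = of_real (t m ^ CARD('n)) * g m x" for x
    proof -
      have "(\<lambda>y. ?k y x * I y) \<in> borel_measurable borel" by measurable
      from lborel_integral_affine[OF _ this, of "t m" x] t[of m]
      show ?thesis by (simp add: g_def mult.commute scaleR_conv_of_real[where 'a = complex])
    qed
    ultimately have "(LINT x|lborel. h x * (of_real (t m ^ CARD('n)) * g m x)) = 0" by simp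
    then have "of_real (t m ^ CARD('n)) * (LINT x|lborel. h x * g m x) = 0"
      by (subst integral_mult_right_zero[symmetric]) (simp add: mult.left_commute)
    then show ?thesis using t[of m] by auto
  qed
  define K where "K = (LINT z|lborel. norm (\<theta> z))"
  have g_le: "norm (g m x) \<le> K" for m x
  proof -
    have "norm (g m x) \<le> (LINT z|lborel. norm (\<theta> z))" unfolding g_def
    proof (rule Bochner_Integration.integral_norm_bound_integral)
      show "integrable lborel (\<lambda>z. I (x + t m *\<^sub>R z) * \<theta> z)"
        by (rule integrable_bounded_mult[OF schwartz_integrable[OF \<theta>(1)] _ I_le]) measurable
      show "integrable lborel (\<lambda>z. norm (\<theta> z))" using schwartz_integrable[OF \<theta>(1)] by simp
    qed (simp add: norm_mult I_le mult_left_le_one_le)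
    then show ?thesis by (simp add: K_def)
  qed
  \<comment> \<open>Interior and exterior are open, so there the indicator is eventually constant
    along \<open>x + t m *\<^sub>R z\<close>; at the boundary this may fail.\<close>
  have g_lim: "(\<lambda>m. g m x) \<longlonglongrightarrow> I x * (LINT z|lborel. \<theta> z)" if x: "x \<notin> cbox a b - box a b" for x
  proof -
    have I_lim: "(\<lambda>m. I (x + t m *\<^sub>R z)) \<longlonglongrightarrow> I x" for z
    proof (rule tendsto_eventually)
      have lim: "(\<lambda>m. x + t m *\<^sub>R z) \<longlonglongrightarrow> x + 0"
        unfolding t_def by (intro tendsto_add tendsto_const LIMSEQ_scaleR_Suc)
      consider "x \<in> box a b" | "x \<in> - cbox a b" using x by blast
      then show "\<forall>\<^sub>F m in sequentially. I (x + t m *\<^sub>R z) = I x"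
      proof cases
        case 1
        have "\<forall>\<^sub>F m in sequentially. x + t m *\<^sub>R z \<in> box a b"
          using lim 1 by (intro topological_tendstoD) auto
        then show ?thesis using 1 by (auto simp: I_def elim: eventually_mono)
      next
        case 2
        have "\<forall>\<^sub>F m in sequentially. x + t m *\<^sub>R z \<in> - cbox a b"
          using lim 2 by (intro topological_tendstoD) (auto simp: open_Compl closed_cbox)
        moreover have "I y = 0" if "y \<in> - cbox a b" for y
          using that box_subset_cbox[of a b] by (auto simp: I_def indicator_def)
        ultimately show ?thesis using 2 by (auto elim!: eventually_mono)
      qed
    qed
    have "(\<lambda>m. g m x) \<longlonglongrightarrow> (LINT z|lborel. I x * \<theta> z)" unfolding g_def
    proof (rule integral_dominated_convergence[where w = "\<lambda>z. norm (\<theta> z)"])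
      show "integrable lborel (\<lambda>z. norm (\<theta> z))" using schwartz_integrable[OF \<theta>(1)] by simp
      show "AE z in lborel. (\<lambda>m. I (x + t m *\<^sub>R z) * \<theta> z) \<longlonglongrightarrow> I x * \<theta> z"
        by (intro AE_I2 tendsto_mult tendsto_const I_lim)
      show "AE z in lborel. norm (I (x + t m *\<^sub>R z) * \<theta> z) \<le> norm (\<theta> z)" for m
        by (intro AE_I2) (simp add: norm_mult I_le mult_left_le_one_le)
    qed measurable
    then show ?thesis by simp
  qed
  have "(\<lambda>m. LINT x|lborel. h x * g m x) \<longlonglongrightarrow> (LINT x|lborel. h x * (I x * (LINT z|lborel. \<theta> z)))"
  proof (rule integral_dominated_convergence[where w = "\<lambda>x. norm (h x) * K"])
    show "integrable lborel (\<lambda>x. norm (h x) * K)" using h by simp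
    have "AE x in lborel. x \<notin> cbox a b - box a b" using null_sets_cbox_diff_box by (rule AE_not_in)
    then show "AE x in lborel. (\<lambda>m. h x * g m x) \<longlonglongrightarrow> h x * (I x * (LINT z|lborel. \<theta> z))"
      by eventually_elim (intro tendsto_mult tendsto_const g_lim)
    show "AE x in lborel. norm (h x * g m x) \<le> norm (h x) * K" for m
      using g_le by (intro AE_I2) (simp add: norm_mult mult_left_mono)
  qed measurable
  then have "(LINT x|lborel. h x * (I x * (LINT z|lborel. \<theta> z))) = 0"
    by (simp add: g0 LIMSEQ_const_iff)
  then have "(LINT x|lborel. h x * I x) * (LINT z|lborel. \<theta> z) = 0"
    by (simp add: mult.assoc[symmetric])
  then have "(LINT x|lborel. h x * I x) = 0" using \<theta>(2) by simp
  then show ?thesis by (simp add: I_def scaleR_conv_of_real[where 'a = complex] mult.commute)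
qed

text \<open>Boxes form an intersection-stable generator of the Borel sets, so vanishing integrals
  over boxes propagate to all Borel sets, and this forces \<open>h\<close> to vanish almost
  everywhere.\<close>

lemma AE_eq_0_if_orthogonal_schwartz:
  fixes h \<theta> :: "real^'n::finite \<Rightarrow> complex"
  assumes h: "integrable lborel h" and zero: "\<And>f. f \<in> schwartz \<Longrightarrow> (LINT x|lborel. h x * f x) = 0"
    and \<theta>: "\<theta> \<in> schwartz" "(LINT x|lborel. \<theta> x) \<noteq> 0" "\<theta> 0 = 1"
  shows "AE x in lborel. h x = 0"
proof (rule sigma_finite_measure.density_zero[OF sigma_finite_lborel h])
  note [measurable] = schwartz_measurable[OF \<theta>(1)]
  have [measurable]: "h \<in> borel_measurable borel" using h by (auto dest: borel_measurable_integrable)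
  define \<nu> where "\<nu> A = (LINT x|lborel. indicator A x *\<^sub>R h x)" for A
  obtain C where C: "\<And>x. norm (\<theta> x) \<le> C" using schwartz_bounded[OF \<theta>(1)] by metis
  \<comment> \<open>Closure under complements needs the integral over the whole space, which is no
    box. Dilations of \<open>\<theta>\<close> converge pointwise to \<open>\<theta> 0 = 1\<close>,
    so that integral is a limit of zeros.\<close>
  have UNIV0: "\<nu> UNIV = 0"
  proof -
    have "(\<lambda>m. LINT x|lborel. h x * \<theta> ((1 / real (Suc m)) *\<^sub>R x)) \<longlonglongrightarrow> (LINT x|lborel. h x * \<theta> 0)"
    proof (rule integral_dominated_convergence[where w = "\<lambda>x. norm (h x) * C"])
      show "integrable lborel (\<lambda>x. norm (h x) * C)" using h by simp
      have "isCont \<theta> 0" using schwartz_differentiable[OF \<theta>(1)] differentiable_imp_continuous_within by blast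
      then show "AE x in lborel. (\<lambda>m. h x * \<theta> ((1 / real (Suc m)) *\<^sub>R x)) \<longlonglongrightarrow> h x * \<theta> 0"
        by (intro AE_I2 tendsto_mult tendsto_const isCont_tendsto_compose[OF _ LIMSEQ_scaleR_Suc])
      show "AE x in lborel. norm (h x * \<theta> ((1 / real (Suc m)) *\<^sub>R x)) \<le> norm (h x) * C" for m
        using C by (intro AE_I2) (simp add: norm_mult mult_left_mono)
    qed measurable
    moreover have "(LINT x|lborel. h x * \<theta> ((1 / real (Suc m)) *\<^sub>R x)) = 0" for m
      using schwartz_affine[OF \<theta>(1), of "1 / real (Suc m)" 0] by (intro zero) simp
    ultimately show ?thesis by (simp add: LIMSEQ_const_iff \<theta>(3) \<nu>_def)
  qed
  let ?E = "range (\<lambda>(a, b). box a b :: (real^'n) set)"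
  have "\<nu> A = 0" if "A \<in> sigma_sets UNIV ?E" for A
  proof (rule sigma_sets_induct_disjoint[OF _ _ that])
    show "Int_stable ?E" by (auto simp: Int_stable_def box_Int_box)
    show "\<nu> A = 0" if "A \<in> ?E" for A
      using that lborel_integral_box_eq_0[OF h zero \<theta>(1,2)] by (auto simp: \<nu>_def)
    show "\<nu> {} = 0" by (simp add: \<nu>_def)
    have borel_E: "sigma_sets UNIV ?E = sets borel" by (simp add: borel_eq_box)
    show "\<nu> (UNIV - A) = 0" if A: "A \<in> sigma_sets UNIV ?E" and "\<nu> A = 0" for A
    proof -
      have [measurable]: "A \<in> sets borel" using A borel_E by simp
      have "\<nu> (UNIV - A) + \<nu> A = (LINT x|lborel. indicator (UNIV - A) x *\<^sub>R h x + indicator A x *\<^sub>R h x)"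
        unfolding \<nu>_def by (rule Bochner_Integration.integral_add[symmetric]; intro integrable_mult_indicator h) auto
      also have "\<dots> = \<nu> UNIV" unfolding \<nu>_def
        by (intro Bochner_Integration.integral_cong) (auto simp: indicator_def)
      finally show ?thesis using UNIV0 \<open>\<nu> A = 0\<close> by simp
    qed
    show "\<nu> (\<Union>i. A i) = 0" if "disjoint_family A" "range A \<subseteq> sigma_sets UNIV ?E" "\<And>i. \<nu> (A i) = 0" for A :: "nat \<Rightarrow> _"
    proof -
      have A: "A i \<in> sets lborel" for i using that(2) borel_E by auto
      have "(LINT x:(\<Union>i. A i)|lborel. h x) = (\<Sum>i. LINT x:A i|lborel. h x)"
      proof (rule lebesgue_integral_countable_add)
        show "A i \<inter> A j = {}" if "i \<noteq> j" for i j
          using \<open>disjoint_family A\<close> that by (auto simp: disjoint_family_on_def)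
        show "set_integrable lborel (\<Union> (range A)) h"
          unfolding set_integrable_def using A by (intro integrable_mult_indicator h) auto
      qed (use A in auto)
      then show ?thesis using that(3) by (simp add: \<nu>_def set_lebesgue_integral_def)
    qed
  qed auto
  then show "set_lebesgue_integral lborel A h = 0" if "A \<in> sets lborel" for A
    using that by (simp add: \<nu>_def set_lebesgue_integral_def borel_eq_box)
qed

section \<open>Schwartz functions as tempered distributions\<close>

definition schwartz_distr :: "(real^'n::finite \<Rightarrow> complex) \<Rightarrow> 'n functional"
  where "schwartz_distr v = (\<lambda>f. if f \<in> schwartz then LINT x|lborel. v x * f x else 0)"

lemma schwartz_product_integrable:
  assumes "f \<in> schwartz" "g \<in> schwartz"
  shows "integrable lborel (\<lambda>x. f x * g x)"
  using assms by (intro schwartz_integrable schwartz_mult)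

text \<open>\<open>schwartz_norm\<close> is a real supremum, so it dominates its terms only if these
  are bounded. At order 0 only the empty list occurs, and boundedness of \<open>f\<close>
  suffices.\<close>

lemma norm_le_schwartz_norm:
  assumes "f \<in> schwartz"
  shows "norm (f x) \<le> schwartz_norm 0 f"
proof -
  obtain C where C: "\<And>x. norm (f x) \<le> C" using schwartz_bounded[OF assms] by metis
  have "(1 + norm x) ^ 0 * norm (mixed_partial [] f x) \<le> schwartz_norm 0 f"
    unfolding schwartz_norm_def
  proof (rule cSUP_upper2)
    show "([], x) \<in> {is. length is \<le> 0} \<times> UNIV" by simp
    show "bdd_above ((\<lambda>(is, x). (1 + norm x) ^ 0 * norm (mixed_partial is f x)) ` ({is. length is \<le> 0} \<times> UNIV))"
      using C by (intro bdd_aboveI[of _ C]) auto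
  qed simp
  then show ?thesis by simp
qed

lemma schwartz_distr_tempered:
  fixes v :: "real^'n::finite \<Rightarrow> complex"
  assumes v: "v \<in> schwartz"
  shows "schwartz_distr v \<in> tempered"
  unfolding tempered_def
proof (intro CollectI conjI allI impI ballI)
  show "schwartz_distr v f = 0" if "f \<notin> schwartz" for f using that by (simp add: schwartz_distr_def)
  show "schwartz_distr v (\<lambda>x. f x + g x) = schwartz_distr v f + schwartz_distr v g"
    if "f \<in> schwartz" "g \<in> schwartz" for f g
    using that v by (simp add: schwartz_distr_def schwartz_add distrib_left schwartz_product_integrable)
  show "schwartz_distr v (\<lambda>x. c * f x) = c * schwartz_distr v f" if "f \<in> schwartz" for c f
    using that by (simp add: schwartz_distr_def schwartz_cmult mult.left_commute)
  define K where "K = (LINT x|lborel. norm (v x))"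
  have K: "K \<ge> 0" unfolding K_def by simp
  have bound: "norm (schwartz_distr v g - schwartz_distr v f) \<le> K * schwartz_norm 0 (\<lambda>x. g x - f x)"
    if "f \<in> schwartz" "g \<in> schwartz" for f g
  proof -
    let ?d = "\<lambda>x. g x - f x"
    have d: "?d \<in> schwartz" using that by (intro schwartz_diff)
    have "schwartz_distr v g - schwartz_distr v f = (LINT x|lborel. v x * ?d x)"
      using that v by (simp add: schwartz_distr_def right_diff_distrib schwartz_product_integrable)
    also have "norm \<dots> \<le> (LINT x|lborel. norm (v x) * schwartz_norm 0 ?d)"
    proof (rule Bochner_Integration.integral_norm_bound_integral)
      show "integrable lborel (\<lambda>x. v x * ?d x)" by (rule schwartz_product_integrable[OF v d])
      show "integrable lborel (\<lambda>x. norm (v x) * schwartz_norm 0 ?d)"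
        using schwartz_integrable[OF v] by (intro integrable_mult_left integrable_norm)
      show "norm (v x * ?d x) \<le> norm (v x) * schwartz_norm 0 ?d" for x
        unfolding norm_mult by (intro mult_left_mono norm_le_schwartz_norm[OF d]) auto
    qed
    finally show ?thesis by (simp add: K_def)
  qed
  show "continuous_map schwartz_topology euclidean (schwartz_distr v)"
    unfolding continuous_map_def
  proof (intro conjI allI impI)
    fix U :: "complex set" assume "openin euclidean U"
    then have U: "open U" by simp
    show "openin schwartz_topology {x \<in> topspace schwartz_topology. schwartz_distr v x \<in> U}"
      unfolding openin_schwartz_topology
    proof (intro conjI ballI)
      fix f assume f: "f \<in> {x \<in> topspace schwartz_topology. schwartz_distr v x \<in> U}"
      then have "schwartz_distr v f \<in> U" by simp
      then obtain e where e: "e > 0" "ball (schwartz_distr v f) e \<subseteq> U" using U open_contains_ball by blast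
      show "\<exists>N. \<exists>e>0. {g \<in> schwartz. \<forall>k\<le>N. schwartz_norm k (\<lambda>x. g x - f x) < e}
          \<subseteq> {x \<in> topspace schwartz_topology. schwartz_distr v x \<in> U}"
      \<comment> \<open>The seminorm of order 0 already controls the functional;
        \<open>K + 1\<close> avoids division by 0 when \<open>K = 0\<close>.\<close>
      proof (intro exI[of _ "0::nat"] exI[of _ "e / (K + 1)"] conjI subsetI)
        show "0 < e / (K + 1)" using e K by simp
        fix g assume g: "g \<in> {g \<in> schwartz. \<forall>k\<le>0. schwartz_norm k (\<lambda>x. g x - f x) < e / (K + 1)}"
        then have n: "schwartz_norm 0 (\<lambda>x. g x - f x) < e / (K + 1)" by simp
        have "0 \<le> schwartz_norm 0 (\<lambda>x. g x - f x)"
          using f g by (intro order_trans[OF norm_ge_zero norm_le_schwartz_norm[of _ 0]] schwartz_diff) auto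
        then have "K * schwartz_norm 0 (\<lambda>x. g x - f x) \<le> (K + 1) * schwartz_norm 0 (\<lambda>x. g x - f x)"
          by (intro mult_right_mono) auto
        also have "\<dots> < e" using n K by (simp add: field_simps)
        finally have "dist (schwartz_distr v f) (schwartz_distr v g) < e"
          using bound[of f g] f g by (simp add: dist_norm norm_minus_commute)
        then show "g \<in> {x \<in> topspace schwartz_topology. schwartz_distr v x \<in> U}" using e g by auto
      qed
    qed auto
  qed auto
qed

section \<open>Littlewood-Paley blocks and their representing functions\<close>

definition lp_block :: "(real^'n::finite \<Rightarrow> complex) \<Rightarrow> nat \<Rightarrow> 'n functional \<Rightarrow> 'n functional"
  where "lp_block \<phi>0 j u = distr_inv_fourier (distr_mult (LP_partition \<phi>0 j) (distr_fourier u))"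

locale littlewood_paley =
  fixes \<phi>0 :: "real^'n::finite \<Rightarrow> complex"
  assumes LP: "LP_generator \<phi>0"
begin

lemma generator_schwartz: "\<phi>0 \<in> schwartz"
  using LP by (simp add: LP_generator_def)

lemma generator_eq_1: "norm x \<le> 1 \<Longrightarrow> \<phi>0 x = 1"
  using LP by (simp add: LP_generator_def)

lemma generator_eq_0: "norm x > 2 \<Longrightarrow> \<phi>0 x = 0"
  using LP closure_subset[of "support_on UNIV \<phi>0"] by (force simp: LP_generator_def support_on_def)

lemma partition_schwartz: "LP_partition \<phi>0 j \<in> schwartz"
proof -
  have "(\<lambda>x. \<phi>0 (a *\<^sub>R x)) \<in> schwartz" if "a \<noteq> 0" for a
    using schwartz_affine[OF generator_schwartz that, of 0] by simp
  then show ?thesis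
    unfolding LP_partition_def[abs_def] using generator_schwartz by (cases "j = 0") (auto intro!: schwartz_diff)
qed

text \<open>\<open>\<phi>0\<close> is complex valued and its integral may be 0. Its squared modulus
  has the same plateau on the unit ball, also vanishes beyond radius 2, and has positive
  integral.\<close>

definition bump :: "real^'n \<Rightarrow> complex"
  where "bump x = \<phi>0 x * cnj (\<phi>0 x)"

lemma bump_schwartz: "bump \<in> schwartz"
  unfolding bump_def[abs_def] using generator_schwartz by (intro schwartz_mult schwartz_cnj)

lemma bump_eq_1: "norm x \<le> 1 \<Longrightarrow> bump x = 1"
  by (simp add: bump_def generator_eq_1)

lemma bump_eq_0: "norm x > 2 \<Longrightarrow> bump x = 0"
  by (simp add: bump_def generator_eq_0)

lemma integral_bump_nonzero: "(LINT x|lborel. bump x) \<noteq> 0"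
proof -
  have b: "bump x = of_real ((norm (\<phi>0 x))\<^sup>2)" for x by (simp only: bump_def complex_norm_square)
  have int: "integrable lborel (\<lambda>x. (norm (\<phi>0 x))\<^sup>2)"
    using integrable_norm[OF schwartz_integrable[OF bump_schwartz]] by (simp add: b norm_power)
  have "0 < measure lborel (ball (0::real^'n) 1)"
    using content_ball_pos[of 1 "0::real^'n"] by simp
  also have "measure lborel (ball (0::real^'n) 1) = (LINT x|lborel. indicator (ball (0::real^'n) 1) x)"
    by simp
  also have "\<dots> \<le> (LINT x|lborel. (norm (\<phi>0 x))\<^sup>2)"
    using generator_eq_1 emeasure_lborel_ball_finite[of "0::real^'n" 1]
    by (intro integral_mono int integrable_real_indicator) (auto simp: indicator_def)
  finally have "(LINT x|lborel. (norm (\<phi>0 x))\<^sup>2) \<noteq> 0" by simp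
  then show ?thesis unfolding b by (simp del: of_real_power)
qed

text \<open>\<open>h\<close> itself may fail to be integrable, but its products with dilated bumps
  are. Each product vanishes almost everywhere, and the bumps equal 1 on balls that exhaust the
  space.\<close>

lemma represents_0_AE:
  fixes h :: "real^'n \<Rightarrow> complex"
  assumes "represents h u" "\<And>f. f \<in> schwartz \<Longrightarrow> u f = 0"
  shows "AE x in lborel. h x = 0"
proof -
  have h: "h \<in> borel_measurable lborel" "\<And>f. f \<in> schwartz \<Longrightarrow> integrable lborel (\<lambda>x. h x * f x)"
    "\<And>f. f \<in> schwartz \<Longrightarrow> (LINT x|lborel. h x * f x) = 0"
    using assms by (auto simp: represents_def)
  have "AE x in lborel. h x * bump ((1 / real (Suc m)) *\<^sub>R x) = 0" for m
  proof (rule AE_eq_0_if_orthogonal_schwartz[OF _ _ bump_schwartz integral_bump_nonzero bump_eq_1])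
    have s: "(\<lambda>x. bump ((1 / real (Suc m)) *\<^sub>R x)) \<in> schwartz"
      using schwartz_affine[OF bump_schwartz, of "1 / real (Suc m)" 0] by simp
    then show "integrable lborel (\<lambda>x. h x * bump ((1 / real (Suc m)) *\<^sub>R x))" by (rule h(2))
    show "(LINT x|lborel. h x * bump ((1 / real (Suc m)) *\<^sub>R x) * f x) = 0" if "f \<in> schwartz" for f
      using h(3)[OF schwartz_mult[OF s that]] by (simp add: mult.assoc)
  qed simp
  then have "AE x in lborel. \<forall>m. h x * bump ((1 / real (Suc m)) *\<^sub>R x) = 0"
    unfolding AE_all_countable by blast
  then show ?thesis
  proof eventually_elim
    case (elim x)
    obtain m :: nat where "norm x < real m" using reals_Archimedean2 by blast
    then have "bump ((1 / real (Suc m)) *\<^sub>R x) = 1" by (intro bump_eq_1) (simp add: field_simps)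
    then show ?case using elim by (metis mult.right_neutral)
  qed
qed

lemma represents_unique:
  fixes h :: "real^'n \<Rightarrow> complex"
  assumes "represents h u" "represents k u"
  shows "AE x in lborel. h x = k x"
proof -
  have "represents (\<lambda>x. h x - k x) (\<lambda>f. 0)"
    using assms by (auto simp: represents_def left_diff_distrib)
  then have "AE x in lborel. h x - k x = 0" by (rule represents_0_AE) simp
  then show ?thesis by simp
qed

text \<open>Representing functions agree almost everywhere and the quasi-norm ignores null sets, so
  the infimum runs over a single value.\<close>

lemma distr_Lp_norm_eq:
  fixes h :: "real^'n \<Rightarrow> complex"
  assumes "represents h u"
  shows "distr_Lp_norm (ereal p) u = Lp_norm (ereal p) h"
proof -
  have "Lp_norm (ereal p) k = Lp_norm (ereal p) h" if "represents k u" for k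
  proof -
    have "AE x in lborel. k x = h x" by (rule represents_unique[OF that assms])
    then have "(\<integral>\<^sup>+x. ennreal_powr (ennreal (norm (k x))) p \<partial>lborel) = (\<integral>\<^sup>+x. ennreal_powr (ennreal (norm (h x))) p \<partial>lborel)"
      by (intro nn_integral_cong_AE) auto
    then show ?thesis by (simp add: Lp_norm_def)
  qed
  then show ?thesis
    unfolding distr_Lp_norm_def using assms by (intro INF_eq_const) blast+
qed

lemma lp_block_apply:
  assumes "f \<in> schwartz"
  shows "lp_block \<phi>0 j u f = u (fourier (\<lambda>\<xi>. LP_partition \<phi>0 j \<xi> * inv_fourier f \<xi>))"
  using assms schwartz_inv_fourier[OF assms] schwartz_mult[OF partition_schwartz schwartz_inv_fourier[OF assms]]
  by (simp add: lp_block_def distr_inv_fourier_def distr_mult_def distr_fourier_def)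

text \<open>The multiplication formula is used twice: to carry the transform from the test side to
  \<open>v\<close>, and to free the test function from its inverse transform.\<close>

lemma lp_block_schwartz_distr:
  assumes v: "v \<in> schwartz"
  shows "represents (inv_fourier (\<lambda>\<xi>. LP_partition \<phi>0 j \<xi> * fourier v \<xi>)) (lp_block \<phi>0 j (schwartz_distr v))"
  unfolding represents_def
proof (intro conjI ballI)
  let ?a = "\<lambda>\<xi>. LP_partition \<phi>0 j \<xi> * fourier v \<xi>"
  have a: "?a \<in> schwartz" by (intro schwartz_mult partition_schwartz schwartz_fourier v)
  have ia: "inv_fourier ?a \<in> schwartz" by (rule schwartz_inv_fourier[OF a])
  then show "inv_fourier ?a \<in> borel_measurable lborel" by (simp add: schwartz_measurable)
  fix f :: "real^'n \<Rightarrow> complex" assume f: "f \<in> schwartz"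
  show "integrable lborel (\<lambda>x. inv_fourier ?a x * f x)" by (rule schwartz_product_integrable[OF ia f])
  let ?b = "\<lambda>\<xi>. LP_partition \<phi>0 j \<xi> * inv_fourier f \<xi>"
  have b: "?b \<in> schwartz" by (intro schwartz_mult partition_schwartz schwartz_inv_fourier f)
  have "lp_block \<phi>0 j (schwartz_distr v) f = (LINT x|lborel. v x * fourier ?b x)"
    by (simp add: lp_block_apply[OF f] schwartz_distr_def schwartz_fourier[OF b])
  also have "\<dots> = (LINT x|lborel. fourier v x * ?b x)"
    by (rule fourier_multiplication_formula[OF schwartz_integrable[OF v] schwartz_integrable[OF b]])
  also have "\<dots> = (LINT x|lborel. fourier (inv_fourier ?a) x * inv_fourier f x)"
    unfolding fourier_inv_fourier[OF a] by (intro Bochner_Integration.integral_cong refl) (simp add: mult_ac)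
  also have "\<dots> = (LINT x|lborel. inv_fourier ?a x * fourier (inv_fourier f) x)"
    by (rule fourier_multiplication_formula[symmetric]) (intro schwartz_integrable ia schwartz_inv_fourier f)+
  finally show "lp_block \<phi>0 j (schwartz_distr v) f = (LINT x|lborel. inv_fourier ?a x * f x)"
    by (simp add: fourier_inv_fourier[OF f])
qed

end

section \<open>Nikolskii's inequality\<close>

lemma ennreal_powr_ennreal: "0 \<le> r \<Longrightarrow> ennreal_powr (ennreal r) p = ennreal (r powr p)"
  by (simp add: ennreal_powr_def)

lemma Lp_norm_eq:
  "Lp_norm (ereal p) h = ennreal_powr (\<integral>\<^sup>+x. ennreal (norm (h x) powr p) \<partial>lborel) (1 / p)"
  by (simp add: Lp_norm_def ennreal_powr_ennreal)

lemma Lp_norm_integrable: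
  assumes "integrable lborel (\<lambda>x. norm (h x) powr p)"
  shows "Lp_norm (ereal p) h = ennreal ((LINT x|lborel. norm (h x) powr p) powr (1 / p))"
  using assms by (simp add: Lp_norm_eq nn_integral_eq_integral ennreal_powr_ennreal)

text \<open>Above the level \<open>l\<close> the power \<open>t powr (p - 1)\<close> is at least
  \<open>l powr (p - 1)\<close>. Splitting at a free level stands in for Hoelder's inequality, with
  \<open>l\<close> chosen at the end.\<close>

lemma le_add_powr:
  fixes t l p :: real
  assumes "0 \<le> t" "0 < l" "1 \<le> p"
  shows "t \<le> l + l powr (1 - p) * t powr p"
proof (cases "t \<le> l")
  case True
  then show ?thesis by (simp add: add_increasing2)
next
  case False
  then have "l powr (p - 1) \<le> t powr (p - 1)" using assms by (intro powr_mono2) auto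
  then have "l powr (1 - p) * t powr p \<ge> l powr (1 - p) * (t * l powr (p - 1))"
    using assms False by (intro mult_left_mono) (auto simp: powr_diff field_simps)
  also have "l powr (1 - p) * (t * l powr (p - 1)) = t"
    using assms by (simp add: mult.left_commute powr_add[symmetric])
  finally show ?thesis using assms by simp
qed

text \<open>For \<open>p\<close> at least 1 split \<open>norm (k y)\<close> at a level
  \<open>l\<close>, so that one part is controlled by the \<open>L_1\<close> norm of the kernel and
  the other by its supremum, and balance the two. For \<open>p < 1\<close> write
  \<open>norm (k y)\<close> as \<open>norm (k y) powr (1 - p) * norm (k y) powr p\<close>, bound the
  first factor through the supremum \<open>S\<close> of \<open>w\<close>, and absorb it on the
  left.\<close>

lemma convolution_sup_bound:
  fixes k \<psi> w :: "real^'n::finite \<Rightarrow> complex"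
  assumes p: "0 < p" and k: "integrable lborel k" and kp: "integrable lborel (\<lambda>x. norm (k x) powr p)"
    and A: "\<And>x. norm (\<psi> x) \<le> A" and \<psi>: "integrable lborel \<psi>" and B: "(LINT x|lborel. norm (\<psi> x)) \<le> B"
    and w: "\<And>x. norm (w x) \<le> (LINT y|lborel. norm (k y) * norm (\<psi> (y - x)))"
    and ae: "AE x in lborel. k x = w x"
  shows "norm (w x) \<le> (1 + B) * (A * (LINT y|lborel. norm (k y) powr p)) powr (1 / p)"
proof -
  define I where "I = (LINT y|lborel. norm (k y) powr p)"
  have I0: "I \<ge> 0" by (simp add: I_def)
  have A0: "A \<ge> 0" using A[of 0] norm_ge_zero order_trans by blast
  have B0: "B \<ge> 0" using B order_trans[OF integral_nonneg_AE[where M = lborel and f = "\<lambda>x. norm (\<psi> x)"]] by auto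
  have [measurable]: "k \<in> borel_measurable borel" "\<psi> \<in> borel_measurable borel"
    using k \<psi> by (auto dest: borel_measurable_integrable)
  have \<psi>_shift: "integrable lborel (\<lambda>y. \<psi> (y - x))" "(LINT y|lborel. norm (\<psi> (y - x))) \<le> B" for x
    using lborel_integrable_affine_iff[of 1 \<psi> "- x"] \<psi> lborel_integral_translate[of "\<lambda>y. norm (\<psi> y)" "- x"] B by auto
  have int_k\<psi>: "integrable lborel (\<lambda>y. norm (k y) * norm (\<psi> (y - x)))" for x
  proof (rule Bochner_Integration.integrable_bound)
    show "integrable lborel (\<lambda>y. norm (k y) * A)" using k by auto
  qed (measurable, use A in \<open>auto intro!: AE_I2 mult_left_mono order_trans[OF A] abs_ge_self simp: abs_mult\<close>)
  show ?thesis
  proof (cases "1 \<le> p")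
    case True
    have le: "norm (w x) \<le> l * B + l powr (1 - p) * (A * I)" if "l > 0" for l
    proof -
      have "norm (w x) \<le> (LINT y|lborel. norm (k y) * norm (\<psi> (y - x)))" by (rule w)
      also have "\<dots> \<le> (LINT y|lborel. l * norm (\<psi> (y - x)) + l powr (1 - p) * A * norm (k y) powr p)"
      proof (rule integral_mono[OF int_k\<psi>])
        show "integrable lborel (\<lambda>y. l * norm (\<psi> (y - x)) + l powr (1 - p) * A * norm (k y) powr p)"
          using \<psi>_shift(1) kp by auto
        fix y
        have "norm (k y) * norm (\<psi> (y - x)) \<le> (l + l powr (1 - p) * norm (k y) powr p) * norm (\<psi> (y - x))"
          using le_add_powr[of "norm (k y)" l p] that True by (intro mult_right_mono) auto
        also have "\<dots> = l * norm (\<psi> (y - x)) + l powr (1 - p) * norm (k y) powr p * norm (\<psi> (y - x))"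
          by (simp add: distrib_right)
        also have "\<dots> \<le> l * norm (\<psi> (y - x)) + l powr (1 - p) * norm (k y) powr p * A"
          by (intro add_left_mono mult_left_mono A) auto
        finally show "norm (k y) * norm (\<psi> (y - x)) \<le> l * norm (\<psi> (y - x)) + l powr (1 - p) * A * norm (k y) powr p"
          by (simp add: mult_ac)
      qed
      also have "\<dots> = l * (LINT y|lborel. norm (\<psi> (y - x))) + l powr (1 - p) * (A * I)"
        using \<psi>_shift(1) kp by (simp add: I_def)
      also have "\<dots> \<le> l * B + l powr (1 - p) * (A * I)"
        using \<psi>_shift(2) that by (intro add_right_mono mult_left_mono) auto
      finally show ?thesis .
    qed
    show ?thesis
    \<comment> \<open>If \<open>A * I\<close> is 0, the balanced level is not positive, and letting
      the level tend to 0 gives the bound instead.\<close>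
    proof (cases "A * I = 0")
      case True
      have "norm (w x) \<le> 0 + e" if "e > 0" for e
      proof -
        have "norm (w x) \<le> e / (B + 1) * B" using le[of "e / (B + 1)"] that B0 True by simp
        also have "\<dots> \<le> e" using that B0 by (simp add: field_simps)
        finally show ?thesis by simp
      qed
      then have "norm (w x) \<le> 0" by (rule field_le_epsilon)
      then show ?thesis using B0 by (intro order_trans[OF _ mult_nonneg_nonneg]) auto
    next
      case False
      then have AI: "A * I > 0" using A0 I0 by (simp add: less_le)
      \<comment> \<open>With this level the second term equals the level itself, hence the factor
        \<open>1 + B\<close>.\<close>
      let ?l = "(A * I) powr (1 / p)"
      have "norm (w x) \<le> ?l * B + ?l powr (1 - p) * (A * I)" using False by (intro le) simp
      also have "?l powr (1 - p) * (A * I) = (A * I) powr ((1 / p) * (1 - p) + 1)"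
        using AI by (simp add: powr_powr powr_add)
      also have "(1 / p) * (1 - p) + 1 = 1 / p" using p by (simp add: field_simps)
      finally show ?thesis by (simp add: I_def algebra_simps)
    qed
  next
    case False
    \<comment> \<open>This crude bound rests on integrability of \<open>k\<close> and serves to make
      \<open>S\<close> finite.\<close>
    have w_bdd: "norm (w x) \<le> A * (LINT y|lborel. norm (k y))" for x
    proof -
      have "norm (w x) \<le> (LINT y|lborel. norm (k y) * norm (\<psi> (y - x)))" by (rule w)
      also have "\<dots> \<le> (LINT y|lborel. A * norm (k y))"
        using k A by (intro integral_mono[OF int_k\<psi>]) (auto simp: mult.commute[of A] intro: mult_left_mono)
      finally show ?thesis by simp
    qed
    define S where "S = (SUP x. norm (w x))"
    have bdd: "bdd_above (range (\<lambda>x. norm (w x)))" using w_bdd by (intro bdd_aboveI2)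
    have wS: "norm (w x) \<le> S" for x unfolding S_def by (rule cSUP_upper[OF _ bdd]) simp
    have "S \<le> A * S powr (1 - p) * I"
      unfolding S_def
    proof (rule cSUP_least, simp, fold S_def)
      fix x
      have "norm (w x) \<le> (LINT y|lborel. norm (k y) * norm (\<psi> (y - x)))" by (rule w)
      also have "\<dots> \<le> (LINT y|lborel. A * S powr (1 - p) * norm (k y) powr p)"
      proof (rule integral_mono_AE[OF int_k\<psi>])
        show "integrable lborel (\<lambda>y. A * S powr (1 - p) * norm (k y) powr p)" using kp by auto
        show "AE y in lborel. norm (k y) * norm (\<psi> (y - x)) \<le> A * S powr (1 - p) * norm (k y) powr p"
          using ae
        proof eventually_elim
          case (elim y)
          have "norm (k y) = norm (k y) powr (1 - p) * norm (k y) powr p"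
            by (cases "k y = 0") (auto simp: powr_add[symmetric])
          also have "\<dots> \<le> S powr (1 - p) * norm (k y) powr p"
            using elim wS[of y] False by (intro mult_right_mono powr_mono2) auto
          finally have "norm (k y) * norm (\<psi> (y - x)) \<le> (S powr (1 - p) * norm (k y) powr p) * A"
            by (intro mult_mono A) auto
          then show ?case by (simp add: mult_ac)
        qed
      qed
      also have "\<dots> = A * S powr (1 - p) * I" by (simp add: I_def)
      finally show "norm (w x) \<le> A * S powr (1 - p) * I" .
    qed
    moreover have S0: "S \<ge> 0" using wS[of 0] norm_ge_zero order_trans by blast
    \<comment> \<open>Division by \<open>S powr (1 - p)\<close> absorbs the supremum and leaves
      \<open>S powr p \<le> A * I\<close>.\<close>
    ultimately have "S \<le> (A * I) powr (1 / p)"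
    proof (cases "S = 0")
      case False
      with S0 have S: "S > 0" by simp
      have "S powr p * S powr (1 - p) = S" using S by (simp add: powr_add[symmetric])
      with \<open>S \<le> A * S powr (1 - p) * I\<close> have "S powr p * S powr (1 - p) \<le> (A * I) * S powr (1 - p)"
        by (simp add: mult_ac)
      then have "S powr p \<le> A * I" using S by simp
      then have "(S powr p) powr (1 / p) \<le> (A * I) powr (1 / p)" using p by (intro powr_mono2) auto
      then show ?thesis using S p by (simp add: powr_powr)
    qed simp
    also have "\<dots> \<le> (1 + B) * (A * I) powr (1 / p)" using B0 mult_right_mono[of 1 "1 + B" "(A * I) powr (1 / p)"] by simp
    finally show ?thesis using wS[of x] by (simp add: I_def)
  qed
qed

text \<open>Write the power \<open>p2\<close> as \<open>(p2 - p1) + p1\<close>; the first part is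
  bounded through \<open>M\<close>, the second is integrable.\<close>

lemma Lp_norm_interpolation:
  fixes h :: "real^'n::finite \<Rightarrow> complex"
  assumes p: "0 < p1" "p1 \<le> p2" and [measurable]: "h \<in> borel_measurable borel"
    and I: "integrable lborel (\<lambda>x. norm (h x) powr p1)"
    and M: "AE x in lborel. norm (h x) \<le> M" "0 \<le> M"
  shows "Lp_norm (ereal p2) h \<le> ennreal ((M powr (p2 - p1) * (LINT x|lborel. norm (h x) powr p1)) powr (1 / p2))"
proof -
  have le: "AE x in lborel. norm (h x) powr p2 \<le> M powr (p2 - p1) * norm (h x) powr p1"
    using M(1)
  proof eventually_elim
    case (elim x)
    have "norm (h x) powr p2 = norm (h x) powr (p2 - p1) * norm (h x) powr p1"
      by (simp add: powr_add[symmetric])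
    also have "\<dots> \<le> M powr (p2 - p1) * norm (h x) powr p1"
      using elim p by (intro mult_right_mono powr_mono2) auto
    finally show ?case .
  qed
  have int: "integrable lborel (\<lambda>x. norm (h x) powr p2)"
    by (rule Bochner_Integration.integrable_bound[OF integrable_mult_right[OF I, of "M powr (p2 - p1)"]])
      (measurable, use le in \<open>auto elim!: eventually_mono\<close>)
  have "(LINT x|lborel. norm (h x) powr p2) \<le> (LINT x|lborel. M powr (p2 - p1) * norm (h x) powr p1)"
    by (rule integral_mono_AE[OF int integrable_mult_right[OF I] le])
  then have "(LINT x|lborel. norm (h x) powr p2) powr (1 / p2)
      \<le> (M powr (p2 - p1) * (LINT x|lborel. norm (h x) powr p1)) powr (1 / p2)"
    using p by (intro powr_mono2) auto
  then show ?thesis by (simp add: Lp_norm_integrable[OF int] ennreal_leI)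
qed

section \<open>Band-limited functions and the reproducing kernel\<close>

context littlewood_paley
begin

lemma partition_eq_0:
  assumes "norm \<xi> > 2 ^ Suc j"
  shows "LP_partition \<phi>0 j \<xi> = 0"
proof (cases "j = 0")
  case True
  then show ?thesis using assms by (simp add: LP_partition_def generator_eq_0)
next
  case False
  have 1: "norm ((2 powr (- real j)) *\<^sub>R \<xi>) = norm \<xi> / 2 ^ j"
    by (simp add: powr_minus powr_realpow divide_inverse mult.commute)
  have 2: "norm ((2 powr (- real j + 1)) *\<^sub>R \<xi>) = 2 * (norm \<xi> / 2 ^ j)"
    by (simp add: powr_diff powr_realpow divide_inverse mult.commute)
  have "norm \<xi> / 2 ^ j > 2" using assms by (simp add: field_simps)
  then have "\<phi>0 ((2 powr (- real j)) *\<^sub>R \<xi>) = 0" "\<phi>0 ((2 powr (- real j + 1)) *\<^sub>R \<xi>) = 0"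
    by (auto intro!: generator_eq_0 simp only: 1 2)
  then show ?thesis unfolding LP_partition_def using False by simp
qed

text \<open>Block \<open>j\<close> is paired with \<open>plateau (j + 2)\<close>: its spectrum has
  radius \<open>2 ^ Suc j\<close>, multiplication by a cutoff enlarges this by at most 1, and
  \<open>2 ^ Suc j + 1 \<le> 2 ^ (j + 2)\<close>.\<close>

definition plateau :: "nat \<Rightarrow> real^'n \<Rightarrow> complex"
  where "plateau j \<xi> = \<phi>0 ((1 / 2 ^ j) *\<^sub>R \<xi>)"

lemma plateau_schwartz: "plateau j \<in> schwartz"
  using schwartz_affine[OF generator_schwartz, of "1 / 2 ^ j" 0] by (simp add: plateau_def[abs_def])

lemma plateau_eq_1: "norm \<xi> \<le> 2 ^ j \<Longrightarrow> plateau j \<xi> = 1"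
  by (simp add: plateau_def generator_eq_1)

lemma fourier_plateau: "fourier (plateau j) x = of_real ((2 ^ j) ^ CARD('n)) * fourier \<phi>0 (2 ^ j *\<^sub>R x)"
  unfolding plateau_def[abs_def]
  by (subst fourier_scale) (auto simp: schwartz_measurable generator_schwartz power_divide power_one_over)

text \<open>\<open>bump (2 *\<^sub>R \<eta>)\<close> lives in the unit ball, so its transform is a
  Schwartz function with small spectrum. The divisor is a nonzero multiple of the integral of
  \<open>bump\<close> and makes the value at the origin 1.\<close>

definition cutoff :: "real^'n \<Rightarrow> complex"
  where "cutoff x = fourier (\<lambda>\<eta>. bump (2 *\<^sub>R \<eta>)) x / fourier (\<lambda>\<eta>. bump (2 *\<^sub>R \<eta>)) 0"

lemma cutoff_schwartz: "cutoff \<in> schwartz"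
proof -
  have "(\<lambda>\<eta>. bump (2 *\<^sub>R \<eta>)) \<in> schwartz" using schwartz_affine[OF bump_schwartz, of 2 0] by simp
  from schwartz_cmult[OF schwartz_fourier[OF this], of "inverse (fourier (\<lambda>\<eta>. bump (2 *\<^sub>R \<eta>)) 0)"]
  show ?thesis by (simp add: cutoff_def[abs_def] divide_inverse mult.commute)
qed

lemma cutoff_0: "cutoff 0 = 1"
proof -
  have "fourier (\<lambda>\<eta>. bump (2 *\<^sub>R \<eta>)) 0 = fourier bump 0 / of_real (2 ^ CARD('n))"
    by (subst fourier_scale) (auto simp: schwartz_measurable bump_schwartz)
  moreover have "fourier bump 0 \<noteq> 0" using integral_bump_nonzero by (simp add: fourier_def)
  ultimately show ?thesis by (simp add: cutoff_def)
qed

text \<open>Dilation by \<open>e \<le> 1\<close> shrinks the support on the frequency side, so one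
  unit ball serves all \<open>e\<close>.\<close>

lemma cutoff_eq_fourier:
  assumes "0 < e" "e \<le> 1"
  obtains G where "G \<in> schwartz" "\<And>\<eta>. norm \<eta> > 1 \<Longrightarrow> G \<eta> = 0" "\<And>x. cutoff (e *\<^sub>R x) = fourier G x"
proof
  let ?b = "fourier (\<lambda>\<eta>. bump (2 *\<^sub>R \<eta>)) 0"
  let ?G = "\<lambda>\<eta>. (of_real (inverse e ^ CARD('n)) / ?b) * bump ((2 / e) *\<^sub>R \<eta>)"
  have s: "(\<lambda>\<eta>. bump (a *\<^sub>R \<eta>)) \<in> schwartz" if "a \<noteq> 0" for a
    using schwartz_affine[OF bump_schwartz that, of 0] by simp
  show "?G \<in> schwartz" using assms by (intro schwartz_cmult s) auto
  show "?G \<eta> = 0" if "norm \<eta> > 1" for \<eta>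
  proof -
    have "2 * 1 < 2 * norm \<eta> / e"
      using assms that by (simp add: field_simps)
    then have "bump ((2 / e) *\<^sub>R \<eta>) = 0" using assms by (intro bump_eq_0) simp
    then show ?thesis by simp
  qed
  show "cutoff (e *\<^sub>R x) = fourier ?G x" for x
  proof -
    have "(\<lambda>\<eta>. bump ((2 / e) *\<^sub>R \<eta>)) = (\<lambda>\<eta>. (\<lambda>\<eta>. bump (2 *\<^sub>R \<eta>)) (inverse e *\<^sub>R \<eta>))"
      by (simp add: divide_inverse)
    then have "fourier (\<lambda>\<eta>. bump ((2 / e) *\<^sub>R \<eta>)) x = fourier (\<lambda>\<eta>. bump (2 *\<^sub>R \<eta>)) (e *\<^sub>R x) / of_real (inverse e ^ CARD('n))"
      using assms by (simp only:) (subst fourier_scale, auto simp: schwartz_measurable[OF s])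
    moreover have "fourier ?G x = (of_real (inverse e ^ CARD('n)) / ?b) * fourier (\<lambda>\<eta>. bump ((2 / e) *\<^sub>R \<eta>)) x"
      by (rule fourier_cmult)
    ultimately show ?thesis using assms by (simp only: cutoff_def) (simp add: power_inverse field_simps)
  qed
qed

text \<open>A function representing a block need not be integrable. Multiplied by a dilated cutoff it is,
  and it is still reproduced by convolution with the inverse transform of a plateau function. So it is
  essentially bounded, which allows the supremum to be absorbed when \<open>p < 1\<close>, with a bound
  that does not depend on the dilation.\<close>

lemma lp_block_orthogonal:
  assumes u: "u (\<lambda>x. 0) = 0" and h: "represents h (lp_block \<phi>0 j u)" and e: "0 < e" "e \<le> 1" and f: "f \<in> schwartz"
  defines "f' \<equiv> fourier (\<lambda>\<xi>. plateau (j + 2) \<xi> * inv_fourier f \<xi>)"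
  shows "(LINT x|lborel. h x * cutoff (e *\<^sub>R x) * f' x) = (LINT x|lborel. h x * cutoff (e *\<^sub>R x) * f x)"
proof -
  obtain G where G: "G \<in> schwartz" "\<And>\<eta>. norm \<eta> > 1 \<Longrightarrow> G \<eta> = 0" "\<And>x. cutoff (e *\<^sub>R x) = fourier G x"
    using cutoff_eq_fourier[OF e] by blast
  have P: "(\<lambda>\<xi>. plateau (j + 2) \<xi> * inv_fourier f \<xi>) \<in> schwartz"
    by (intro schwartz_mult plateau_schwartz schwartz_inv_fourier f)
  have f': "f' \<in> schwartz" unfolding f'_def by (rule schwartz_fourier[OF P])
  define k where "k x = f' x - f x" for x
  have k: "k \<in> schwartz" unfolding k_def[abs_def] by (intro schwartz_diff f' f)
  have ik: "inv_fourier k \<xi> = (plateau (j + 2) \<xi> - 1) * inv_fourier f \<xi>" for \<xi>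
  proof -
    have "inv_fourier k \<xi> = inv_fourier f' \<xi> - inv_fourier f \<xi>"
      unfolding inv_fourier_eq k_def
      using fourier_add[OF schwartz_integrable[OF f'] schwartz_integrable[OF schwartz_cmult[OF f, of "-1"]], of "- \<xi>"]
        fourier_cmult[of "-1" f "- \<xi>"] by simp
    moreover have "inv_fourier f' \<xi> = plateau (j + 2) \<xi> * inv_fourier f \<xi>"
      unfolding f'_def by (simp only: inv_fourier_fourier[OF P])
    ultimately show ?thesis by (simp add: algebra_simps)
  qed
  have gk: "(\<lambda>x. cutoff (e *\<^sub>R x) * k x) \<in> schwartz"
    unfolding G(3) by (intro schwartz_mult schwartz_fourier G k)
  \<comment> \<open>On the frequency side the product is a convolution of \<open>G\<close>, living
    in the unit ball, with \<open>inv_fourier k\<close>, which vanishes on the ball of radius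
    \<open>2 ^ (j + 2)\<close>. The result vanishes on the ball of radius \<open>2 ^ Suc j\<close>,
    outside of which the partition function is 0.\<close>
  have "LP_partition \<phi>0 j \<xi> * inv_fourier (\<lambda>x. cutoff (e *\<^sub>R x) * k x) \<xi> = 0" for \<xi>
  proof (cases "norm \<xi> > 2 ^ Suc j")
    case True
    then show ?thesis by (simp add: partition_eq_0)
  next
    case False
    have "G \<eta> * inv_fourier k (\<xi> - \<eta>) = 0" for \<eta>
    proof (cases "norm \<eta> > 1")
      case False
      have "norm (\<xi> - \<eta>) \<le> 2 ^ Suc j + 1"
        using False \<open>\<not> norm \<xi> > 2 ^ Suc j\<close> norm_triangle_ineq4[of \<xi> \<eta>] by simp
      also have "\<dots> \<le> (2::real) ^ Suc j + 2 ^ Suc j" by (intro add_left_mono one_le_power) simp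
      finally have "norm (\<xi> - \<eta>) \<le> 2 ^ (j + 2)" by simp
      then show ?thesis by (simp add: ik plateau_eq_1 del: power_Suc)
    qed (simp add: G)
    then show ?thesis
      unfolding G(3) inv_fourier_mult_fourier[OF schwartz_integrable[OF G(1)] schwartz_integrable[OF k]]
      by (simp only: integral_zero mult_zero_right)
  qed
  then have "lp_block \<phi>0 j u (\<lambda>x. cutoff (e *\<^sub>R x) * k x) = u (fourier (\<lambda>\<xi>. 0))"
    by (simp only: lp_block_apply[OF gk])
  also have "fourier (\<lambda>\<xi>. 0) = (\<lambda>x :: real^'n. 0)" by (simp add: fourier_def fun_eq_iff)
  finally have "(LINT x|lborel. h x * (cutoff (e *\<^sub>R x) * k x)) = 0"
    using h gk u by (simp add: represents_def)
  moreover have "integrable lborel (\<lambda>x. h x * cutoff (e *\<^sub>R x) * f' x)" "integrable lborel (\<lambda>x. h x * cutoff (e *\<^sub>R x) * f x)"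
  proof -
    have "(\<lambda>x. cutoff (e *\<^sub>R x) * f' x) \<in> schwartz" "(\<lambda>x. cutoff (e *\<^sub>R x) * f x) \<in> schwartz"
      unfolding G(3) by (intro schwartz_mult schwartz_fourier G f f')+
    then show "integrable lborel (\<lambda>x. h x * cutoff (e *\<^sub>R x) * f' x)" "integrable lborel (\<lambda>x. h x * cutoff (e *\<^sub>R x) * f x)"
      using h by (simp_all add: represents_def mult.assoc)
  qed
  ultimately show ?thesis
    by (simp add: k_def right_diff_distrib mult.assoc[symmetric])
qed

text \<open>The rescaled kernel \<open>\<psi>\<close> has an \<open>L_1\<close> norm independent of
  \<open>j\<close> and a supremum of order \<open>(2 ^ j) ^ CARD('n)\<close>. Both enter
  \<open>convolution_sup_bound\<close>, applied to \<open>h\<close> times a cutoff; the cutoff is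
  removed by letting its dilates tend to the constant 1.\<close>

lemma band_limited_bound:
  obtains C D where "0 < C" "0 < D"
    "\<And>j u h p. u (\<lambda>x. 0) = 0 \<Longrightarrow> represents h (lp_block \<phi>0 j u) \<Longrightarrow> 0 < p \<Longrightarrow>
      integrable lborel (\<lambda>x. norm (h x) powr p) \<Longrightarrow>
      AE x in lborel. norm (h x) \<le> C * (D * (2 ^ j) ^ CARD('n) * (LINT x|lborel. norm (h x) powr p)) powr (1 / p)"
proof -
  define c where "c = (2 * pi) powr (- real CARD('n) / 2)"
  have c0: "c > 0" by (simp add: c_def)
  have F: "fourier \<phi>0 \<in> schwartz" by (rule schwartz_fourier[OF generator_schwartz])
  obtain A0 where A0: "A0 > 0" "\<And>x. norm (fourier \<phi>0 x) \<le> A0" using schwartz_bounded[OF F] by metis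
  obtain K where K: "K > 0" "\<And>x. norm (cutoff x) \<le> K" using schwartz_bounded[OF cutoff_schwartz] by metis
  define B where "B = c * (LINT x|lborel. norm (fourier \<phi>0 x))"
  have B0: "B \<ge> 0" using c0 by (simp add: B_def)
  \<comment> \<open>\<open>K\<close> is the price for estimating the cut-off function by
    \<open>h\<close>.\<close>
  define C where "C = (1 + B) * K"
  \<comment> \<open>The factor \<open>4 ^ CARD('n)\<close> accounts for the index
    \<open>j + 2\<close> of the plateau in place of \<open>j\<close>.\<close>
  define D where "D = c * A0 * 4 ^ CARD('n)"
  note [measurable] = schwartz_measurable[OF F] schwartz_measurable[OF cutoff_schwartz]
  show thesis
  proof (rule that)
    show "C > 0" using B0 K by (simp add: C_def)
    show "D > 0" using c0 A0 by (simp add: D_def)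
    fix j and u :: "'n functional" and h :: "real^'n \<Rightarrow> complex" and p :: real
    assume u: "u (\<lambda>x. 0) = 0" and h: "represents h (lp_block \<phi>0 j u)" and p: "0 < p"
      and I: "integrable lborel (\<lambda>x. norm (h x) powr p)"
    have [measurable]: "h \<in> borel_measurable borel" using h by (simp add: represents_def)
    define \<psi> where "\<psi> x = of_real c * fourier (plateau (j + 2)) x" for x
    have \<psi>_eq: "\<psi> x = of_real (c * (2 ^ (j + 2)) ^ CARD('n)) * fourier \<phi>0 (2 ^ (j + 2) *\<^sub>R x)" for x
      by (simp only: \<psi>_def fourier_plateau) simp
    define A where "A = D * (2 ^ j) ^ CARD('n)"
    have A_pos: "A > 0" using \<open>D > 0\<close> by (simp add: A_def)
    have A_eq: "A = c * (2 ^ (j + 2)) ^ CARD('n) * A0"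
      by (simp add: A_def D_def power_add power_mult_distrib mult_ac)
    have \<psi>_le: "norm (\<psi> x) \<le> A" for x
      using c0 A0(2) unfolding \<psi>_eq A_eq by (simp add: norm_mult norm_power mult_left_mono)
    have \<psi>_s: "\<psi> \<in> schwartz"
      unfolding \<psi>_def[abs_def] by (intro schwartz_cmult schwartz_fourier plateau_schwartz)
    note [measurable] = schwartz_measurable[OF \<psi>_s]
    have \<psi>_B: "(LINT x|lborel. norm (\<psi> x)) \<le> B"
    proof -
      have "(LINT x|lborel. norm (\<psi> x)) = c * (2 ^ (j + 2)) ^ CARD('n) * (LINT x|lborel. norm (fourier \<phi>0 (0 + 2 ^ (j + 2) *\<^sub>R x)))"
        using c0 unfolding \<psi>_eq by (simp add: norm_mult norm_power)
      also have "(LINT x|lborel. norm (fourier \<phi>0 (0 + 2 ^ (j + 2) *\<^sub>R x))) = (LINT x|lborel. norm (fourier \<phi>0 x)) /\<^sub>R \<bar>2 ^ (j + 2)\<bar> ^ CARD('n)"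
        by (subst lborel_integral_affine[of "2 ^ (j + 2)" "\<lambda>x. norm (fourier \<phi>0 x)" 0]) auto
      finally have "(LINT x|lborel. norm (\<psi> x)) = c * (LINT x|lborel. norm (fourier \<phi>0 x))"
        by (simp add: field_simps)
      then show ?thesis by (simp add: B_def)
    qed
    define M where "M = C * (A * (LINT x|lborel. norm (h x) powr p)) powr (1 / p)"
    have bound: "AE x in lborel. norm (h x * cutoff ((1 / real (Suc m)) *\<^sub>R x)) \<le> M" for m
    proof -
      define e where "e = 1 / real (Suc m)"
      have e: "0 < e" "e \<le> 1" by (auto simp: e_def)
      define k where "k x = h x * cutoff (e *\<^sub>R x)" for x
      have [measurable]: "k \<in> borel_measurable borel" unfolding k_def[abs_def] by measurable
      have ks: "(\<lambda>x. cutoff (e *\<^sub>R x)) \<in> schwartz" using schwartz_affine[OF cutoff_schwartz, of e 0] e by simp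
      have k: "integrable lborel k" using h ks by (simp add: represents_def k_def[abs_def])
      define w where "w x = (LINT y|lborel. \<psi> (y - x) * k y)" for x
      have "(\<lambda>(x, y). \<psi> (y - x) * k y) \<in> borel_measurable (borel \<Otimes>\<^sub>M lborel)" by measurable
      then have [measurable]: "w \<in> borel_measurable borel"
        unfolding w_def[abs_def] by (intro lborel.borel_measurable_lebesgue_integral)
      have int_w: "integrable lborel (\<lambda>y. \<psi> (y - x) * k y)" for x
        by (rule integrable_bounded_mult[OF k _ \<psi>_le]) measurable
      have w_le: "norm (w x) \<le> (LINT y|lborel. norm (k y) * norm (\<psi> (y - x)))" for x
        using integral_norm_bound[of lborel "\<lambda>y. \<psi> (y - x) * k y"] by (simp add: w_def norm_mult mult.commute)
      have w_le': "norm (w x) \<le> A * (LINT y|lborel. norm (k y))" for x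
      proof -
        have "norm (w x) \<le> (LINT y|lborel. A * norm (k y))" unfolding w_def
          by (rule Bochner_Integration.integral_norm_bound_integral[OF int_w])
            (use k \<psi>_le in \<open>auto simp: norm_mult intro!: mult_right_mono\<close>)
        then show ?thesis by simp
      qed
      \<comment> \<open>Tested against \<open>f\<close>, the plateau may be inserted on the side of
        \<open>k\<close> by \<open>lp_block_orthogonal\<close>, and Fubini turns the result into the
        convolution \<open>w\<close>.\<close>
      have "represents (\<lambda>x. k x - w x) (\<lambda>f. 0)"
        unfolding represents_def
      proof (intro conjI ballI)
        fix f :: "real^'n \<Rightarrow> complex" assume f: "f \<in> schwartz"
        note [measurable] = schwartz_measurable[OF f]
        obtain Cf where Cf: "\<And>x. norm (f x) \<le> Cf" using schwartz_bounded[OF f] by metis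
        have i1: "integrable lborel (\<lambda>x. k x * f x)"
          unfolding mult.commute[of "k _"] by (rule integrable_bounded_mult[OF k _ Cf]) measurable
        have i2: "integrable lborel (\<lambda>x. w x * f x)"
          by (rule integrable_bounded_mult[OF schwartz_integrable[OF f] _ w_le']) measurable
        show "integrable lborel (\<lambda>x. (k x - w x) * f x)" using i1 i2 by (simp add: left_diff_distrib)
        have "(LINT x|lborel. k x * f x) = (LINT y|lborel. k y * fourier (\<lambda>\<xi>. plateau (j + 2) \<xi> * inv_fourier f \<xi>) y)"
          unfolding k_def by (rule lp_block_orthogonal[OF u h e f, symmetric])
        also have "(\<lambda>y. fourier (\<lambda>\<xi>. plateau (j + 2) \<xi> * inv_fourier f \<xi>) y) = (\<lambda>y. LINT x|lborel. \<psi> (y - x) * f x)"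
          unfolding fourier_mult_inv_fourier[OF schwartz_integrable[OF f] schwartz_integrable[OF plateau_schwartz]] \<psi>_def c_def
          by (subst integral_mult_right_zero[symmetric]) (simp add: mult_ac)
        also have "(LINT y|lborel. k y * (LINT x|lborel. \<psi> (y - x) * f x)) = (LINT x|lborel. f x * w x)"
          unfolding w_def
          by (rule lborel_Fubini_kernel[OF k schwartz_integrable[OF f] _ \<psi>_le]) measurable
        finally show "0 = (LINT x|lborel. (k x - w x) * f x)"
          using i1 i2 by (simp add: left_diff_distrib mult.commute[of "f _"])
      qed measurable
      then have "AE x in lborel. k x - w x = 0" by (rule represents_0_AE) simp
      then have kw: "AE x in lborel. k x = w x" by simp
      \<comment> \<open>Trading the integral of the cut-off function for that of \<open>h\<close>
        makes the bound independent of \<open>e\<close>.\<close>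
      have k_le: "norm (k x) powr p \<le> K powr p * norm (h x) powr p" for x
      proof -
        have "norm (k x) \<le> K * norm (h x)"
          using K(2)[of "e *\<^sub>R x"] by (simp add: k_def norm_mult mult.commute[of K] mult_left_mono)
        then have "norm (k x) powr p \<le> (K * norm (h x)) powr p" using p by (intro powr_mono2) auto
        then show ?thesis using K by (simp add: powr_mult)
      qed
      have kp: "integrable lborel (\<lambda>x. norm (k x) powr p)"
        by (rule Bochner_Integration.integrable_bound[OF integrable_mult_right[OF I, of "K powr p"]])
          (measurable, use k_le in simp)
      have "(A * (LINT x|lborel. norm (k x) powr p)) powr (1 / p) \<le> (A * (LINT x|lborel. K powr p * norm (h x) powr p)) powr (1 / p)"
        using p A_pos k_le I kp by (intro powr_mono2 mult_left_mono integral_mono) (auto intro!: mult_nonneg_nonneg)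
      also have "\<dots> = (K powr p * (A * (LINT x|lborel. norm (h x) powr p))) powr (1 / p)"
        by (simp add: mult_ac)
      also have "\<dots> = K * (A * (LINT x|lborel. norm (h x) powr p)) powr (1 / p)"
        using p A_pos K by (subst powr_mult) (auto simp: powr_powr)
      finally have "(1 + B) * (A * (LINT x|lborel. norm (k x) powr p)) powr (1 / p) \<le> M"
        using B0 by (simp add: M_def C_def mult.assoc mult_left_mono)
      then have "norm (w x) \<le> M" for x
        using convolution_sup_bound[OF p k kp \<psi>_le schwartz_integrable[OF \<psi>_s] \<psi>_B w_le kw, of x] by linarith
      then show ?thesis using kw by (auto simp: k_def e_def elim!: eventually_mono)
    qed
    then have "AE x in lborel. \<forall>m. norm (h x * cutoff ((1 / real (Suc m)) *\<^sub>R x)) \<le> M"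
      unfolding AE_all_countable by blast
    then show "AE x in lborel. norm (h x) \<le> C * (D * (2 ^ j) ^ CARD('n) * (LINT x|lborel. norm (h x) powr p)) powr (1 / p)"
    proof eventually_elim
      case (elim x)
      have "isCont cutoff 0" using schwartz_differentiable[OF cutoff_schwartz] differentiable_imp_continuous_within by blast
      then have "(\<lambda>m. norm (h x * cutoff ((1 / real (Suc m)) *\<^sub>R x))) \<longlonglongrightarrow> norm (h x * cutoff 0)"
        by (intro tendsto_norm tendsto_mult tendsto_const isCont_tendsto_compose[OF _ LIMSEQ_scaleR_Suc])
      then have "norm (h x * cutoff 0) \<le> M"
        by (rule LIMSEQ_le_const2) (use elim in blast)
      then show ?case by (simp add: cutoff_0 M_def A_def)
    qed
  qed
qed

text \<open>The supremum bound is inserted into \<open>Lp_norm_interpolation\<close>. It carries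
  \<open>2 ^ j\<close> to the power \<open>CARD('n) / p1\<close>, which is raised to
  \<open>(p2 - p1) / p2\<close>; and \<open>(1 / p1) * ((p2 - p1) / p2)\<close> is
  \<open>1 / p1 - 1 / p2\<close>.\<close>

theorem nikolskii_inequality:
  assumes p: "0 < p1" "p1 \<le> p2"
  obtains C where "0 < C" "\<And>j u h. u (\<lambda>x. 0) = 0 \<Longrightarrow> represents h (lp_block \<phi>0 j u) \<Longrightarrow>
    Lp_norm (ereal p2) h \<le> ennreal (C * 2 powr (real j * real CARD('n) * (1 / p1 - 1 / p2))) * Lp_norm (ereal p1) h"
proof -
  obtain C D where CD: "0 < C" "0 < D"
    and bound: "\<And>j u h p. u (\<lambda>x. 0) = 0 \<Longrightarrow> represents h (lp_block \<phi>0 j u) \<Longrightarrow> 0 < p \<Longrightarrow>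
      integrable lborel (\<lambda>x. norm (h x) powr p) \<Longrightarrow>
      AE x in lborel. norm (h x) \<le> C * (D * (2 ^ j) ^ CARD('n) * (LINT x|lborel. norm (h x) powr p)) powr (1 / p)"
    using band_limited_bound by blast
  define E where "E = C powr ((p2 - p1) / p2) * D powr (1 / p1 - 1 / p2)"
  show thesis
  proof (rule that)
    show "E > 0" using CD by (simp add: E_def)
    fix j and u :: "'n functional" and h :: "real^'n \<Rightarrow> complex"
    assume u: "u (\<lambda>x. 0) = 0" and h: "represents h (lp_block \<phi>0 j u)"
    have [measurable]: "h \<in> borel_measurable borel" using h by (simp add: represents_def)
    let ?a = "2 powr (real j * real CARD('n) * (1 / p1 - 1 / p2))"
    show "Lp_norm (ereal p2) h \<le> ennreal (E * ?a) * Lp_norm (ereal p1) h"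
    \<comment> \<open>An infinite quasi-norm on the right settles the claim only because the factor
      in front is positive, as 0 times infinity is 0 here.\<close>
    proof (cases "integrable lborel (\<lambda>x. norm (h x) powr p1)")
      case False
      then have "(\<integral>\<^sup>+x. ennreal (norm (h x) powr p1) \<partial>lborel) = \<infinity>"
        by (simp add: integrable_iff_bounded less_top[symmetric])
      then have "Lp_norm (ereal p1) h = \<infinity>" by (simp add: Lp_norm_eq ennreal_powr_def)
      moreover have "ennreal (E * ?a) * \<infinity> = \<infinity>"
        using \<open>E > 0\<close> by (simp add: ennreal_mult_eq_top_iff ennreal_eq_0_iff not_le)
      ultimately show ?thesis by (simp only: infinity_ennreal_def top_greatest)
    next
      case True
      define I where "I = (LINT x|lborel. norm (h x) powr p1)"
      have I0: "I \<ge> 0" by (simp add: I_def)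
      define X where "X = D * (2 ^ j) ^ CARD('n)"
      have X0: "X > 0" using CD by (simp add: X_def)
      define M where "M = C * (X * I) powr (1 / p1)"
      have M: "AE x in lborel. norm (h x) \<le> M" "0 \<le> M"
        using bound[OF u h p(1) True] CD by (simp_all add: M_def X_def I_def)
      have "Lp_norm (ereal p2) h \<le> ennreal ((M powr (p2 - p1) * I) powr (1 / p2))"
        unfolding I_def by (rule Lp_norm_interpolation[OF p _ True M]) measurable
      also have "(M powr (p2 - p1) * I) powr (1 / p2) = E * ?a * I powr (1 / p1)"
      proof (cases "I = 0")
        case False
        then have I: "I > 0" using I0 by simp
        have X: "X powr (1 / p1 - 1 / p2) = D powr (1 / p1 - 1 / p2) * ?a"
          using CD by (simp add: X_def powr_mult powr_powr powr_realpow[symmetric])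
        have e: "(1 / p1) * ((p2 - p1) * (1 / p2)) = 1 / p1 - 1 / p2" using p by (simp add: field_simps)
        have "(M powr (p2 - p1) * I) powr (1 / p2) = M powr ((p2 - p1) * (1 / p2)) * I powr (1 / p2)"
          using I by (simp add: powr_mult powr_powr)
        also have "M powr ((p2 - p1) * (1 / p2)) = C powr ((p2 - p1) / p2) * (X * I) powr (1 / p1 - 1 / p2)"
          using CD I X0 by (simp add: M_def powr_mult powr_powr flip: e)
        also have "(X * I) powr (1 / p1 - 1 / p2) = X powr (1 / p1 - 1 / p2) * I powr (1 / p1 - 1 / p2)"
          using I X0 by (simp add: powr_mult)
        also have "C powr ((p2 - p1) / p2) * (X powr (1 / p1 - 1 / p2) * I powr (1 / p1 - 1 / p2)) * I powr (1 / p2)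
            = C powr ((p2 - p1) / p2) * X powr (1 / p1 - 1 / p2) * (I powr (1 / p1 - 1 / p2) * I powr (1 / p2))"
          by (simp only: mult_ac)
        also have "I powr (1 / p1 - 1 / p2) * I powr (1 / p2) = I powr (1 / p1)"
          by (simp add: powr_add[symmetric])
        finally show ?thesis by (simp add: X E_def mult_ac)
      qed simp
      also have "ennreal (E * ?a * I powr (1 / p1)) = ennreal (E * ?a) * Lp_norm (ereal p1) h"
        using \<open>E > 0\<close> by (simp add: Lp_norm_integrable[OF True] I_def ennreal_mult')
      finally show ?thesis .
    qed
  qed
qed

end

section \<open>Sequence quasi-norms\<close>

lemma ennreal_powr_0 [simp]: "ennreal_powr 0 r = 0"
  by (simp add: ennreal_powr_def)

lemma ennreal_powr_1 [simp]: "ennreal_powr 1 r = 1"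
  by (simp add: ennreal_powr_def)

lemma ennreal_powr_top [simp]: "ennreal_powr \<top> r = \<top>"
  by (simp add: ennreal_powr_def)

lemma ennreal_powr_mono:
  assumes "a \<le> b" "0 \<le> r"
  shows "ennreal_powr a r \<le> ennreal_powr b r"
proof (cases b)
  case (real y)
  with assms obtain x where "a = ennreal x" "0 \<le> x" "x \<le> y" by (cases a) (auto simp: top_unique)
  then show ?thesis using real assms by (simp add: ennreal_powr_ennreal ennreal_leI powr_mono2)
qed simp

lemma ennreal_powr_powr:
  assumes "0 < r" "0 < s"
  shows "ennreal_powr (ennreal_powr a r) s = ennreal_powr a (r * s)"
  using assms by (cases a) (simp_all add: ennreal_powr_ennreal powr_powr)

lemma ennreal_powr_one_exponent [simp]: "ennreal_powr a 1 = a"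
  by (cases a) (simp_all add: ennreal_powr_ennreal)

lemma ennreal_powr_inverse:
  assumes "0 < r"
  shows "ennreal_powr (ennreal_powr a r) (1 / r) = a" "ennreal_powr (ennreal_powr a (1 / r)) r = a"
  using assms by (simp_all add: ennreal_powr_powr)

lemma ennreal_powr_eq_0_iff: "ennreal_powr a r = 0 \<longleftrightarrow> a = 0"
  by (cases a) (auto simp: ennreal_powr_ennreal)

lemma ennreal_powr_mult:
  "ennreal_powr (a * b) r = ennreal_powr a r * ennreal_powr b r"
proof (cases "a = \<top> \<or> b = \<top>")
  case True
  then show ?thesis
    by (cases "a = 0"; cases "b = 0") (auto simp: ennreal_mult_top ennreal_top_mult ennreal_powr_eq_0_iff)
next
  case False
  then obtain x y where "a = ennreal x" "0 \<le> x" "b = ennreal y" "0 \<le> y" by (cases a; cases b) auto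
  then show ?thesis by (simp add: ennreal_mult[symmetric] ennreal_powr_ennreal powr_mult)
qed

lemma ennreal_powr_add_exponent:
  assumes "0 < r" "0 < s"
  shows "ennreal_powr a (r + s) = ennreal_powr a r * ennreal_powr a s"
  using assms by (cases a) (simp_all add: ennreal_powr_ennreal ennreal_mult[symmetric] powr_add ennreal_top_mult)

text \<open>Bounding the sum by twice the maximum works alike for exponents below and above
  1.\<close>

lemma ennreal_powr_add_le:
  assumes "0 \<le> r"
  shows "ennreal_powr (a + b) r \<le> ennreal (2 powr r) * (ennreal_powr a r + ennreal_powr b r)"
proof -
  have "a + b \<le> 2 * max a b" by (cases "a \<le> b") (auto simp: mult_2 max_def add_mono)
  then have "ennreal_powr (a + b) r \<le> ennreal_powr (ennreal 2 * max a b) r"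
    using assms by (intro ennreal_powr_mono) auto
  also have "\<dots> = ennreal (2 powr r) * ennreal_powr (max a b) r"
    by (simp only: ennreal_powr_mult) (simp add: ennreal_powr_ennreal del: ennreal_numeral)
  also have "\<dots> \<le> ennreal (2 powr r) * (ennreal_powr a r + ennreal_powr b r)"
    by (intro mult_left_mono) (auto simp: max_def add_increasing add_increasing2)
  finally show ?thesis .
qed

section \<open>Quasi-norm properties and inclusions of sequence spaces\<close>

lemma positive_ereal_cases:
  assumes "0 < (q :: ereal)"
  obtains "q = \<infinity>" | r where "q = ereal r" "0 < r"
  using assms by (cases q) auto

lemma lq_norm_infinity: "lq_norm \<infinity> a = (SUP j. a j)"
  by (simp add: lq_norm_def)

lemma lq_norm_ereal: "lq_norm (ereal r) a = ennreal_powr (\<Sum>j. ennreal_powr (a j) r) (1 / r)"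
  by (simp add: lq_norm_def)

lemma lq_norm_mono:
  assumes "0 < q" "\<And>j. a j \<le> b j"
  shows "lq_norm q a \<le> lq_norm q b"
  using assms(1)
proof (cases q rule: positive_ereal_cases)
  case 1
  then show ?thesis using assms(2) by (auto simp: lq_norm_infinity intro: SUP_mono)
next
  case (2 r)
  then show ?thesis using assms(2)
    by (auto simp: lq_norm_ereal intro!: ennreal_powr_mono suminf_le)
qed

lemma lq_norm_cmult:
  assumes "0 < q"
  shows "lq_norm q (\<lambda>j. c * a j) = c * lq_norm q a"
  using assms
proof (cases q rule: positive_ereal_cases)
  case 1
  then show ?thesis by (simp add: lq_norm_infinity SUP_mult_left_ennreal)
next
  case (2 r)
  then show ?thesis by (simp add: lq_norm_ereal ennreal_powr_mult ennreal_powr_inverse)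
qed

lemma lq_norm_zero: "0 < q \<Longrightarrow> lq_norm q (\<lambda>j. 0) = 0"
  using lq_norm_cmult[of q 0 "\<lambda>j. 0"] by simp

text \<open>\<open>ennreal_powr_add_le\<close> is used inside the sum with exponent \<open>r\<close>
  and outside with \<open>1 / r\<close>, which treats all finite exponents alike.\<close>

lemma lq_norm_add:
  assumes "0 < q"
  obtains K where "0 < K" "\<And>a b. lq_norm q (\<lambda>j. a j + b j) \<le> ennreal K * (lq_norm q a + lq_norm q b)"
  using assms
proof (cases q rule: positive_ereal_cases)
  case 1
  have "lq_norm q (\<lambda>j. a j + b j) \<le> ennreal 1 * (lq_norm q a + lq_norm q b)" for a b
    unfolding 1 lq_norm_infinity by (auto intro!: SUP_least add_mono SUP_upper)
  then show ?thesis using that[of 1] by simp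
next
  case (2 r)
  let ?K = "(2 powr r) powr (1 / r) * 2 powr (1 / r)"
  have "lq_norm q (\<lambda>j. a j + b j) \<le> ennreal ?K * (lq_norm q a + lq_norm q b)" for a b
  proof -
    let ?A = "\<Sum>j. ennreal_powr (a j) r" and ?B = "\<Sum>j. ennreal_powr (b j) r"
    have "(\<Sum>j. ennreal_powr (a j + b j) r) \<le> (\<Sum>j. ennreal (2 powr r) * (ennreal_powr (a j) r + ennreal_powr (b j) r))"
      using 2 by (intro suminf_le ennreal_powr_add_le) auto
    also have "\<dots> = ennreal (2 powr r) * (?A + ?B)"
      by (simp add: suminf_add[symmetric])
    finally have "lq_norm q (\<lambda>j. a j + b j) \<le> ennreal_powr (ennreal (2 powr r) * (?A + ?B)) (1 / r)"
      using 2 by (simp add: lq_norm_ereal ennreal_powr_mono)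
    also have "\<dots> = ennreal ((2 powr r) powr (1 / r)) * ennreal_powr (?A + ?B) (1 / r)"
      by (simp only: ennreal_powr_mult) (simp add: ennreal_powr_ennreal)
    also have "\<dots> \<le> ennreal ((2 powr r) powr (1 / r)) * (ennreal (2 powr (1 / r)) * (ennreal_powr ?A (1 / r) + ennreal_powr ?B (1 / r)))"
      using 2 by (intro mult_left_mono ennreal_powr_add_le) auto
    finally show ?thesis using 2 by (simp add: lq_norm_ereal ennreal_mult mult.assoc)
  qed
  then show ?thesis using that[of ?K] by simp
qed

lemma lq_norm_component_le:
  assumes "0 < q"
  shows "a j \<le> lq_norm q a"
  using assms
proof (cases q rule: positive_ereal_cases)
  case 1
  then show ?thesis by (auto simp: lq_norm_infinity intro: SUP_upper)
next
  case (2 r)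
  have "ennreal_powr (a j) r = (\<Sum>i\<in>{j}. ennreal_powr (a i) r)" by simp
  also have "\<dots> \<le> (\<Sum>i. ennreal_powr (a i) r)" by (intro sum_le_suminf) auto
  finally have "ennreal_powr (ennreal_powr (a j) r) (1 / r) \<le> lq_norm q a"
    using 2 by (simp add: lq_norm_ereal ennreal_powr_mono)
  then show ?thesis using 2 by (simp add: ennreal_powr_inverse)
qed

text \<open>A bump placed at scale \<open>j\<close> is also seen by block \<open>j + 1\<close>; its
  contribution there is measured by a shifted sequence.\<close>

lemma lq_norm_shift:
  assumes "0 < q"
  shows "lq_norm q (\<lambda>j. if j = 0 then 0 else a (j - 1)) = lq_norm q a"
  using assms
proof (cases q rule: positive_ereal_cases)
  case 1
  have "(SUP j. if j = 0 then 0 else a (j - 1)) \<le> (SUP j. a j)"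
    by (rule SUP_least) (auto intro: SUP_upper)
  moreover have "(SUP j. a j) \<le> (SUP j. if j = 0 then 0 else a (j - 1))"
    by (rule SUP_least, rule SUP_upper2[of "Suc _"]) auto
  ultimately show ?thesis unfolding 1 lq_norm_infinity by (rule antisym)
next
  case (2 r)
  have "(\<Sum>j. ennreal_powr (if j = 0 then 0 else a (j - 1)) r) = (\<Sum>j. ennreal_powr (a j) r)"
    using sums_unique[OF sums_Suc[of "\<lambda>j. ennreal_powr (if j = 0 then 0 else a (j - 1)) r" "\<Sum>j. ennreal_powr (a j) r"]]
      summable_sums[OF summableI, of "\<lambda>j. ennreal_powr (a j) r"] by simp
  then show ?thesis using 2 by (simp add: lq_norm_ereal)
qed

text \<open>With \<open>N\<close> the quasi-norm for \<open>q1\<close>, every term is at most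
  \<open>N\<close>, so \<open>a j\<close> to the power \<open>r2\<close> is at most \<open>N\<close>
  to the power \<open>r2 - r1\<close> times \<open>a j\<close> to the power \<open>r1\<close>.
  Summation restores the full power \<open>r2\<close> of \<open>N\<close>.\<close>

lemma lq_norm_antimono_exponent:
  assumes "0 < q1" "q1 \<le> q2"
  shows "lq_norm q2 a \<le> lq_norm q1 a"
proof -
  have "0 < q2" using assms by simp
  then show ?thesis
  proof (cases q2 rule: positive_ereal_cases)
    case 1
    then show ?thesis using lq_norm_component_le[OF assms(1)] by (auto simp: lq_norm_infinity intro: SUP_least)
  next
    case (2 r2)
    then obtain r1 where r1: "q1 = ereal r1" "0 < r1" "r1 \<le> r2" using assms by (cases q1) auto
    show ?thesis
    proof (cases "r1 = r2")
      case False
      then have lt: "r1 < r2" using r1 by simp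
      let ?N = "lq_norm q1 a"
      have "(\<Sum>j. ennreal_powr (a j) r2) \<le> (\<Sum>j. ennreal_powr ?N (r2 - r1) * ennreal_powr (a j) r1)"
      proof (intro suminf_le)
        fix j
        have "ennreal_powr (a j) r2 = ennreal_powr (a j) (r2 - r1) * ennreal_powr (a j) r1"
          using ennreal_powr_add_exponent[of "r2 - r1" r1 "a j"] lt r1 by simp
        also have "\<dots> \<le> ennreal_powr ?N (r2 - r1) * ennreal_powr (a j) r1"
          using lt lq_norm_component_le[OF assms(1)] by (intro mult_right_mono ennreal_powr_mono) auto
        finally show "ennreal_powr (a j) r2 \<le> ennreal_powr ?N (r2 - r1) * ennreal_powr (a j) r1" .
      qed auto
      also have "\<dots> = ennreal_powr ?N (r2 - r1) * ennreal_powr ?N r1"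
        using r1 by (simp add: lq_norm_ereal ennreal_powr_inverse)
      also have "\<dots> = ennreal_powr ?N r2"
        using ennreal_powr_add_exponent[of "r2 - r1" r1 ?N] lt r1 by simp
      finally have "lq_norm q2 a \<le> ennreal_powr (ennreal_powr ?N r2) (1 / r2)"
        using 2 by (simp add: lq_norm_ereal ennreal_powr_mono)
      then show ?thesis using 2 by (simp add: ennreal_powr_inverse)
    qed (simp add: 2 r1)
  qed
qed

text \<open>All arithmetic with \<open>1 / \<infinity> = 0\<close> happens here. What remains is
  inclusion of sequence spaces, an infinite \<open>q1\<close> against a finite \<open>q2\<close>, or
  three real exponents.\<close>

lemma exponent_cases:
  fixes q1 q2 qs :: ereal
  assumes "0 < q1" "0 < q2" "0 < qs" "1 / qs = max (1 / q2 - 1 / q1) 0"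
  obtains (le) "q1 \<le> q2" "qs = \<infinity>"
    | (infinite) r where "0 < r" "q1 = \<infinity>" "q2 = ereal r" "qs = ereal r"
    | (finite) r1 r2 s where "0 < r2" "r2 < r1" "0 < s" "1 / s = 1 / r2 - 1 / r1"
        "q1 = ereal r1" "q2 = ereal r2" "qs = ereal s"
proof -
  have inv: "1 / ereal r = ereal (1 / r)" if "r > 0" for r
    using that by (simp add: one_ereal_def)
  have inv_0: "qs = \<infinity>" if "1 / qs = 0"
    using assms(3)
  proof (cases qs rule: positive_ereal_cases)
    case (2 s)
    then show ?thesis using that by (simp add: inv zero_ereal_def)
  qed
  from assms(1) show thesis
  proof (cases q1 rule: positive_ereal_cases)
    case 1
    from assms(2) show ?thesis
    proof (cases q2 rule: positive_ereal_cases)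
      case 1
      then have "1 / qs = 0" using assms \<open>q1 = \<infinity>\<close> by simp
      then have "qs = \<infinity>" by (rule inv_0)
      then show ?thesis using 1 le by simp
    next
      case (2 r)
      then have e: "1 / qs = ereal (1 / r)" using assms \<open>q1 = \<infinity>\<close> by (simp add: inv max_def)
      from assms(3) have "qs = ereal r"
      proof (cases qs rule: positive_ereal_cases)
        case 1
        then show ?thesis using e \<open>0 < r\<close> by (simp add: zero_ereal_def)
      next
        case (2 s)
        then show ?thesis using e \<open>0 < r\<close> by (simp add: inv)
      qed
      then show ?thesis using 2 \<open>q1 = \<infinity>\<close> infinite by blast
    qed
  next
    case (2 r1)
    note q1 = this
    from assms(2) show ?thesis
    proof (cases q2 rule: positive_ereal_cases)
      case 1
      then have "1 / qs = max (0 - ereal (1 / r1)) 0" using assms q1 by (simp add: inv)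
      then have "1 / qs = 0" using q1 by (simp add: max_def)
      then have "qs = \<infinity>" by (rule inv_0)
      then show ?thesis using 1 le by simp
    next
      case (2 r2)
      have e: "1 / qs = ereal (max (1 / r2 - 1 / r1) 0)"
        using assms(4) q1 2 by (simp add: inv max_def zero_ereal_def)
      show ?thesis
      proof (cases "r2 < r1")
        case True
        then have pos: "1 / r2 - 1 / r1 > 0" using 2 by (simp add: field_simps)
        from assms(3) show ?thesis
        proof (cases qs rule: positive_ereal_cases)
          case 1
          then show ?thesis using e pos by simp
        next
          case (2 s)
          then have "1 / s = 1 / r2 - 1 / r1" using e pos by (simp add: inv)
          then show ?thesis using \<open>q2 = ereal r2\<close> \<open>0 < r2\<close> True q1 2 finite by blast
        qed
      next
        case False
        then have "1 / r2 \<le> 1 / r1" using q1 2 by (simp add: field_simps)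
        then have "1 / qs = 0" using e by (simp add: max_def)
        then have "qs = \<infinity>" by (rule inv_0)
        then show ?thesis using False q1 2 le by simp
      qed
    qed
  qed
qed

text \<open>The weak form \<open>(x y)\<^bsup>r2\<^esup> \<le> x\<^bsup>s\<^esup> + y\<^bsup>r1\<^esup>\<close> of Young's inequality suffices, since constants do not matter.\<close>

lemma ennreal_powr_mult_le_add:
  assumes "0 < r2" "0 < r1" "0 < s" "1 / s = 1 / r2 - 1 / r1"
  shows "ennreal_powr (x * y) r2 \<le> ennreal_powr x s + ennreal_powr y r1"
proof -
  define z where "z = max (ennreal_powr x s) (ennreal_powr y r1)"
  have x: "x \<le> ennreal_powr z (1 / s)"
    using ennreal_powr_mono[of "ennreal_powr x s" z "1 / s"] assms(3)
    unfolding ennreal_powr_inverse(1)[OF assms(3)] by (simp add: z_def)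
  have y: "y \<le> ennreal_powr z (1 / r1)"
    using ennreal_powr_mono[of "ennreal_powr y r1" z "1 / r1"] assms by (simp add: z_def ennreal_powr_inverse)
  have "x * y \<le> ennreal_powr z (1 / s) * ennreal_powr z (1 / r1)" by (intro mult_mono x y) auto
  also have "\<dots> = ennreal_powr z (1 / r2)"
  proof -
    have "1 / s + 1 / r1 = 1 / r2" using assms(4) by simp
    then show ?thesis using ennreal_powr_add_exponent[of "1 / s" "1 / r1" z] assms(1-3) by simp
  qed
  finally have "ennreal_powr (x * y) r2 \<le> ennreal_powr (ennreal_powr z (1 / r2)) r2"
    using assms by (intro ennreal_powr_mono) auto
  also have "\<dots> = z" using assms by (simp add: ennreal_powr_inverse)
  also have "\<dots> \<le> ennreal_powr x s + ennreal_powr y r1" by (auto simp: z_def add_increasing add_increasing2)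
  finally show ?thesis .
qed

text \<open>For three finite exponents both factors are normalised to quasi-norm 1, where
  \<open>ennreal_powr_mult_le_add\<close> bounds the sum of powers by 2. The other cases take one
  factor out at its supremum.\<close>

lemma lq_norm_Hoelder:
  fixes q1 q2 qs :: ereal
  assumes "0 < q1" "0 < q2" "0 < qs" "1 / qs = max (1 / q2 - 1 / q1) 0"
  obtains K where "0 < K" "\<And>a b. lq_norm q2 (\<lambda>j. a j * b j) \<le> ennreal K * (lq_norm qs a * lq_norm q1 b)"
  using assms
proof (cases rule: exponent_cases)
  case le
  have "lq_norm q2 (\<lambda>j. a j * b j) \<le> ennreal 1 * (lq_norm qs a * lq_norm q1 b)" for a b
  proof -
    have "lq_norm q2 (\<lambda>j. a j * b j) \<le> lq_norm q2 (\<lambda>j. lq_norm qs a * b j)"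
      using assms lq_norm_component_le[of qs a] by (intro lq_norm_mono mult_right_mono) auto
    also have "\<dots> = lq_norm qs a * lq_norm q2 b" using assms by (simp add: lq_norm_cmult)
    also have "\<dots> \<le> lq_norm qs a * lq_norm q1 b"
      using assms le by (intro mult_left_mono lq_norm_antimono_exponent) auto
    finally show ?thesis by simp
  qed
  then show ?thesis using that[of 1] by simp
next
  case (infinite r)
  have "lq_norm q2 (\<lambda>j. a j * b j) \<le> ennreal 1 * (lq_norm qs a * lq_norm q1 b)" for a b
  proof -
    have "lq_norm q2 (\<lambda>j. a j * b j) \<le> lq_norm q2 (\<lambda>j. lq_norm q1 b * a j)"
      using assms lq_norm_component_le[of q1 b]
      by (intro lq_norm_mono) (auto simp: mult.commute[of "a _"] intro: mult_right_mono)
    also have "\<dots> = lq_norm q1 b * lq_norm qs a" using assms infinite by (simp add: lq_norm_cmult)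
    finally show ?thesis by (simp add: mult.commute)
  qed
  then show ?thesis using that[of 1] by simp
next
  case (finite r1 r2 s)
  have "lq_norm q2 (\<lambda>j. a j * b j) \<le> ennreal (2 powr (1 / r2)) * (lq_norm qs a * lq_norm q1 b)" for a b
  proof -
    define \<alpha> \<beta> where "\<alpha> = lq_norm qs a" and "\<beta> = lq_norm q1 b"
    \<comment> \<open>Normalisation needs finite nonzero factors. If one is 0, the right-hand side
      is 0 even when the other is infinite, so the left-hand side has to be shown to vanish.\<close>
    consider "\<alpha> = 0 \<or> \<beta> = 0" | "\<alpha> \<noteq> 0" "\<beta> \<noteq> 0" "\<alpha> = \<top> \<or> \<beta> = \<top>" | "\<alpha> \<noteq> 0" "\<beta> \<noteq> 0" "\<alpha> \<noteq> \<top>" "\<beta> \<noteq> \<top>"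
      by blast
    then show ?thesis
    proof cases
      case 1
      then have "a j * b j = 0" for j
        using lq_norm_component_le[OF assms(3), of a j] lq_norm_component_le[OF assms(1), of b j] by (auto simp: \<alpha>_def \<beta>_def)
      then have "(\<lambda>j. a j * b j) = (\<lambda>j. 0)" by (rule ext)
      then show ?thesis using assms by (simp only: lq_norm_zero zero_le)
    next
      case 2
      then have "\<alpha> * \<beta> = \<top>" by (auto simp: ennreal_mult_top ennreal_top_mult)
      moreover have "ennreal (2 powr (1 / r2)) * \<top> = \<top>" by (simp add: ennreal_mult_eq_top_iff)
      ultimately show ?thesis by (simp only: \<alpha>_def \<beta>_def top_greatest)
    next
      case 3
      define x y where "x j = inverse \<alpha> * a j" and "y j = inverse \<beta> * b j" for j
      have inv: "inverse c * c = 1" if "c \<noteq> 0" "c \<noteq> \<top>" for c :: ennreal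
        using that by (simp add: mult.commute divide_ennreal_def[symmetric] ennreal_divide_self less_top)
      have "lq_norm qs x = 1" "lq_norm q1 y = 1"
        using assms 3 inv by (auto simp: x_def[abs_def] y_def[abs_def] lq_norm_cmult \<alpha>_def[symmetric] \<beta>_def[symmetric])
      then have X: "(\<Sum>j. ennreal_powr (x j) s) = 1" and Y: "(\<Sum>j. ennreal_powr (y j) r1) = 1"
        using ennreal_powr_inverse(2)[of s "\<Sum>j. ennreal_powr (x j) s"] ennreal_powr_inverse(2)[of r1 "\<Sum>j. ennreal_powr (y j) r1"] finite
        by (simp_all add: lq_norm_ereal)
      have ab: "a j * b j = (\<alpha> * \<beta>) * (x j * y j)" for j
      proof -
        have "(\<alpha> * \<beta>) * (x j * y j) = (inverse \<alpha> * \<alpha>) * (inverse \<beta> * \<beta>) * (a j * b j)"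
          by (simp add: x_def y_def mult_ac)
        then show ?thesis using 3 inv by simp
      qed
      have "(\<Sum>j. ennreal_powr (x j * y j) r2) \<le> (\<Sum>j. ennreal_powr (x j) s + ennreal_powr (y j) r1)"
        using finite by (intro suminf_le ennreal_powr_mult_le_add) auto
      also have "\<dots> = 2" by (simp add: suminf_add[symmetric] X Y)
      finally have "lq_norm q2 (\<lambda>j. x j * y j) \<le> ennreal_powr (ennreal 2) (1 / r2)"
        using finite by (simp add: lq_norm_ereal ennreal_powr_mono)
      then have "\<alpha> * \<beta> * lq_norm q2 (\<lambda>j. x j * y j) \<le> \<alpha> * \<beta> * ennreal (2 powr (1 / r2))"
        by (intro mult_left_mono) (auto simp: ennreal_powr_ennreal simp del: ennreal_numeral)
      moreover have "lq_norm q2 (\<lambda>j. a j * b j) = \<alpha> * \<beta> * lq_norm q2 (\<lambda>j. x j * y j)"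
        unfolding ab by (rule lq_norm_cmult[OF assms(2)])
      ultimately show ?thesis by (simp add: \<alpha>_def \<beta>_def mult.commute)
    qed
  qed
  then show ?thesis using that[of "2 powr (1 / r2)"] by simp
qed

section \<open>A converse of Hoelder's inequality, tested on sparse index sets\<close>

lemma lq_norm_finite_support:
  assumes "finite J" "0 < r" "\<And>j. j \<in> J \<Longrightarrow> 0 \<le> x j"
  shows "lq_norm (ereal r) (\<lambda>j. if j \<in> J then ennreal (x j) else 0) = ennreal ((\<Sum>j\<in>J. x j powr r) powr (1 / r))"
proof -
  have "(\<Sum>j. ennreal_powr (if j \<in> J then ennreal (x j) else 0) r) = (\<Sum>j\<in>J. ennreal_powr (if j \<in> J then ennreal (x j) else 0) r)"
    by (rule suminf_finite[OF assms(1)]) auto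
  also have "\<dots> = (\<Sum>j\<in>J. ennreal (x j powr r))"
    using assms by (intro sum.cong) (auto simp: ennreal_powr_ennreal)
  also have "\<dots> = ennreal (\<Sum>j\<in>J. x j powr r)" by (rule sum_ennreal) auto
  finally show ?thesis by (simp add: lq_norm_ereal ennreal_powr_ennreal sum_nonneg)
qed

text \<open>A bump in the annulus of scale \<open>j\<close> meets blocks \<open>j\<close> and
  \<open>j + 1\<close>. Without consecutive indices no block receives two bumps, so contributions
  cannot cancel.\<close>

definition gapped :: "nat set \<Rightarrow> bool"
  where "gapped J \<longleftrightarrow> finite J \<and> (\<forall>j\<in>J. Suc j \<notin> J)"

text \<open>The even and the odd numbers below \<open>N\<close> are both gapped, whence the bound
  \<open>M + M\<close> for every partial sum.\<close>

lemma lq_norm_finite_if_gapped_sums_bounded: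
  assumes s: "0 < s" and a: "\<And>j. 0 \<le> a j" and M: "\<And>J. gapped J \<Longrightarrow> (\<Sum>j\<in>J. a j powr s) \<le> M"
  shows "lq_norm (ereal s) (\<lambda>j. ennreal (a j)) < \<infinity>"
proof -
  have M0: "0 \<le> M" using M[of "{}"] by (simp add: gapped_def)
  have "(\<Sum>j<N. ennreal (a j powr s)) \<le> ennreal (M + M)" for N
  proof -
    have sp: "gapped {j. j < N \<and> even j}" "gapped {j. j < N \<and> odd j}" by (auto simp: gapped_def)
    have "{..<N} = {j. j < N \<and> even j} \<union> {j. j < N \<and> odd j}" by auto
    then have "(\<Sum>j<N. a j powr s) = (\<Sum>j | j < N \<and> even j. a j powr s) + (\<Sum>j | j < N \<and> odd j. a j powr s)"
      by (simp only:) (rule sum.union_disjoint, auto)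
    also have "\<dots> \<le> M + M" by (intro add_mono M sp)
    finally show ?thesis by (subst sum_ennreal) (auto intro: ennreal_leI)
  qed
  then have "(\<Sum>j. ennreal_powr (ennreal (a j)) s) \<le> ennreal (M + M)"
    using a by (simp add: ennreal_powr_ennreal suminf_eq_SUP SUP_least)
  then have "lq_norm (ereal s) (\<lambda>j. ennreal (a j)) \<le> ennreal_powr (ennreal (M + M)) (1 / s)"
    using s by (simp add: lq_norm_ereal ennreal_powr_mono)
  also have "\<dots> < \<infinity>" using M0 by (simp add: ennreal_powr_ennreal)
  finally show ?thesis .
qed

text \<open>The tests are the extremal sequences of Hoelder's inequality: single indices when
  \<open>q1 \<le> q2\<close>, the constant 1 when \<open>q1\<close> is infinite, and
  \<open>a j powr (s / r1)\<close> when all exponents are finite.\<close>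

lemma lq_norm_finite_if_multiplier:
  fixes q1 q2 qs :: ereal
  assumes q: "0 < q1" "0 < q2" "0 < qs" "1 / qs = max (1 / q2 - 1 / q1) 0"
    and a: "\<And>j. 0 < a j" and C: "0 < C"
    and bound: "\<And>J b. gapped J \<Longrightarrow> (\<And>j. 0 \<le> b j) \<Longrightarrow>
      lq_norm q2 (\<lambda>j. if j \<in> J then ennreal (a j * b j) else 0) \<le> ennreal C * lq_norm q1 (\<lambda>j. if j \<in> J then ennreal (b j) else 0)"
  shows "lq_norm qs (\<lambda>j. ennreal (a j)) < \<infinity>"
  using q
proof (cases rule: exponent_cases)
  case le
  have "ennreal (a j) \<le> ennreal C" for j
  proof -
    have "ennreal (a j) \<le> lq_norm q2 (\<lambda>i. if i \<in> {j} then ennreal (a i * 1) else 0)"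
      using lq_norm_component_le[OF q(2), of "\<lambda>i. if i \<in> {j} then ennreal (a i * 1) else 0" j] by simp
    also have "\<dots> \<le> ennreal C * lq_norm q1 (\<lambda>i. if i \<in> {j} then ennreal 1 else 0)"
      by (rule bound) (auto simp: gapped_def)
    also have "lq_norm q1 (\<lambda>i. if i \<in> {j} then ennreal 1 else 0) \<le> 1"
      using q(1)
    proof (cases q1 rule: positive_ereal_cases)
      case 1
      then show ?thesis by (auto simp: lq_norm_infinity intro!: SUP_least)
    next
      case (2 r)
      then show ?thesis using lq_norm_finite_support[of "{j}" r "\<lambda>_. 1"] by simp
    qed
    finally show ?thesis by (simp add: mult_left_mono)
  qed
  then have "lq_norm qs (\<lambda>j. ennreal (a j)) \<le> ennreal C" using le by (auto simp: lq_norm_infinity intro: SUP_least)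
  then show ?thesis by (simp add: le_less_trans)
next
  case (infinite r)
  have "(\<Sum>j\<in>J. a j powr r) \<le> C powr r" if J: "gapped J" for J
  proof -
    have fin: "finite J" using J by (simp add: gapped_def)
    have "ennreal ((\<Sum>j\<in>J. a j powr r) powr (1 / r)) = lq_norm q2 (\<lambda>j. if j \<in> J then ennreal (a j * 1) else 0)"
      unfolding mult_1_right using lq_norm_finite_support[OF fin infinite(1), of a] a infinite by (simp add: less_imp_le)
    also have "\<dots> \<le> ennreal C * lq_norm q1 (\<lambda>j. if j \<in> J then ennreal 1 else 0)" by (rule bound[OF J]) simp
    also have "lq_norm q1 (\<lambda>j. if j \<in> J then ennreal 1 else 0) \<le> 1"
      unfolding infinite lq_norm_infinity by (rule SUP_least) auto
    then have "ennreal C * lq_norm q1 (\<lambda>j. if j \<in> J then ennreal 1 else 0) \<le> ennreal C * 1"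
      by (rule mult_left_mono) simp
    finally have "(\<Sum>j\<in>J. a j powr r) powr (1 / r) \<le> C" using C by simp
    then have "((\<Sum>j\<in>J. a j powr r) powr (1 / r)) powr r \<le> C powr r" using infinite by (intro powr_mono2) auto
    then show ?thesis using infinite by (simp add: powr_powr sum_nonneg)
  qed
  then show ?thesis unfolding infinite by (rule lq_norm_finite_if_gapped_sums_bounded[OF infinite(1) less_imp_le[OF a]])
next
  case (finite r1 r2 s)
  have r1: "0 < r1" using finite by simp
  have "(\<Sum>j\<in>J. a j powr s) \<le> C powr s" if J: "gapped J" for J
  proof (cases "(\<Sum>j\<in>J. a j powr s) = 0")
    case False
    define T where "T = (\<Sum>j\<in>J. a j powr s)"
    have T: "T > 0" using False by (simp add: T_def less_le sum_nonneg)
    have fin: "finite J" using J by (simp add: gapped_def)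
    \<comment> \<open>The exponent \<open>s / r1\<close> is chosen so that both sides become powers
      of the same sum \<open>T\<close>.\<close>
    have e: "(1 + s / r1) * r2 = s"
    proof -
      have "1 + s / r1 = s / r2" using finite r1 by (simp add: field_simps)
      then show ?thesis using finite by simp
    qed
    have "ennreal (T powr (1 / r2)) = lq_norm q2 (\<lambda>j. if j \<in> J then ennreal (a j * a j powr (s / r1)) else 0)"
    proof -
      have "(a j * a j powr (s / r1)) powr r2 = a j powr s" for j
      proof -
        have "a j * a j powr (s / r1) = a j powr (1 + s / r1)" using a[of j] by (simp add: powr_add)
        then show ?thesis using e by (simp add: powr_powr)
      qed
      then show ?thesis
        using lq_norm_finite_support[OF fin, of r2 "\<lambda>j. a j * a j powr (s / r1)"] finite a by (simp add: T_def less_imp_le)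
    qed
    also have "\<dots> \<le> ennreal C * lq_norm q1 (\<lambda>j. if j \<in> J then ennreal (a j powr (s / r1)) else 0)"
      by (rule bound[OF J]) simp
    also have "\<dots> = ennreal (C * T powr (1 / r1))"
      using lq_norm_finite_support[OF fin r1, of "\<lambda>j. a j powr (s / r1)"] finite r1 C
      by (simp add: powr_powr T_def ennreal_mult)
    finally have "T powr (1 / r2) \<le> C * T powr (1 / r1)" using C by simp
    \<comment> \<open>\<open>T\<close> is finite and positive, so its power on the right may be
      divided out; the exponent left is \<open>1 / r2 - 1 / r1 = 1 / s\<close>.\<close>
    then have "T powr (1 / s) \<le> C" using T unfolding finite(4) by (simp add: powr_diff pos_divide_le_eq)
    then have "(T powr (1 / s)) powr s \<le> C powr s" using finite by (intro powr_mono2) auto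
    moreover have "(T powr (1 / s)) powr s = T" using T finite(3) by (simp only: powr_powr) simp
    ultimately show ?thesis by (simp add: T_def)
  qed simp
  then show ?thesis unfolding finite by (rule lq_norm_finite_if_gapped_sums_bounded[OF finite(3) less_imp_le[OF a]])
qed

section \<open>Besov quasi-norms and continuous embeddings\<close>

lemma besov_norm_eq: "besov_norm \<phi>0 \<sigma> p q u = lq_norm q (\<lambda>j. ennreal (\<sigma> j) * distr_Lp_norm p (lp_block \<phi>0 j u))"
  by (simp add: besov_norm_def lp_block_def)

lemma lp_block_add: "lp_block \<phi>0 j (\<lambda>f. u f + v f) = (\<lambda>f. lp_block \<phi>0 j u f + lp_block \<phi>0 j v f)"
  by (auto simp: lp_block_def distr_inv_fourier_def distr_mult_def distr_fourier_def)

lemma lp_block_cmult: "lp_block \<phi>0 j (\<lambda>f. c * u f) = (\<lambda>f. c * lp_block \<phi>0 j u f)"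
  by (auto simp: lp_block_def distr_inv_fourier_def distr_mult_def distr_fourier_def)

lemma Lp_norm_add:
  assumes "0 < p"
  obtains K where "0 < K"
    "\<And>h k :: real^'n::finite \<Rightarrow> complex. h \<in> borel_measurable borel \<Longrightarrow> k \<in> borel_measurable borel \<Longrightarrow>
      Lp_norm (ereal p) (\<lambda>x. h x + k x) \<le> ennreal K * (Lp_norm (ereal p) h + Lp_norm (ereal p) k)"
proof -
  let ?K = "(2 powr p) powr (1 / p) * 2 powr (1 / p)"
  let ?P = "\<lambda>h x. ennreal_powr (ennreal (norm (h x :: complex))) p"
  have P: "Lp_norm (ereal p) h = ennreal_powr (\<integral>\<^sup>+x. ?P h x \<partial>lborel) (1 / p)" for h :: "real^'n \<Rightarrow> complex"
    by (simp add: Lp_norm_def)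
  have "Lp_norm (ereal p) (\<lambda>x. h x + k x) \<le> ennreal ?K * (Lp_norm (ereal p) h + Lp_norm (ereal p) k)"
    if [measurable]: "h \<in> borel_measurable borel" "k \<in> borel_measurable borel" for h k :: "real^'n \<Rightarrow> complex"
  proof -
    have [measurable]: "?P h \<in> borel_measurable borel" if [measurable]: "h \<in> borel_measurable borel" for h :: "real^'n \<Rightarrow> complex"
      by (simp add: ennreal_powr_ennreal)
    let ?A = "\<integral>\<^sup>+x. ?P h x \<partial>lborel" and ?B = "\<integral>\<^sup>+x. ?P k x \<partial>lborel"
    have "(\<integral>\<^sup>+x. ?P (\<lambda>x. h x + k x) x \<partial>lborel) \<le> (\<integral>\<^sup>+x. ennreal (2 powr p) * (?P h x + ?P k x) \<partial>lborel)"
    proof (intro nn_integral_mono)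
      fix x
      have "?P (\<lambda>x. h x + k x) x \<le> ennreal_powr (ennreal (norm (h x)) + ennreal (norm (k x))) p"
        using assms by (intro ennreal_powr_mono) (auto simp: norm_triangle_ineq ennreal_plus[symmetric] simp del: ennreal_plus)
      also have "\<dots> \<le> ennreal (2 powr p) * (?P h x + ?P k x)" using assms by (intro ennreal_powr_add_le) auto
      finally show "?P (\<lambda>x. h x + k x) x \<le> ennreal (2 powr p) * (?P h x + ?P k x)" .
    qed
    also have "\<dots> = ennreal (2 powr p) * (?A + ?B)"
      by (simp add: nn_integral_cmult nn_integral_add)
    finally have "Lp_norm (ereal p) (\<lambda>x. h x + k x) \<le> ennreal_powr (ennreal (2 powr p) * (?A + ?B)) (1 / p)"
      unfolding P using assms by (intro ennreal_powr_mono) auto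
    also have "\<dots> = ennreal ((2 powr p) powr (1 / p)) * ennreal_powr (?A + ?B) (1 / p)"
      by (simp only: ennreal_powr_mult) (simp add: ennreal_powr_ennreal)
    also have "\<dots> \<le> ennreal ((2 powr p) powr (1 / p)) * (ennreal (2 powr (1 / p)) * (ennreal_powr ?A (1 / p) + ennreal_powr ?B (1 / p)))"
      using assms by (intro mult_left_mono ennreal_powr_add_le) auto
    finally show ?thesis unfolding P by (simp add: ennreal_mult mult.assoc)
  qed
  then show thesis using that[of ?K] by simp
qed

lemma Lp_norm_cmult:
  assumes "0 < p" and [measurable]: "h \<in> borel_measurable borel"
  shows "Lp_norm (ereal p) (\<lambda>x. c * h x) = ennreal (norm c) * Lp_norm (ereal p) h"
  using assms(1)
  by (simp add: Lp_norm_eq norm_mult powr_mult ennreal_mult nn_integral_cmult ennreal_powr_mult ennreal_powr_ennreal powr_powr)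

lemma Lp_norm_zero [simp]: "Lp_norm (ereal p) (\<lambda>x. 0) = 0"
  by (simp add: Lp_norm_eq)

lemma represents_add:
  "represents h u \<Longrightarrow> represents k v \<Longrightarrow> represents (\<lambda>x. h x + k x) (\<lambda>f. u f + v f)"
  by (auto simp: represents_def distrib_right)

lemma represents_cmult: "represents h u \<Longrightarrow> represents (\<lambda>x. c * h x) (\<lambda>f. c * u f)"
  by (auto simp: represents_def mult.assoc)

lemma represents_zero: "represents (\<lambda>x. 0) (\<lambda>f. 0)"
  by (auto simp: represents_def)

lemma distr_Lp_norm_not_represented: "\<not> (\<exists>h. represents h u) \<Longrightarrow> distr_Lp_norm p u = \<top>"
  by (simp add: distr_Lp_norm_def)

section \<open>Quasi-norm properties of Besov spaces\<close>

context littlewood_paley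
begin

text \<open>A distribution without representing function has infinite quasi-norm, which makes the
  bound trivial; otherwise representatives may be added.\<close>

lemma distr_Lp_norm_add:
  assumes "0 < p"
  obtains K where "0 < K" "\<And>u v :: 'n functional.
    distr_Lp_norm (ereal p) (\<lambda>f. u f + v f) \<le> ennreal K * (distr_Lp_norm (ereal p) u + distr_Lp_norm (ereal p) v)"
proof -
  obtain K where K: "0 < K" "\<And>h k :: real^'n \<Rightarrow> complex. h \<in> borel_measurable borel \<Longrightarrow> k \<in> borel_measurable borel \<Longrightarrow>
      Lp_norm (ereal p) (\<lambda>x. h x + k x) \<le> ennreal K * (Lp_norm (ereal p) h + Lp_norm (ereal p) k)"
    using Lp_norm_add[OF assms] by blast
  have "distr_Lp_norm (ereal p) (\<lambda>f. u f + v f) \<le> ennreal K * (distr_Lp_norm (ereal p) u + distr_Lp_norm (ereal p) v)"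
    for u v :: "'n functional"
  proof (cases "(\<exists>h. represents h u) \<and> (\<exists>k. represents k v)")
    case True
    then obtain h k where hk: "represents h u" "represents k v" by blast
    then show ?thesis
      using K(2)[of h k] by (simp add: distr_Lp_norm_eq[OF hk(1)] distr_Lp_norm_eq[OF hk(2)] distr_Lp_norm_eq[OF represents_add[OF hk]])
        (simp add: represents_def)
  next
    case False
    then have "distr_Lp_norm (ereal p) u + distr_Lp_norm (ereal p) v = \<top>"
      using distr_Lp_norm_not_represented[of u] distr_Lp_norm_not_represented[of v] by auto
    moreover have "ennreal K * \<top> = \<top>" using K(1) by (simp add: ennreal_mult_eq_top_iff)
    ultimately show ?thesis by (simp only: top_greatest)
  qed
  then show thesis using that K(1) by blast
qed

lemma distr_Lp_norm_cmult:
  assumes "0 < p" "c \<noteq> 0"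
  shows "distr_Lp_norm (ereal p) (\<lambda>f. c * u f) \<le> ennreal (norm c) * distr_Lp_norm (ereal p) (u :: 'n functional)"
proof (cases "\<exists>h. represents h u")
  case True
  then obtain h where h: "represents h u" by blast
  then have "h \<in> borel_measurable borel" by (simp add: represents_def)
  then show ?thesis
    by (simp add: distr_Lp_norm_eq[OF h] distr_Lp_norm_eq[OF represents_cmult[OF h]] Lp_norm_cmult[OF assms(1)])
next
  case False
  have "ennreal (norm c) * \<top> = \<top>" using assms by (simp add: ennreal_mult_eq_top_iff)
  then show ?thesis by (simp only: distr_Lp_norm_not_represented[OF False] top_greatest)
qed

lemma besov_norm_cmult:
  assumes "0 < p" "0 < q" "c \<noteq> 0"
  shows "besov_norm \<phi>0 \<sigma> (ereal p) q (\<lambda>f. c * u f) \<le> ennreal (norm c) * besov_norm \<phi>0 \<sigma> (ereal p) q u"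
proof -
  have "besov_norm \<phi>0 \<sigma> (ereal p) q (\<lambda>f. c * u f) \<le> lq_norm q (\<lambda>j. ennreal (norm c) * (ennreal (\<sigma> j) * distr_Lp_norm (ereal p) (lp_block \<phi>0 j u)))"
    unfolding besov_norm_eq lp_block_cmult mult.left_commute[of "ennreal (norm c)"]
    by (intro lq_norm_mono mult_left_mono distr_Lp_norm_cmult assms) auto
  then show ?thesis using assms by (simp add: lq_norm_cmult besov_norm_eq)
qed

lemma besov_norm_add:
  assumes "0 < p" "0 < q"
  obtains K where "0 < K"
    "\<And>u v. besov_norm \<phi>0 \<sigma> (ereal p) q (\<lambda>f. u f + v f) \<le> ennreal K * (besov_norm \<phi>0 \<sigma> (ereal p) q u + besov_norm \<phi>0 \<sigma> (ereal p) q v)"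
proof -
  obtain K where K: "0 < K" "\<And>u v :: 'n functional.
    distr_Lp_norm (ereal p) (\<lambda>f. u f + v f) \<le> ennreal K * (distr_Lp_norm (ereal p) u + distr_Lp_norm (ereal p) v)"
    using distr_Lp_norm_add[OF assms(1)] by blast
  obtain L where L: "0 < L" "\<And>a b. lq_norm q (\<lambda>j. a j + b j) \<le> ennreal L * (lq_norm q a + lq_norm q b)"
    using lq_norm_add[OF assms(2)] by blast
  have "besov_norm \<phi>0 \<sigma> (ereal p) q (\<lambda>f. u f + v f) \<le> ennreal (K * L) * (besov_norm \<phi>0 \<sigma> (ereal p) q u + besov_norm \<phi>0 \<sigma> (ereal p) q v)" for u v
  proof -
    let ?a = "\<lambda>u j. ennreal (\<sigma> j) * distr_Lp_norm (ereal p) (lp_block \<phi>0 j u)"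
    have "?a (\<lambda>f. u f + v f) j \<le> ennreal K * (?a u j + ?a v j)" for j
      using mult_left_mono[OF K(2)[of "lp_block \<phi>0 j u" "lp_block \<phi>0 j v"], of "ennreal (\<sigma> j)"]
      by (simp add: lp_block_add mult.left_commute[of _ "ennreal K"] distrib_left)
    then have "besov_norm \<phi>0 \<sigma> (ereal p) q (\<lambda>f. u f + v f) \<le> lq_norm q (\<lambda>j. ennreal K * (?a u j + ?a v j))"
      unfolding besov_norm_eq by (intro lq_norm_mono assms)
    also have "\<dots> = ennreal K * lq_norm q (\<lambda>j. ?a u j + ?a v j)" using assms by (simp add: lq_norm_cmult)
    also have "\<dots> \<le> ennreal K * (ennreal L * (lq_norm q (?a u) + lq_norm q (?a v)))" by (intro mult_left_mono L) auto
    finally show ?thesis using K L by (simp add: besov_norm_eq ennreal_mult mult.assoc)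
  qed
  then show thesis using that[of "K * L"] K L by simp
qed

lemma besov_norm_diff:
  assumes "0 < p" "0 < q"
  obtains K where "0 < K"
    "\<And>u v. besov_norm \<phi>0 \<sigma> (ereal p) q (\<lambda>f. u f + v f) \<le> ennreal K * (besov_norm \<phi>0 \<sigma> (ereal p) q u + besov_norm \<phi>0 \<sigma> (ereal p) q v)"
    "\<And>u v. besov_norm \<phi>0 \<sigma> (ereal p) q (\<lambda>f. u f - v f) \<le> ennreal K * (besov_norm \<phi>0 \<sigma> (ereal p) q u + besov_norm \<phi>0 \<sigma> (ereal p) q v)"
proof -
  obtain K where K: "0 < K"
    "\<And>u v. besov_norm \<phi>0 \<sigma> (ereal p) q (\<lambda>f. u f + v f) \<le> ennreal K * (besov_norm \<phi>0 \<sigma> (ereal p) q u + besov_norm \<phi>0 \<sigma> (ereal p) q v)"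
    using besov_norm_add[OF assms] by blast
  have "besov_norm \<phi>0 \<sigma> (ereal p) q (\<lambda>f. u f - v f) \<le> ennreal K * (besov_norm \<phi>0 \<sigma> (ereal p) q u + besov_norm \<phi>0 \<sigma> (ereal p) q v)" for u v
  proof -
    have "besov_norm \<phi>0 \<sigma> (ereal p) q (\<lambda>f. u f + (-1) * v f) \<le> ennreal K * (besov_norm \<phi>0 \<sigma> (ereal p) q u + besov_norm \<phi>0 \<sigma> (ereal p) q (\<lambda>f. (-1) * v f))"
      by (rule K(2))
    also have "\<dots> \<le> ennreal K * (besov_norm \<phi>0 \<sigma> (ereal p) q u + besov_norm \<phi>0 \<sigma> (ereal p) q v)"
      using besov_norm_cmult[OF assms, of "-1" \<sigma> v] by (intro mult_left_mono add_left_mono) auto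
    finally show ?thesis by simp
  qed
  then show thesis using that K by blast
qed

lemma besov_norm_zero:
  assumes "0 < q"
  shows "besov_norm \<phi>0 \<sigma> (ereal p) q (\<lambda>f. 0) = 0"
proof -
  have "lp_block \<phi>0 j (\<lambda>f. 0) = (\<lambda>f. 0)" for j
    using lp_block_cmult[of \<phi>0 j 0 "\<lambda>f. 0"] by simp
  then show ?thesis
    using assms by (simp add: besov_norm_eq distr_Lp_norm_eq[OF represents_zero] lq_norm_zero)
qed

text \<open>Nikolskii's inequality changes \<open>p1\<close> into \<open>p2\<close> in each block at
  the cost of a power of 2. Together with the quotient of the weights this is the multiplier
  sequence, to which \<open>lq_norm_Hoelder\<close> applies.\<close>

lemma besov_norm_le_if_multiplier_finite:
  fixes \<sigma> \<tau> :: "nat \<Rightarrow> real"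
  assumes p: "0 < p1" "p1 \<le> p2" and q: "0 < q1" "0 < q2" "0 < qs" "1 / qs = max (1 / q2 - 1 / q1) 0"
    and pos: "\<And>j. 0 < \<sigma> j" "\<And>j. 0 < \<tau> j"
    and fin: "lq_norm qs (\<lambda>j. ennreal (inverse (\<sigma> j) * \<tau> j * 2 powr (real j * real CARD('n) * (1 / p1 - 1 / p2)))) < \<infinity>"
  obtains C where "0 < C" "\<And>u. u (\<lambda>x. 0) = 0 \<Longrightarrow>
    besov_norm \<phi>0 \<tau> (ereal p2) q2 u \<le> ennreal C * besov_norm \<phi>0 \<sigma> (ereal p1) q1 u"
proof -
  let ?e = "\<lambda>j. 2 powr (real j * real CARD('n) * (1 / p1 - 1 / p2))"
  let ?a = "\<lambda>j. inverse (\<sigma> j) * \<tau> j * ?e j"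
  obtain N where N: "0 < N" "\<And>j u h. u (\<lambda>x. 0) = 0 \<Longrightarrow> represents h (lp_block \<phi>0 j u) \<Longrightarrow>
    Lp_norm (ereal p2) h \<le> ennreal (N * ?e j) * Lp_norm (ereal p1) h"
    using nikolskii_inequality[OF p] by blast
  obtain K where K: "0 < K" "\<And>a b. lq_norm q2 (\<lambda>j. a j * b j) \<le> ennreal K * (lq_norm qs a * lq_norm q1 b)"
    using lq_norm_Hoelder[OF q] by blast
  obtain A where A: "lq_norm qs (\<lambda>j. ennreal (?a j)) = ennreal A" "0 \<le> A"
    using fin by (cases "lq_norm qs (\<lambda>j. ennreal (?a j))") auto
  \<comment> \<open>\<open>A + 1\<close> keeps the constant positive, since the continuity argument
    divides by it.\<close>
  define C where "C = N * K * (A + 1)"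
  have C: "0 < C" using N K A by (simp add: C_def)
  have "besov_norm \<phi>0 \<tau> (ereal p2) q2 u \<le> ennreal C * besov_norm \<phi>0 \<sigma> (ereal p1) q1 u" if u: "u (\<lambda>x. 0) = 0" for u
  proof -
    let ?x = "\<lambda>j. ennreal (\<sigma> j) * distr_Lp_norm (ereal p1) (lp_block \<phi>0 j u)"
    have le: "distr_Lp_norm (ereal p2) (lp_block \<phi>0 j u) \<le> ennreal (N * ?e j) * distr_Lp_norm (ereal p1) (lp_block \<phi>0 j u)" for j
    proof (cases "\<exists>h. represents h (lp_block \<phi>0 j u)")
      case True
      then obtain h where h: "represents h (lp_block \<phi>0 j u)" by blast
      then show ?thesis using N(2)[OF u h] by (simp only: distr_Lp_norm_eq)
    next
      case False
      have "ennreal (N * ?e j) * \<top> = \<top>" using N by (simp add: ennreal_mult_eq_top_iff ennreal_eq_0_iff not_le)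
      then show ?thesis by (simp only: distr_Lp_norm_not_represented[OF False] top_greatest)
    qed
    have "ennreal (\<tau> j) * distr_Lp_norm (ereal p2) (lp_block \<phi>0 j u) \<le> ennreal N * (ennreal (?a j) * ?x j)" for j
    proof -
      have "ennreal (\<tau> j) * distr_Lp_norm (ereal p2) (lp_block \<phi>0 j u)
          \<le> ennreal (\<tau> j) * (ennreal (N * ?e j) * distr_Lp_norm (ereal p1) (lp_block \<phi>0 j u))"
        by (intro mult_left_mono le) auto
      also have "\<dots> = ennreal (\<tau> j * (N * ?e j)) * distr_Lp_norm (ereal p1) (lp_block \<phi>0 j u)"
        using pos[of j] N by (simp add: ennreal_mult' mult.assoc)
      also have "\<tau> j * (N * ?e j) = N * (?a j * \<sigma> j)" using pos(1)[of j] by simp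
      also have "ennreal (N * (?a j * \<sigma> j)) = ennreal N * (ennreal (?a j) * ennreal (\<sigma> j))"
        using pos(1)[of j] pos(2)[of j] N by (simp add: ennreal_mult'[symmetric])
      finally show ?thesis by (simp only: mult.assoc)
    qed
    then have "besov_norm \<phi>0 \<tau> (ereal p2) q2 u \<le> lq_norm q2 (\<lambda>j. ennreal N * (ennreal (?a j) * ?x j))"
      unfolding besov_norm_eq using q by (intro lq_norm_mono)
    also have "\<dots> = ennreal N * lq_norm q2 (\<lambda>j. ennreal (?a j) * ?x j)" by (rule lq_norm_cmult[OF q(2)])
    also have "\<dots> \<le> ennreal N * (ennreal K * (ennreal A * lq_norm q1 ?x))"
      using K(2)[of "\<lambda>j. ennreal (?a j)" ?x] by (intro mult_left_mono) (auto simp: A)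
    also have "\<dots> \<le> ennreal N * (ennreal K * (ennreal (A + 1) * lq_norm q1 ?x))"
      using A(2) by (intro mult_left_mono mult_right_mono ennreal_leI) auto
    also have "\<dots> = ennreal C * besov_norm \<phi>0 \<sigma> (ereal p1) q1 u"
      using N K A(2) by (simp add: C_def besov_norm_eq ennreal_mult mult.assoc del: ennreal_plus)
    finally show ?thesis .
  qed
  then show thesis using that C by blast
qed

section \<open>From a bound between quasi-norms to continuity, and back\<close>

lemma tempered_zero: "u \<in> tempered \<Longrightarrow> u (\<lambda>x. 0) = 0"
proof -
  assume "u \<in> tempered"
  then have "\<forall>c. \<forall>f\<in>schwartz. u (\<lambda>x. c * f x) = c * u f" by (simp add: tempered_def)
  from this[rule_format, OF schwartz_zero, of 0] show ?thesis by simp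
qed

lemma besov_embedding_continuous_if_bounded:
  assumes C: "0 < C" "\<And>u. u (\<lambda>x. 0) = 0 \<Longrightarrow>
    besov_norm \<phi>0 \<tau> p2 q2 u \<le> ennreal C * besov_norm \<phi>0 \<sigma> p1 q1 u"
  shows "besov_embedding_continuous \<phi>0 \<sigma> p1 q1 \<tau> p2 q2"
proof -
  have sub: "besov \<phi>0 \<sigma> p1 q1 \<subseteq> besov \<phi>0 \<tau> p2 q2"
  proof
    fix u assume u: "u \<in> besov \<phi>0 \<sigma> p1 q1"
    then have "besov_norm \<phi>0 \<tau> p2 q2 u \<le> ennreal C * besov_norm \<phi>0 \<sigma> p1 q1 u"
      by (intro C(2) tempered_zero[of u]) (simp add: besov_def)
    also have "\<dots> < \<infinity>" using u by (simp add: besov_def ennreal_mult_less_top)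
    finally show "u \<in> besov \<phi>0 \<tau> p2 q2" using u by (simp add: besov_def)
  qed
  moreover have "continuous_map (besov_topology \<phi>0 \<sigma> p1 q1) (besov_topology \<phi>0 \<tau> p2 q2) id"
    unfolding continuous_map_def
  proof (intro conjI allI impI)
    fix U assume U: "openin (besov_topology \<phi>0 \<tau> p2 q2) U"
    show "openin (besov_topology \<phi>0 \<sigma> p1 q1) {u \<in> topspace (besov_topology \<phi>0 \<sigma> p1 q1). id u \<in> U}"
      unfolding openin_besov_topology topspace_besov_topology
    proof (intro conjI ballI)
      fix u assume u: "u \<in> {u \<in> besov \<phi>0 \<sigma> p1 q1. id u \<in> U}"
      then obtain e where e: "e > 0" "{v \<in> besov \<phi>0 \<tau> p2 q2. besov_norm \<phi>0 \<tau> p2 q2 (\<lambda>f. v f - u f) < ennreal e} \<subseteq> U"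
        using U unfolding openin_besov_topology by auto
      have "v \<in> U" if v: "v \<in> besov \<phi>0 \<sigma> p1 q1" "besov_norm \<phi>0 \<sigma> p1 q1 (\<lambda>f. v f - u f) < ennreal (e / C)" for v
      proof -
        \<comment> \<open>Vanishing at the zero function passes to differences at once, and it is
          all that the bound asks of them.\<close>
        have "u (\<lambda>x. 0) = 0" "v (\<lambda>x. 0) = 0" using u v by (auto simp: besov_def intro: tempered_zero)
        then have "besov_norm \<phi>0 \<tau> p2 q2 (\<lambda>f. v f - u f) \<le> ennreal C * besov_norm \<phi>0 \<sigma> p1 q1 (\<lambda>f. v f - u f)"
          by (intro C) simp
        also have "\<dots> < ennreal C * ennreal (e / C)"
          using v(2) C(1) by (intro ennreal_mult_strict_left_mono) auto
        also have "\<dots> = ennreal e" using C(1) e(1) by (simp add: ennreal_mult[symmetric])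
        finally show ?thesis using v sub e by blast
      qed
      then show "\<exists>e>0. {v \<in> besov \<phi>0 \<sigma> p1 q1. besov_norm \<phi>0 \<sigma> p1 q1 (\<lambda>f. v f - u f) < ennreal e} \<subseteq> {u \<in> besov \<phi>0 \<sigma> p1 q1. id u \<in> U}"
        using C e by (intro exI[of _ "e / C"]) auto
    qed auto
  qed (use sub in auto)
  ultimately show ?thesis by (simp add: besov_embedding_continuous_def)
qed

text \<open>A quasi-norm ball need not be open. The points that have some small ball inside it form
  an open set, since the quasi-triangle inequality lets two steps of size \<open>d / (2 * K)\<close>
  stay within radius \<open>d\<close>.\<close>

lemma besov_ball_neighbourhood:
  assumes "0 < p" "0 < q" "0 < e" and u: "u \<in> besov \<phi>0 \<sigma> (ereal p) q"
  obtains U where "openin (besov_topology \<phi>0 \<sigma> (ereal p) q) U" "u \<in> U"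
    "\<And>v. v \<in> U \<Longrightarrow> besov_norm \<phi>0 \<sigma> (ereal p) q (\<lambda>f. v f - u f) < ennreal e"
proof -
  let ?N = "besov_norm \<phi>0 \<sigma> (ereal p) q" and ?X = "besov \<phi>0 \<sigma> (ereal p) q"
  let ?B = "\<lambda>u e. {v \<in> ?X. ?N (\<lambda>f. v f - u f) < ennreal e}"
  obtain K where K: "0 < K" "\<And>u v. ?N (\<lambda>f. u f + v f) \<le> ennreal K * (?N u + ?N v)"
    using besov_norm_add[OF assms(1,2)] by blast
  define U where "U = {v \<in> ?X. \<exists>d>0. ?B v d \<subseteq> ?B u e}"
  have self: "v \<in> ?B v d" if "v \<in> ?X" "0 < d" for v d
    using that assms(2) by (simp add: besov_norm_zero)
  have "openin (besov_topology \<phi>0 \<sigma> (ereal p) q) U"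
    unfolding openin_besov_topology
  proof (intro conjI ballI)
    show "U \<subseteq> ?X" by (auto simp: U_def)
    fix v assume "v \<in> U"
    then obtain d where d: "d > 0" "?B v d \<subseteq> ?B u e" "v \<in> ?X" by (auto simp: U_def)
    define d' where "d' = d / (2 * K)"
    have d': "d' > 0" using d K by (simp add: d'_def)
    have "w \<in> U" if w: "w \<in> ?B v d'" for w
    proof -
      have "?B w d' \<subseteq> ?B v d"
      proof
        fix z assume z: "z \<in> ?B w d'"
        have "?N (\<lambda>f. z f - v f) = ?N (\<lambda>f. (z f - w f) + (w f - v f))" by simp
        also have "\<dots> \<le> ennreal K * (?N (\<lambda>f. z f - w f) + ?N (\<lambda>f. w f - v f))" by (rule K(2))
        also have "\<dots> < ennreal K * (ennreal d' + ennreal d')"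
          using z w K by (intro ennreal_mult_strict_left_mono add_strict_mono) auto
        also have "\<dots> = ennreal d" using K d by (simp add: d'_def ennreal_plus[symmetric] ennreal_mult[symmetric] del: ennreal_plus)
        finally show "z \<in> ?B v d" using z by simp
      qed
      then show ?thesis using d d' w by (auto simp: U_def)
    qed
    then show "\<exists>e>0. ?B v e \<subseteq> U" using d' by blast
  qed
  moreover have "u \<in> U" using u assms(3) by (auto simp: U_def)
  moreover have "?N (\<lambda>f. v f - u f) < ennreal e" if "v \<in> U" for v
    using that self[of v] by (auto simp: U_def)
  ultimately show thesis using that by blast
qed

text \<open>Continuity at 0 maps a small ball of the source into the unit ball of the target, and
  homogeneity turns this into a bound. Schwartz functions supply all the later tests.\<close>

lemma besov_embedding_bound_schwartz:
  assumes p: "0 < p1" "0 < p2" and q: "0 < q1" "0 < q2"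
    and cont: "besov_embedding_continuous \<phi>0 \<sigma> (ereal p1) q1 \<tau> (ereal p2) q2"
  obtains C where "0 < C" "\<And>v. v \<in> schwartz \<Longrightarrow>
    besov_norm \<phi>0 \<tau> (ereal p2) q2 (schwartz_distr v) \<le> ennreal C * besov_norm \<phi>0 \<sigma> (ereal p1) q1 (schwartz_distr v)"
proof -
  let ?S = "besov_norm \<phi>0 \<sigma> (ereal p1) q1" and ?T = "besov_norm \<phi>0 \<tau> (ereal p2) q2"
  have zero_eq: "schwartz_distr (\<lambda>x. 0) = (\<lambda>f. 0)" by (auto simp: schwartz_distr_def)
  have zero: "(\<lambda>f. 0) \<in> besov \<phi>0 \<rho> (ereal p) q" if "0 < q" for \<rho> p q
    using schwartz_distr_tempered[OF schwartz_zero] that by (simp add: besov_def besov_norm_zero zero_eq)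
  obtain U where U: "openin (besov_topology \<phi>0 \<tau> (ereal p2) q2) U" "(\<lambda>f. 0) \<in> U"
    "\<And>v. v \<in> U \<Longrightarrow> ?T (\<lambda>f. v f - 0) < ennreal 1"
    by (rule besov_ball_neighbourhood[OF p(2) q(2) zero_less_one zero[OF q(2)], of \<tau>]) blast
  have "openin (besov_topology \<phi>0 \<sigma> (ereal p1) q1) {u \<in> besov \<phi>0 \<sigma> (ereal p1) q1. u \<in> U}"
  proof -
    have "continuous_map (besov_topology \<phi>0 \<sigma> (ereal p1) q1) (besov_topology \<phi>0 \<tau> (ereal p2) q2) id"
      using cont by (simp add: besov_embedding_continuous_def)
    from openin_continuous_map_preimage[OF this U(1)] show ?thesis by simp
  qed
  then have "\<exists>e>0. {v \<in> besov \<phi>0 \<sigma> (ereal p1) q1. ?S (\<lambda>f. v f - 0) < ennreal e} \<subseteq> {u \<in> besov \<phi>0 \<sigma> (ereal p1) q1. u \<in> U}"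
    unfolding openin_besov_topology by (rule conjunct2[THEN bspec]) (use U(2) zero[OF q(1)] in simp)
  then obtain e where e: "e > 0" "{v \<in> besov \<phi>0 \<sigma> (ereal p1) q1. ?S (\<lambda>f. v f - 0) < ennreal e} \<subseteq> U"
    by blast
  have unit: "?T u < 1" if "u \<in> besov \<phi>0 \<sigma> (ereal p1) q1" "?S u < ennreal e" for u
    using that e U(3)[of u] by auto
  \<comment> \<open>A strict upper bound \<open>r\<close> is used for scaling because the quasi-norm
    itself could be 0.\<close>
  have main: "?T (schwartz_distr v) \<le> ennreal (r / e)" if v: "v \<in> schwartz" and r: "0 < r" "?S (schwartz_distr v) < ennreal r" for v r
  proof -
    let ?c = "complex_of_real (e / r)"
    have c: "?c \<noteq> 0" using r e by simp
    have dv: "schwartz_distr (\<lambda>x. c * v x) = (\<lambda>f. c * schwartz_distr v f)" for c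
      by (auto simp: schwartz_distr_def mult.assoc)
    have "?S (\<lambda>f. ?c * schwartz_distr v f) \<le> ennreal (norm ?c) * ?S (schwartz_distr v)"
      by (rule besov_norm_cmult[OF p(1) q(1) c])
    also have "\<dots> < ennreal (norm ?c) * ennreal r"
      using r e by (intro ennreal_mult_strict_left_mono) auto
    also have "\<dots> = ennreal e" using r e by (simp add: ennreal_mult[symmetric] norm_divide)
    finally have lt: "?S (\<lambda>f. ?c * schwartz_distr v f) < ennreal e" .
    moreover have "(\<lambda>f. ?c * schwartz_distr v f) \<in> besov \<phi>0 \<sigma> (ereal p1) q1"
    proof -
      have "(\<lambda>f. ?c * schwartz_distr v f) \<in> tempered"
        using schwartz_distr_tempered[OF schwartz_cmult[OF v]] unfolding dv .
      moreover have "?S (\<lambda>f. ?c * schwartz_distr v f) < \<infinity>"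
        using lt by (rule order.strict_trans) simp
      ultimately show ?thesis unfolding besov_def by blast
    qed
    ultimately have le: "?T (\<lambda>f. ?c * schwartz_distr v f) \<le> 1" using unit by (simp add: less_imp_le)
    have "?T (schwartz_distr v) = ?T (\<lambda>f. inverse ?c * (?c * schwartz_distr v f))" using c by simp
    also have "\<dots> \<le> ennreal (norm (inverse ?c)) * ?T (\<lambda>f. ?c * schwartz_distr v f)"
      using c by (intro besov_norm_cmult p q) simp
    also have "\<dots> \<le> ennreal (norm (inverse ?c)) * 1" by (intro mult_left_mono le) simp
    finally show ?thesis using r e by (simp add: norm_inverse norm_divide)
  qed
  have "?T (schwartz_distr v) \<le> ennreal (1 / e) * ?S (schwartz_distr v)" if v: "v \<in> schwartz" for v
  proof (cases "?S (schwartz_distr v)")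
    case top
    then show ?thesis using e by (simp add: ennreal_mult_top)
  next
    case (real s)
    \<comment> \<open>The choice \<open>r = s + d * e\<close> exceeds \<open>s\<close> also when
      \<open>s = 0\<close>; then \<open>d\<close> tends to 0.\<close>
    have "?T (schwartz_distr v) \<le> ennreal (s / e) + ennreal d" if "0 < d" for d
    proof -
      have "?T (schwartz_distr v) \<le> ennreal ((s + d * e) / e)"
        using that e real by (intro main v) (auto intro!: ennreal_lessI add_nonneg_pos)
      also have "(s + d * e) / e = s / e + d" using e by (simp add: field_simps)
      finally show ?thesis using that real e by simp
    qed
    then have "?T (schwartz_distr v) \<le> ennreal (s / e)"
      by (rule ennreal_le_epsilon)
    then show ?thesis using real e by (simp add: ennreal_mult[symmetric])
  qed
  then show thesis using that[of "1 / e"] e by simp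
qed

end

section \<open>Necessity of the conditions\<close>

text \<open>Small \<open>p\<close> needs more decay: \<open>k\<close> is taken with
  \<open>k * p\<close> at least \<open>2 * CARD('n)\<close>, the exponent of the integrable
  weight.\<close>

lemma schwartz_Lp_integrable:
  fixes v :: "real^'n::finite \<Rightarrow> complex"
  assumes v: "v \<in> schwartz" and p: "0 < p"
  shows "integrable lborel (\<lambda>x. norm (v x) powr p)"
proof -
  note [measurable] = schwartz_measurable[OF v]
  obtain k :: nat where k: "real (2 * CARD('n)) / p < real k" using reals_Archimedean2 by blast
  obtain C where C: "C > 0" "\<And>x. (1 + norm x) ^ k * norm (v x) \<le> C" using schwartz_decay[OF v] by metis
  have kp: "real (2 * CARD('n)) \<le> real k * p" using k p by (simp add: field_simps)
  have le: "norm (v x) powr p \<le> C powr p * inverse ((1 + norm x) ^ (2 * CARD('n)))" for x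
  proof -
    have pos: "0 < 1 + norm x" by (simp add: add_pos_nonneg)
    have "(1 + norm x) ^ (2 * CARD('n)) * norm (v x) powr p \<le> ((1 + norm x) powr (real k)) powr p * norm (v x) powr p"
      using kp pos by (intro mult_right_mono) (auto simp: powr_powr powr_realpow[symmetric] intro!: powr_mono)
    also have "\<dots> = ((1 + norm x) ^ k * norm (v x)) powr p"
      using pos by (simp add: powr_mult powr_realpow)
    also have "\<dots> \<le> C powr p" using C(2)[of x] p pos by (intro powr_mono2) auto
    finally show ?thesis using pos by (simp add: field_simps)
  qed
  show ?thesis
    by (rule Bochner_Integration.integrable_bound[OF integrable_mult_right[OF integrable_weight, of "C powr p"]])
      (measurable, use le in simp)
qed

lemma Lp_norm_schwartz:
  assumes "v \<in> schwartz" "0 < p"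
  obtains N where "0 \<le> N" "Lp_norm (ereal p) v = ennreal N"
  using that Lp_norm_integrable[OF schwartz_Lp_integrable[OF assms]] by (meson powr_ge_zero)

lemma Lp_norm_ge_on_ball:
  fixes h :: "real^'n::finite \<Rightarrow> complex"
  assumes p: "0 < p" and [measurable]: "h \<in> borel_measurable borel" and a: "0 < a" and r: "0 < r"
    and le: "\<And>x. x \<in> ball z r \<Longrightarrow> a \<le> norm (h x)"
  shows "ennreal (a * (unit_ball_vol (real CARD('n)) * r ^ CARD('n)) powr (1 / p)) \<le> Lp_norm (ereal p) h"
proof -
  let ?V = "unit_ball_vol (real CARD('n)) * r ^ CARD('n)"
  have V: "emeasure lborel (ball z r) = ennreal ?V" using r emeasure_ball[of r z] by simp
  have "ennreal (a powr p * ?V) = ennreal (a powr p) * emeasure lborel (ball z r)"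
    using V r by (simp add: ennreal_mult)
  also have "\<dots> = (\<integral>\<^sup>+x. ennreal (a powr p) * indicator (ball z r) x \<partial>lborel)" by (simp add: nn_integral_cmult_indicator)
  also have "\<dots> \<le> (\<integral>\<^sup>+x. ennreal (norm (h x) powr p) \<partial>lborel)"
  proof (intro nn_integral_mono)
    fix x
    show "ennreal (a powr p) * indicator (ball z r) x \<le> ennreal (norm (h x) powr p)"
      using le[of x] a p by (cases "x \<in> ball z r") (auto intro!: ennreal_leI powr_mono2)
  qed
  finally have "ennreal_powr (ennreal (a powr p * ?V)) (1 / p) \<le> Lp_norm (ereal p) h"
    unfolding Lp_norm_eq using p by (intro ennreal_powr_mono) auto
  then show ?thesis using a p r by (simp add: ennreal_powr_ennreal powr_mult powr_powr)
qed

lemma Lp_norm_schwartz_pos: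
  fixes v :: "real^'n::finite \<Rightarrow> complex"
  assumes v: "v \<in> schwartz" and p: "0 < p" and z: "v z \<noteq> 0"
  shows "0 < Lp_norm (ereal p) v"
proof -
  have "continuous_on UNIV v" by (rule schwartz_continuous[OF v])
  then have "open {x. norm (v x) > norm (v z) / 2}"
    by (intro open_Collect_less continuous_intros)
  then obtain r where r: "r > 0" "ball z r \<subseteq> {x. norm (v x) > norm (v z) / 2}"
    using z open_contains_ball by (metis (no_types, lifting) half_gt_zero_iff mem_Collect_eq norm_eq_zero norm_ge_zero less_le field_sum_of_halves less_add_same_cancel1)
  have "0 < unit_ball_vol (real CARD('n))" by (intro unit_ball_vol_pos) simp
  then have "0 < ennreal (norm (v z) / 2 * (unit_ball_vol (real CARD('n)) * r ^ CARD('n)) powr (1 / p))"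
    using z r by (simp add: less_imp_neq[symmetric])
  also have "\<dots> \<le> Lp_norm (ereal p) v"
    using z r schwartz_measurable[OF v] by (intro Lp_norm_ge_on_ball[OF p]) (auto dest!: subsetD)
  finally show ?thesis .
qed

lemma Lp_norm_scale:
  fixes h :: "real^'n::finite \<Rightarrow> complex"
  assumes s: "0 < s" and [measurable]: "h \<in> borel_measurable borel"
  shows "Lp_norm (ereal p) (\<lambda>x. h (s *\<^sub>R x)) = ennreal (s powr (- real CARD('n) / p)) * Lp_norm (ereal p) h"
proof -
  have "(\<integral>\<^sup>+x. ennreal (norm (h x) powr p) \<partial>lborel) = ennreal (s ^ CARD('n)) * (\<integral>\<^sup>+x. ennreal (norm (h (s *\<^sub>R x)) powr p) \<partial>lborel)"
    using lborel_nn_integral_affine[of s "\<lambda>x. ennreal (norm (h x) powr p)" 0] s by simp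
  then have "ennreal (inverse (s ^ CARD('n))) * (\<integral>\<^sup>+x. ennreal (norm (h x) powr p) \<partial>lborel)
      = (ennreal (inverse (s ^ CARD('n))) * ennreal (s ^ CARD('n))) * (\<integral>\<^sup>+x. ennreal (norm (h (s *\<^sub>R x)) powr p) \<partial>lborel)"
    by (simp add: mult.assoc)
  also have "ennreal (inverse (s ^ CARD('n))) * ennreal (s ^ CARD('n)) = 1"
    using s by (simp add: ennreal_mult[symmetric])
  finally have "Lp_norm (ereal p) (\<lambda>x. h (s *\<^sub>R x)) = ennreal_powr (ennreal (inverse (s ^ CARD('n)))) (1 / p) * Lp_norm (ereal p) h"
    by (simp add: Lp_norm_eq ennreal_powr_mult[symmetric])
  also have "ennreal_powr (ennreal (inverse (s ^ CARD('n)))) (1 / p) = ennreal (s powr (- real CARD('n) / p))"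
    using s by (simp add: ennreal_powr_ennreal powr_realpow[symmetric] powr_minus[symmetric] powr_powr)
  finally show ?thesis .
qed

lemma Lp_norm_translate:
  fixes h :: "real^'n::finite \<Rightarrow> complex"
  assumes [measurable]: "h \<in> borel_measurable borel"
  shows "Lp_norm (ereal p) (\<lambda>x. h (x + b)) = Lp_norm (ereal p) h"
  using lborel_nn_integral_affine[of 1 "\<lambda>x. ennreal (norm (h x) powr p)" b] by (simp add: Lp_norm_eq add.commute)

lemma inv_fourier_scale:
  fixes f :: "real^'n::finite \<Rightarrow> complex"
  assumes "a \<noteq> 0" "f \<in> borel_measurable borel"
  shows "inv_fourier (\<lambda>x. f (a *\<^sub>R x)) \<xi> = inv_fourier f (\<xi> /\<^sub>R a) / of_real (\<bar>a\<bar> ^ CARD('n))"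
  unfolding inv_fourier_eq fourier_scale[OF assms] by simp

lemma inv_fourier_cmult: "inv_fourier (\<lambda>x. c * f x) \<xi> = c * inv_fourier f \<xi>"
  by (simp add: inv_fourier_eq fourier_cmult)

lemma inv_fourier_zero [simp]: "inv_fourier (\<lambda>x. 0) = (\<lambda>x. 0)"
  by (simp add: inv_fourier_def fun_eq_iff)

text \<open>Dilation by \<open>2 ^ k\<close> in frequency multiplies the inverse transform by
  \<open>2 ^ (k * CARD('n))\<close> and contracts it in space, which contributes 2 to the power
  \<open>- k * CARD('n) / p\<close>.\<close>

lemma Lp_norm_inv_fourier_dilate:
  fixes f :: "real^'n::finite \<Rightarrow> complex"
  assumes p: "0 < p" and f: "f \<in> schwartz"
  shows "Lp_norm (ereal p) (inv_fourier (\<lambda>\<xi>. f ((1 / 2 ^ k) *\<^sub>R \<xi>)))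
    = ennreal (2 powr (real k * real CARD('n) * (1 - 1 / p))) * Lp_norm (ereal p) (inv_fourier f)"
proof -
  note [measurable] = schwartz_measurable[OF f] schwartz_measurable[OF schwartz_inv_fourier[OF f]]
  have "inv_fourier (\<lambda>\<xi>. f ((1 / 2 ^ k) *\<^sub>R \<xi>)) = (\<lambda>x. of_real ((2 ^ k) ^ CARD('n)) * inv_fourier f (2 ^ k *\<^sub>R x))"
    by (rule ext, subst inv_fourier_scale) (auto simp: power_one_over)
  then have "Lp_norm (ereal p) (inv_fourier (\<lambda>\<xi>. f ((1 / 2 ^ k) *\<^sub>R \<xi>)))
      = ennreal ((2 ^ k) ^ CARD('n)) * (ennreal ((2 ^ k) powr (- real CARD('n) / p)) * Lp_norm (ereal p) (inv_fourier f))"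
    by (simp only:) (subst Lp_norm_cmult[OF p], measurable, subst Lp_norm_scale, simp, measurable, simp add: norm_power)
  also have "\<dots> = ennreal ((2 ^ k) ^ CARD('n) * (2 ^ k) powr (- real CARD('n) / p)) * Lp_norm (ereal p) (inv_fourier f)"
    by (simp add: ennreal_mult mult.assoc)
  also have "(2 ^ k) ^ CARD('n) * (2 ^ k) powr (- real CARD('n) / p) = (2 powr (real k * real CARD('n) * (1 - 1 / p)) :: real)"
    by (simp add: powr_realpow[symmetric] powr_powr powr_add[symmetric] algebra_simps)
  finally show ?thesis .
qed

section \<open>Test functions with controlled spectrum\<close>

context littlewood_paley
begin

lemma partition_0: "LP_partition \<phi>0 0 \<xi> = \<phi>0 \<xi>"
  by (simp add: LP_partition_def)

lemma partition_Suc: "LP_partition \<phi>0 (Suc k) \<xi> = \<phi>0 ((1 / 2 ^ Suc k) *\<^sub>R \<xi>) - \<phi>0 ((1 / 2 ^ k) *\<^sub>R \<xi>)"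
proof -
  have e: "2 powr (- real m) = (1 / 2 ^ m :: real)" for m
    by (simp add: powr_minus powr_realpow divide_inverse)
  have "- real (Suc k) + 1 = - real k" by simp
  then show ?thesis unfolding LP_partition_def by (simp only: e) simp
qed

text \<open>On the unit ball all dilates of \<open>\<phi>0\<close> in the partition equal 1, so
  block 0 reproduces \<open>v\<close> and every other block is a difference of equal terms.\<close>

lemma besov_norm_low_frequency:
  assumes v: "v \<in> schwartz" and low: "\<And>\<xi>. norm \<xi> > 1 \<Longrightarrow> fourier v \<xi> = 0" and q: "0 < q"
  shows "besov_norm \<phi>0 \<sigma> (ereal p) q (schwartz_distr v) = ennreal (\<sigma> 0) * Lp_norm (ereal p) v"
proof -
  have 0: "(\<lambda>\<xi>. LP_partition \<phi>0 0 \<xi> * fourier v \<xi>) = fourier v"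
  proof
    fix \<xi> show "LP_partition \<phi>0 0 \<xi> * fourier v \<xi> = fourier v \<xi>"
      using low[of \<xi>] by (cases "norm \<xi> > 1") (auto simp: partition_0 generator_eq_1)
  qed
  have Suc: "(\<lambda>\<xi>. LP_partition \<phi>0 (Suc k) \<xi> * fourier v \<xi>) = (\<lambda>\<xi>. 0)" for k
  proof
    fix \<xi> show "LP_partition \<phi>0 (Suc k) \<xi> * fourier v \<xi> = 0"
    proof (cases "norm \<xi> > 1")
      case False
      have "norm \<xi> \<le> 2 ^ m" for m using False order_trans[of "norm \<xi>" 1 "2 ^ m"] by simp
      then have "norm ((1 / 2 ^ m) *\<^sub>R \<xi>) \<le> 1" for m by simp
      then show ?thesis unfolding partition_Suc by (simp add: generator_eq_1 del: norm_scaleR power_Suc)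
    qed (simp add: low)
  qed
  have "distr_Lp_norm (ereal p) (lp_block \<phi>0 j (schwartz_distr v)) = (if j = 0 then Lp_norm (ereal p) v else 0)" for j
  proof (cases j)
    case 0
    then show ?thesis
      using distr_Lp_norm_eq[OF lp_block_schwartz_distr[OF v, of 0]] \<open>(\<lambda>\<xi>. LP_partition \<phi>0 0 \<xi> * fourier v \<xi>) = fourier v\<close>
      by (simp add: inv_fourier_fourier[OF v])
  next
    case (Suc k)
    then show ?thesis
      using distr_Lp_norm_eq[OF lp_block_schwartz_distr[OF v, of "Suc k"]] \<open>\<And>k. (\<lambda>\<xi>. LP_partition \<phi>0 (Suc k) \<xi> * fourier v \<xi>) = (\<lambda>\<xi>. 0)\<close>
      by simp
  qed
  then have "besov_norm \<phi>0 \<sigma> (ereal p) q (schwartz_distr v) = lq_norm q (\<lambda>j. (ennreal (\<sigma> 0) * Lp_norm (ereal p) v) * (if j = 0 then 1 else 0))"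
    unfolding besov_norm_eq by (intro arg_cong[where f = "lq_norm q"]) auto
  also have "\<dots> = (ennreal (\<sigma> 0) * Lp_norm (ereal p) v) * lq_norm q (\<lambda>j. if j = 0 then 1 else 0)"
    by (rule lq_norm_cmult[OF q])
  also have "lq_norm q (\<lambda>j::nat. if j = 0 then 1 else 0) = 1"
    using q
  proof (cases q rule: positive_ereal_cases)
    case 1
    show ?thesis unfolding 1 lq_norm_infinity
      by (rule antisym[OF SUP_least SUP_upper2[of 0]]) auto
  next
    case (2 r)
    have "(\<Sum>j::nat. ennreal_powr (if j = 0 then 1 else 0) r) = (\<Sum>j\<in>{0::nat}. ennreal_powr (if j = 0 then 1 else 0) r)"
      by (rule suminf_finite) auto
    then show ?thesis by (simp add: 2 lq_norm_ereal)
  qed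
  finally show ?thesis by simp
qed

text \<open>\<open>\<phi>0 (2 *\<^sub>R \<xi>)\<close> vanishes off the unit ball and equals 1 at 0,
  so its inverse transform is not the zero function.\<close>

lemma low_frequency_function:
  obtains v :: "real^'n \<Rightarrow> complex" and z where "v \<in> schwartz" "\<And>\<xi>. norm \<xi> > 1 \<Longrightarrow> fourier v \<xi> = 0" "v z \<noteq> 0"
proof -
  have s: "(\<lambda>\<xi>. \<phi>0 (2 *\<^sub>R \<xi>)) \<in> schwartz" using schwartz_affine[OF generator_schwartz, of 2 0] by simp
  let ?v = "inv_fourier (\<lambda>\<xi>. \<phi>0 (2 *\<^sub>R \<xi>))"
  have F: "fourier ?v = (\<lambda>\<xi>. \<phi>0 (2 *\<^sub>R \<xi>))" by (rule fourier_inv_fourier[OF s])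
  have "\<exists>z. ?v z \<noteq> 0"
  proof (rule ccontr)
    assume "\<not> ?thesis"
    then have "fourier ?v 0 = 0" by (simp add: fourier_def)
    moreover have "fourier ?v 0 = 1" unfolding F by (simp add: generator_eq_1)
    ultimately show False by simp
  qed
  then obtain z where z: "?v z \<noteq> 0" by blast
  have low: "fourier ?v \<xi> = 0" if "norm \<xi> > 1" for \<xi> using that unfolding F by (simp add: generator_eq_0)
  show thesis by (rule that[OF schwartz_inv_fourier[OF s] low z])
qed

text \<open>Stretching by \<open>t \<ge> 1\<close> keeps the spectrum in the unit ball and
  multiplies the \<open>L_p\<close> quasi-norm by \<open>t powr (n / p)\<close>. If
  \<open>p2 < p1\<close>, the target side grows faster in \<open>t\<close> than the source
  side.\<close>

lemma embedding_exponents_le: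
  assumes p: "0 < p1" "0 < p2" and q: "0 < q1" "0 < q2" and pos: "\<And>j. 0 < \<sigma> j" "\<And>j. 0 < \<tau> j" and C: "0 < C"
    and bound: "\<And>v. v \<in> schwartz \<Longrightarrow>
      besov_norm \<phi>0 \<tau> (ereal p2) q2 (schwartz_distr v) \<le> ennreal C * besov_norm \<phi>0 \<sigma> (ereal p1) q1 (schwartz_distr v)"
  shows "p1 \<le> p2"
proof (rule ccontr)
  assume "\<not> p1 \<le> p2"
  then have lt: "p2 < p1" by simp
  obtain v :: "real^'n \<Rightarrow> complex" and z where v: "v \<in> schwartz" "\<And>\<xi>. norm \<xi> > 1 \<Longrightarrow> fourier v \<xi> = 0" "v z \<noteq> 0"
    using low_frequency_function by blast
  obtain N1 where N1: "0 \<le> N1" "Lp_norm (ereal p1) v = ennreal N1" using Lp_norm_schwartz[OF v(1) p(1)] by blast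
  obtain N2 where N2: "0 \<le> N2" "Lp_norm (ereal p2) v = ennreal N2" using Lp_norm_schwartz[OF v(1) p(2)] by blast
  have N2_pos: "0 < N2" using Lp_norm_schwartz_pos[OF v(1) p(2) v(3)] N2 by simp
  define n where "n = real CARD('n)"
  have n: "0 < n" by (simp add: n_def)
  have ineq: "\<tau> 0 * (t powr (n / p2) * N2) \<le> C * (\<sigma> 0 * (t powr (n / p1) * N1))" if t: "1 \<le> t" for t
  proof -
    define w where "w x = v ((1 / t) *\<^sub>R x)" for x
    have w: "w \<in> schwartz" using schwartz_affine[OF v(1), of "1 / t" 0] t by (simp add: w_def[abs_def])
    have low: "fourier w \<xi> = 0" if "norm \<xi> > 1" for \<xi>
    proof -
      have "1 * 1 < t * norm \<xi>" using t that by (intro mult_le_less_imp_less) auto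
      then have "fourier v (\<xi> /\<^sub>R (1 / t)) = 0" using t by (intro v(2)) simp
      then show ?thesis unfolding w_def[abs_def]
        using t by (subst fourier_scale) (auto simp: schwartz_measurable[OF v(1)])
    qed
    have L: "Lp_norm (ereal p) w = ennreal (t powr (n / p)) * Lp_norm (ereal p) v" for p
      using t Lp_norm_scale[of "1 / t" v p] schwartz_measurable[OF v(1)]
      by (simp add: w_def[abs_def] n_def powr_divide powr_minus_divide)
    have "ennreal (\<tau> 0 * (t powr (n / p2) * N2)) \<le> ennreal (C * (\<sigma> 0 * (t powr (n / p1) * N1)))"
      using bound[OF w] pos[of 0] N1(1) N2(1) C
      by (simp add: besov_norm_low_frequency[OF w low] q L N1(2) N2(2) ennreal_mult)
    then show ?thesis using pos(1)[of 0] N1(1) C by (simp add: ennreal_le_iff)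
  qed
  define d where "d = n / p2 - n / p1"
  have d: "0 < d" using lt p n by (simp add: d_def field_simps)
  define M where "M = C * \<sigma> 0 * N1 / (\<tau> 0 * N2)"
  have M: "0 \<le> M" using C pos[of 0] N1 N2 by (simp add: M_def less_imp_le)
  \<comment> \<open>Chosen so that \<open>t powr d = M + 1\<close>, which contradicts the bound by
    \<open>M\<close>.\<close>
  define t where "t = (M + 1) powr (1 / d)"
  have t1: "1 \<le> t" unfolding t_def using M d by (intro ge_one_powr_ge_zero) auto
  have "t powr d = t powr (n / p2) / t powr (n / p1)" using t1 by (simp add: d_def powr_diff)
  also have "\<dots> \<le> M"
    using ineq[OF t1] t1 pos(2)[of 0] N2_pos by (simp add: M_def field_simps)
  finally have "t powr d \<le> M" .
  moreover have "t powr d = M + 1" using d M by (simp add: t_def powr_powr)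
  ultimately show False by simp
qed

text \<open>The generator does not vanish slightly outside the unit ball, so that a bump there,
  dilated by \<open>2\<^sup>k\<close>, meets only the blocks \<open>k\<close> and \<open>k + 1\<close> of the partition, and the first one nontrivially.\<close>

lemma annulus_bump:
  obtains \<eta> :: "real^'n \<Rightarrow> complex" and z where "\<eta> \<in> schwartz" "\<And>\<xi>. \<eta> \<xi> \<noteq> 0 \<Longrightarrow> 1 < norm \<xi> \<and> norm \<xi> < 2" "\<phi>0 z * \<eta> z \<noteq> 0"
proof -
  obtain i :: 'n where True by blast
  define e :: "real^'n" where "e = axis i 1"
  have e: "norm e = 1" by (simp add: e_def norm_axis_1)
  have "isCont \<phi>0 e" using schwartz_differentiable[OF generator_schwartz] differentiable_imp_continuous_within by blast
  then obtain d where d: "d > 0" "\<And>x. dist x e < d \<Longrightarrow> dist (\<phi>0 x) (\<phi>0 e) < 1"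
    unfolding continuous_at_eps_delta by (metis zero_less_one)
  \<comment> \<open>Within \<open>d\<close> of the unit vector \<open>\<phi>0\<close> differs from 1
    by less than 1, hence is nonzero. The bound \<open>1 / 4\<close> keeps the support of the bump
    below radius 2.\<close>
  define \<delta> where "\<delta> = min (d / 2) (1 / 4)"
  have \<delta>: "0 < \<delta>" "\<delta> < d" "\<delta> \<le> 1 / 4" using d by (auto simp: \<delta>_def)
  define z where "z = (1 + \<delta>) *\<^sub>R e"
  have nz: "norm z = 1 + \<delta>" using \<delta> e by (simp add: z_def)
  have "dist z e = \<delta>" using \<delta> e by (simp add: z_def dist_norm scaleR_left_distrib)
  then have "\<phi>0 z \<noteq> 0" using d(2)[of z] \<delta> e by (auto simp: generator_eq_1)
  \<comment> \<open>With this factor the bump lives within \<open>\<delta> / 2\<close> of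
    \<open>z\<close>, hence at radii between \<open>1 + \<delta> / 2\<close> and
    \<open>1 + 3 * \<delta> / 2\<close>.\<close>
  define \<eta> where "\<eta> \<xi> = \<phi>0 ((4 / \<delta>) *\<^sub>R (\<xi> - z))" for \<xi>
  have "\<eta> \<in> schwartz"
    using schwartz_affine[OF generator_schwartz, of "4 / \<delta>" "- ((4 / \<delta>) *\<^sub>R z)"] \<delta>
    by (simp add: \<eta>_def[abs_def] scaleR_diff_right)
  moreover have "1 < norm \<xi> \<and> norm \<xi> < 2" if "\<eta> \<xi> \<noteq> 0" for \<xi>
  proof -
    have "norm ((4 / \<delta>) *\<^sub>R (\<xi> - z)) \<le> 2" using that generator_eq_0 unfolding \<eta>_def by force
    then have "(4 / \<delta>) * norm (\<xi> - z) \<le> 2" using \<delta> unfolding norm_scaleR by simp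
    then have "norm (\<xi> - z) \<le> \<delta> / 2" using \<delta> by (simp add: field_simps)
    moreover have "norm \<xi> \<le> norm (\<xi> - z) + norm z" "norm z \<le> norm (\<xi> - z) + norm \<xi>"
      using norm_triangle_ineq[of "\<xi> - z" z] norm_triangle_ineq2[of z \<xi>] by (simp_all add: norm_minus_commute)
    ultimately show ?thesis using nz \<delta> by linarith
  qed
  moreover have "\<phi>0 z * \<eta> z \<noteq> 0" using \<open>\<phi>0 z \<noteq> 0\<close> by (simp add: \<eta>_def generator_eq_1)
  ultimately show thesis using that by blast
qed

text \<open>On the annulus \<open>2 ^ j < norm \<xi> < 2 ^ Suc j\<close> the dilate of
  \<open>\<phi>0\<close> by \<open>2 ^ m\<close> is 0 for \<open>m < j\<close> and 1 for
  \<open>m > j\<close>. A difference of consecutive dilates survives only if \<open>m = j\<close>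
  occurs in it, which happens for blocks \<open>j\<close> and \<open>j + 1\<close>.\<close>

lemma partition_mult_dilated_bump:
  assumes \<eta>: "\<And>\<xi>. \<eta> \<xi> \<noteq> 0 \<Longrightarrow> 1 < norm \<xi> \<and> norm \<xi> < 2"
  defines "\<alpha> \<equiv> \<lambda>\<xi>. \<phi>0 \<xi> * \<eta> \<xi>" and "\<beta> \<equiv> \<lambda>\<xi>. (\<phi>0 ((1 / 2) *\<^sub>R \<xi>) - \<phi>0 \<xi>) * \<eta> \<xi>"
  shows "LP_partition \<phi>0 k \<xi> * \<eta> ((1 / 2 ^ j) *\<^sub>R \<xi>) =
    (if k = j then \<alpha> ((1 / 2 ^ j) *\<^sub>R \<xi>) else if k = Suc j then \<beta> ((1 / 2 ^ j) *\<^sub>R \<xi>) else 0)"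
proof (cases "\<eta> ((1 / 2 ^ j) *\<^sub>R \<xi>) = 0")
  case True
  then show ?thesis by (simp add: \<alpha>_def \<beta>_def)
next
  case False
  from \<eta>[OF this] have b: "2 ^ j < norm \<xi>" "norm \<xi> < 2 ^ Suc j" by (auto simp: field_simps)
  have n: "norm ((1 / 2 ^ m) *\<^sub>R \<xi>) = norm \<xi> / 2 ^ m" for m by simp
  have z: "\<phi>0 ((1 / 2 ^ m) *\<^sub>R \<xi>) = 0" if "m < j" for m
  proof -
    have "2 * 2 ^ m \<le> (2::real) ^ j" using that power_increasing[of "Suc m" j "2::real"] by simp
    then have "2 < norm \<xi> / 2 ^ m" using b by (simp add: field_simps)
    then show ?thesis by (intro generator_eq_0) (simp only: n)
  qed
  have o: "\<phi>0 ((1 / 2 ^ m) *\<^sub>R \<xi>) = 1" if "j < m" for m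
  proof -
    have "2 ^ Suc j \<le> (2::real) ^ m" using that by (intro power_increasing) auto
    then have "norm \<xi> / 2 ^ m \<le> 1" using b by (simp add: field_simps)
    then show ?thesis by (intro generator_eq_1) (simp only: n)
  qed
  show ?thesis
  proof (cases k)
    case 0
    then show ?thesis using z[of 0] by (cases "j = 0") (auto simp: partition_0 \<alpha>_def)
  next
    case (Suc m)
    have P: "LP_partition \<phi>0 k \<xi> = \<phi>0 ((1 / 2 ^ k) *\<^sub>R \<xi>) - \<phi>0 ((1 / 2 ^ m) *\<^sub>R \<xi>)"
      unfolding Suc by (rule partition_Suc)
    consider "k < j" | "k = j" | "k = Suc j" | "Suc j < k" by linarith
    then show ?thesis
    proof cases
      case 1
      then show ?thesis unfolding P using z[of k] z[of m] Suc by simp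
    next
      case 2
      then show ?thesis unfolding P using z[of m] Suc by (simp add: \<alpha>_def)
    next
      case 3
      then show ?thesis unfolding P using Suc by (simp add: \<beta>_def)
    next
      case 4
      then show ?thesis unfolding P using o[of k] o[of m] Suc by simp
    qed
  qed
qed

text \<open>The test function has as transform a sum of bumps of height \<open>b j\<close> at the
  scales in \<open>J\<close>. The source norm sees pieces \<open>\<alpha>\<close> at
  \<open>j\<close> and \<open>\<beta>\<close> at \<open>j + 1\<close>, the latter weighted by
  \<open>\<sigma> (Suc j) \<le> d * \<sigma> j\<close>; the lower bound in the target keeps the
  pieces \<open>\<alpha>\<close>.\<close>

lemma gapped_sum_test_function:
  assumes p: "0 < p1" "0 < p2" and q: "0 < q1" "0 < q2" and pos: "\<And>j. 0 < \<sigma> j" "\<And>j. 0 < \<tau> j"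
    and adm: "0 < d" "\<And>j. \<sigma> (Suc j) \<le> d * \<sigma> j"
  obtains c1 c2 where "0 < c1" "0 < c2"
    "\<And>J b. gapped J \<Longrightarrow> (\<And>j. 0 \<le> b j) \<Longrightarrow> \<exists>v\<in>schwartz.
      besov_norm \<phi>0 \<sigma> (ereal p1) q1 (schwartz_distr v) \<le> ennreal c1 *
        lq_norm q1 (\<lambda>j. if j \<in> J then ennreal (\<sigma> j * b j * 2 powr (real j * real CARD('n) * (1 - 1 / p1))) else 0) \<and>
      ennreal c2 * lq_norm q2 (\<lambda>j. if j \<in> J then ennreal (\<tau> j * b j * 2 powr (real j * real CARD('n) * (1 - 1 / p2))) else 0)
        \<le> besov_norm \<phi>0 \<tau> (ereal p2) q2 (schwartz_distr v)"
proof -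
  obtain \<eta> :: "real^'n \<Rightarrow> complex" and z where \<eta>: "\<eta> \<in> schwartz" "\<And>\<xi>. \<eta> \<xi> \<noteq> 0 \<Longrightarrow> 1 < norm \<xi> \<and> norm \<xi> < 2" "\<phi>0 z * \<eta> z \<noteq> 0"
    using annulus_bump by blast
  define \<alpha> where "\<alpha> \<xi> = \<phi>0 \<xi> * \<eta> \<xi>" for \<xi>
  define \<beta> where "\<beta> \<xi> = (\<phi>0 ((1 / 2) *\<^sub>R \<xi>) - \<phi>0 \<xi>) * \<eta> \<xi>" for \<xi>
  have \<alpha>: "\<alpha> \<in> schwartz" unfolding \<alpha>_def[abs_def] by (intro schwartz_mult generator_schwartz \<eta>)
  have "(\<lambda>\<xi>. \<phi>0 ((1 / 2) *\<^sub>R \<xi>)) \<in> schwartz" using schwartz_affine[OF generator_schwartz, of "1 / 2" 0] by simp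
  then have \<beta>: "\<beta> \<in> schwartz" unfolding \<beta>_def[abs_def] by (intro schwartz_mult schwartz_diff generator_schwartz \<eta>)
  have dil: "(\<lambda>\<xi>. f ((1 / 2 ^ j) *\<^sub>R \<xi>)) \<in> schwartz" if "f \<in> schwartz" for f :: "real^'n \<Rightarrow> complex" and j :: nat
    using schwartz_affine[OF that, of "1 / 2 ^ j" 0] by simp
  have part: "LP_partition \<phi>0 k \<xi> * \<eta> ((1 / 2 ^ j) *\<^sub>R \<xi>) =
    (if k = j then \<alpha> ((1 / 2 ^ j) *\<^sub>R \<xi>) else if k = Suc j then \<beta> ((1 / 2 ^ j) *\<^sub>R \<xi>) else 0)" for k j \<xi>
    using partition_mult_dilated_bump[OF \<eta>(2)] unfolding \<alpha>_def \<beta>_def by blast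
  obtain A1 where A1: "0 \<le> A1" "Lp_norm (ereal p1) (inv_fourier \<alpha>) = ennreal A1"
    using Lp_norm_schwartz[OF schwartz_inv_fourier[OF \<alpha>] p(1)] by blast
  obtain B1 where B1: "0 \<le> B1" "Lp_norm (ereal p1) (inv_fourier \<beta>) = ennreal B1"
    using Lp_norm_schwartz[OF schwartz_inv_fourier[OF \<beta>] p(1)] by blast
  obtain A2 where A2: "0 \<le> A2" "Lp_norm (ereal p2) (inv_fourier \<alpha>) = ennreal A2"
    using Lp_norm_schwartz[OF schwartz_inv_fourier[OF \<alpha>] p(2)] by blast
  \<comment> \<open>The point \<open>z\<close> from \<open>annulus_bump\<close> guarantees a nonzero
    \<open>\<alpha>\<close>, which makes the lower constant \<open>A2\<close> positive.\<close>
  have "\<exists>x. inv_fourier \<alpha> x \<noteq> 0"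
  proof (rule ccontr)
    assume "\<not> ?thesis"
    then have "fourier (inv_fourier \<alpha>) z = 0" by (simp add: fourier_def)
    then show False using \<eta>(3) by (simp add: fourier_inv_fourier[OF \<alpha>] \<alpha>_def)
  qed
  then have A2_pos: "0 < A2"
    using Lp_norm_schwartz_pos[OF schwartz_inv_fourier[OF \<alpha>] p(2)] A2 by auto
  obtain K where K: "0 < K" "\<And>a b. lq_norm q1 (\<lambda>j. a j + b j) \<le> ennreal K * (lq_norm q1 a + lq_norm q1 b)"
    using lq_norm_add[OF q(1)] by blast
  define c1 where "c1 = K * (A1 + d * B1 + 1)"
  have c1: "0 < c1" using K A1 B1 adm by (simp add: c1_def add_nonneg_pos)
  show thesis
  proof (rule that[OF c1 A2_pos])
    fix J and b :: "nat \<Rightarrow> real" assume J: "gapped J" and b: "\<And>j. 0 \<le> b j"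
    have fin: "finite J" and gap: "\<And>j. j \<in> J \<Longrightarrow> Suc j \<notin> J" using J by (auto simp: gapped_def)
    define H where "H \<xi> = (\<Sum>j\<in>J. of_real (b j) * \<eta> ((1 / 2 ^ j) *\<^sub>R \<xi>))" for \<xi>
    have H: "H \<in> schwartz" unfolding H_def[abs_def] by (intro schwartz_sum schwartz_cmult dil \<eta>)
    define v where "v = inv_fourier H"
    have v: "v \<in> schwartz" unfolding v_def by (rule schwartz_inv_fourier[OF H])
    have Fv: "fourier v = H" unfolding v_def by (rule fourier_inv_fourier[OF H])
    \<comment> \<open>Gapped indices make the cases exclusive: block \<open>k\<close> meets its own
      bump or the one below it, never both.\<close>
    have LH: "LP_partition \<phi>0 k \<xi> * H \<xi> =
        (if k \<in> J then of_real (b k) * \<alpha> ((1 / 2 ^ k) *\<^sub>R \<xi>)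
         else if k \<noteq> 0 \<and> k - 1 \<in> J then of_real (b (k - 1)) * \<beta> ((1 / 2 ^ (k - 1)) *\<^sub>R \<xi>) else 0)" for k \<xi>
    proof -
      let ?t = "\<lambda>j. of_real (b j) * (if k = j then \<alpha> ((1 / 2 ^ j) *\<^sub>R \<xi>) else if k = Suc j then \<beta> ((1 / 2 ^ j) *\<^sub>R \<xi>) else 0)"
      have eq: "LP_partition \<phi>0 k \<xi> * H \<xi> = (\<Sum>j\<in>J. ?t j)"
        unfolding H_def sum_distrib_left mult.left_commute[of "LP_partition \<phi>0 k \<xi>"] part ..
      consider "k \<in> J" | "k \<notin> J" "k \<noteq> 0" "k - 1 \<in> J" | "k \<notin> J" "\<not> (k \<noteq> 0 \<and> k - 1 \<in> J)" by blast
      then show ?thesis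
      proof cases
        case 1
        have "(\<Sum>j\<in>J. ?t j) = ?t k"
          using 1 gap fin by (subst sum.mono_neutral_right[of J "{k}"]) auto
        then show ?thesis unfolding eq using 1 by simp
      next
        case 2
        then obtain m where m: "k = Suc m" by (cases k) auto
        have "(\<Sum>j\<in>J. ?t j) = ?t m"
          using 2 fin m by (subst sum.mono_neutral_right[of J "{m}"]) auto
        then show ?thesis unfolding eq using 2 m by simp
      next
        case 3
        have "(\<Sum>j\<in>J. ?t j) = 0"
          using 3 by (intro sum.neutral) auto
        then show ?thesis unfolding eq using 3 by auto
      qed
    qed
    let ?e = "\<lambda>p j. 2 powr (real j * real CARD('n) * (1 - 1 / p))"
    have dilate: "Lp_norm (ereal p) (inv_fourier (\<lambda>\<xi>. of_real (b j) * f ((1 / 2 ^ j) *\<^sub>R \<xi>))) = ennreal (b j * ?e p j) * Lp_norm (ereal p) (inv_fourier f)"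
      if "0 < p" "f \<in> schwartz" for p j and f :: "real^'n \<Rightarrow> complex"
    proof -
      have "Lp_norm (ereal p) (inv_fourier (\<lambda>\<xi>. of_real (b j) * f ((1 / 2 ^ j) *\<^sub>R \<xi>)))
        = ennreal (b j) * Lp_norm (ereal p) (inv_fourier (\<lambda>\<xi>. f ((1 / 2 ^ j) *\<^sub>R \<xi>)))"
        unfolding inv_fourier_cmult[abs_def]
        using Lp_norm_cmult[OF that(1) schwartz_measurable[OF schwartz_inv_fourier[OF dil[OF that(2)]]], of "of_real (b j)" j] b[of j] by simp
      then show ?thesis using b[of j] by (simp add: Lp_norm_inv_fourier_dilate[OF that] ennreal_mult mult.assoc)
    qed
    have block: "distr_Lp_norm (ereal p) (lp_block \<phi>0 k (schwartz_distr v)) =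
        (if k \<in> J then ennreal (b k * ?e p k) * Lp_norm (ereal p) (inv_fourier \<alpha>)
         else if k \<noteq> 0 \<and> k - 1 \<in> J then ennreal (b (k - 1) * ?e p (k - 1)) * Lp_norm (ereal p) (inv_fourier \<beta>) else 0)"
      if "0 < p" for p k
      using distr_Lp_norm_eq[OF lp_block_schwartz_distr[OF v, of k], of p]
      by (simp add: Fv LH dilate[OF that \<alpha>] dilate[OF that \<beta>])
    let ?x = "\<lambda>j. if j \<in> J then ennreal (\<sigma> j * b j * ?e p1 j) else 0"
    have upper: "ennreal (\<sigma> k) * distr_Lp_norm (ereal p1) (lp_block \<phi>0 k (schwartz_distr v))
        \<le> ennreal A1 * ?x k + ennreal (d * B1) * (if k = 0 then 0 else ?x (k - 1))" for k
    proof -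
      consider "k \<in> J" | "k \<notin> J" "k \<noteq> 0" "k - 1 \<in> J" | "k \<notin> J" "\<not> (k \<noteq> 0 \<and> k - 1 \<in> J)" by blast
      then show ?thesis
      proof cases
        case 1
        then have "ennreal (\<sigma> k) * distr_Lp_norm (ereal p1) (lp_block \<phi>0 k (schwartz_distr v)) = ennreal A1 * ?x k"
          using pos(1)[of k] b[of k] A1 by (simp add: block[OF p(1)] ennreal_mult[symmetric] mult_ac)
        then show ?thesis by (simp add: add_increasing2)
      next
        case 2
        \<comment> \<open>Admissibility moves the weight from \<open>k\<close> back to the scale
          \<open>k - 1\<close> at which the bump was placed.\<close>
        have "\<sigma> k \<le> d * \<sigma> (k - 1)" using adm(2)[of "k - 1"] 2 by simp
        then have "ennreal (\<sigma> k * (b (k - 1) * ?e p1 (k - 1) * B1)) \<le> ennreal (d * \<sigma> (k - 1) * (b (k - 1) * ?e p1 (k - 1) * B1))"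
          using b[of "k - 1"] B1 by (intro ennreal_leI mult_right_mono) auto
        moreover have "ennreal (\<sigma> k) * distr_Lp_norm (ereal p1) (lp_block \<phi>0 k (schwartz_distr v)) = ennreal (\<sigma> k * (b (k - 1) * ?e p1 (k - 1) * B1))"
          using 2 pos(1)[of k] b[of "k - 1"] B1 by (simp add: block[OF p(1)] ennreal_mult)
        moreover have "ennreal (d * \<sigma> (k - 1) * (b (k - 1) * ?e p1 (k - 1) * B1)) = ennreal (d * B1) * ?x (k - 1)"
          using 2 pos(1)[of "k - 1"] b[of "k - 1"] B1 adm(1) by (simp add: ennreal_mult[symmetric] mult_ac)
        ultimately show ?thesis using 2 by (simp add: add_increasing)
      next
        case 3
        then show ?thesis by (auto simp: block[OF p(1)])
      qed
    qed
    have "besov_norm \<phi>0 \<sigma> (ereal p1) q1 (schwartz_distr v) \<le>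
        lq_norm q1 (\<lambda>k. ennreal A1 * ?x k + ennreal (d * B1) * (if k = 0 then 0 else ?x (k - 1)))"
      unfolding besov_norm_eq by (intro lq_norm_mono q upper)
    also have "\<dots> \<le> ennreal K * (lq_norm q1 (\<lambda>k. ennreal A1 * ?x k) + lq_norm q1 (\<lambda>k. ennreal (d * B1) * (if k = 0 then 0 else ?x (k - 1))))"
      by (rule K(2))
    also have "\<dots> = ennreal K * (ennreal A1 * lq_norm q1 ?x + ennreal (d * B1) * lq_norm q1 ?x)"
    proof -
      have "lq_norm q1 (\<lambda>k. if k = 0 then 0 else ?x (k - 1)) = lq_norm q1 ?x"
        by (rule lq_norm_shift[OF q(1)])
      then show ?thesis by (simp only: lq_norm_cmult[OF q(1)])
    qed
    also have "\<dots> = ennreal (K * (A1 + d * B1)) * lq_norm q1 ?x"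
      using K A1 B1 adm(1) by (simp add: ennreal_mult distrib_right mult.assoc)
    also have "\<dots> \<le> ennreal c1 * lq_norm q1 ?x"
      using K by (intro mult_right_mono ennreal_leI) (auto simp: c1_def)
    finally have 1: "besov_norm \<phi>0 \<sigma> (ereal p1) q1 (schwartz_distr v) \<le> ennreal c1 * lq_norm q1 ?x" .
    let ?y = "\<lambda>j. if j \<in> J then ennreal (\<tau> j * b j * ?e p2 j) else 0"
    have lower: "ennreal A2 * ?y k \<le> ennreal (\<tau> k) * distr_Lp_norm (ereal p2) (lp_block \<phi>0 k (schwartz_distr v))" for k
    proof (cases "k \<in> J")
      case True
      then have "ennreal (\<tau> k) * distr_Lp_norm (ereal p2) (lp_block \<phi>0 k (schwartz_distr v)) = ennreal A2 * ?y k"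
        using pos(2)[of k] b[of k] A2 by (simp add: block[OF p(2)] ennreal_mult[symmetric] mult_ac)
      then show ?thesis by simp
    qed simp
    have "ennreal A2 * lq_norm q2 ?y = lq_norm q2 (\<lambda>k. ennreal A2 * ?y k)" by (rule lq_norm_cmult[OF q(2), symmetric])
    also have "\<dots> \<le> besov_norm \<phi>0 \<tau> (ereal p2) q2 (schwartz_distr v)"
      unfolding besov_norm_eq by (intro lq_norm_mono q lower)
    finally show "\<exists>v\<in>schwartz. besov_norm \<phi>0 \<sigma> (ereal p1) q1 (schwartz_distr v) \<le> ennreal c1 * lq_norm q1 ?x \<and>
        ennreal A2 * lq_norm q2 ?y \<le> besov_norm \<phi>0 \<tau> (ereal p2) q2 (schwartz_distr v)"
      using 1 v by blast
  qed
qed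

lemma multiplier_finite_if_bounded:
  fixes \<sigma> \<tau> :: "nat \<Rightarrow> real"
  assumes p: "0 < p1" "0 < p2" and q: "0 < q1" "0 < q2" "0 < qs" "1 / qs = max (1 / q2 - 1 / q1) 0"
    and pos: "\<And>j. 0 < \<sigma> j" "\<And>j. 0 < \<tau> j" and adm: "0 < d" "\<And>j. \<sigma> (Suc j) \<le> d * \<sigma> j" and C: "0 < C"
    and bound: "\<And>v. v \<in> schwartz \<Longrightarrow>
      besov_norm \<phi>0 \<tau> (ereal p2) q2 (schwartz_distr v) \<le> ennreal C * besov_norm \<phi>0 \<sigma> (ereal p1) q1 (schwartz_distr v)"
  shows "lq_norm qs (\<lambda>j. ennreal (inverse (\<sigma> j) * \<tau> j * 2 powr (real j * real CARD('n) * (1 / p1 - 1 / p2)))) < \<infinity>"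
proof -
  let ?e = "\<lambda>p j. 2 powr (real j * real CARD('n) * (1 - 1 / p))"
  let ?a = "\<lambda>j. inverse (\<sigma> j) * \<tau> j * 2 powr (real j * real CARD('n) * (1 / p1 - 1 / p2))"
  obtain c1 c2 where c: "0 < c1" "0 < c2"
    and test: "\<And>J b. gapped J \<Longrightarrow> (\<And>j. 0 \<le> b j) \<Longrightarrow> \<exists>v\<in>schwartz.
      besov_norm \<phi>0 \<sigma> (ereal p1) q1 (schwartz_distr v) \<le> ennreal c1 *
        lq_norm q1 (\<lambda>j. if j \<in> J then ennreal (\<sigma> j * b j * ?e p1 j) else 0) \<and>
      ennreal c2 * lq_norm q2 (\<lambda>j. if j \<in> J then ennreal (\<tau> j * b j * ?e p2 j) else 0)
        \<le> besov_norm \<phi>0 \<tau> (ereal p2) q2 (schwartz_distr v)"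
    using gapped_sum_test_function[of p1 p2 q1 q2 \<sigma> \<tau> d, OF p q(1,2) pos adm] by blast
  show ?thesis
  proof (rule lq_norm_finite_if_multiplier[OF q])
    show "0 < ?a j" for j using pos[of j] by simp
    show "0 < C * c1 / c2" using C c by simp
    fix J and b :: "nat \<Rightarrow> real" assume J: "gapped J" and b: "\<And>j. 0 \<le> b j"
    \<comment> \<open>The heights are divided by the source weights, so that the source sequence is
      \<open>b\<close> itself; the quotient of the two scale factors then leaves the multiplier in
      the target.\<close>
    define b' where "b' j = b j / (\<sigma> j * ?e p1 j)" for j
    have b': "0 \<le> b' j" for j using b[of j] pos(1)[of j] by (simp add: b'_def)
    have s: "\<sigma> j * b' j * ?e p1 j = b j" for j using pos(1)[of j] by (simp add: b'_def)
    have t: "\<tau> j * b' j * ?e p2 j = ?a j * b j" for j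
    proof -
      have "?e p2 j / ?e p1 j = 2 powr (real j * real CARD('n) * (1 / p1 - 1 / p2))"
        by (subst powr_diff[symmetric]) (simp add: algebra_simps)
      then have "\<tau> j * (b j / \<sigma> j) * (?e p2 j / ?e p1 j) = ?a j * b j" by (simp add: divide_inverse mult_ac)
      then show ?thesis by (simp add: b'_def)
    qed
    let ?L = "lq_norm q2 (\<lambda>j. if j \<in> J then ennreal (?a j * b j) else 0)" and ?R = "lq_norm q1 (\<lambda>j. if j \<in> J then ennreal (b j) else 0)"
    have "\<exists>v\<in>schwartz. besov_norm \<phi>0 \<sigma> (ereal p1) q1 (schwartz_distr v) \<le> ennreal c1 * ?R \<and>
      ennreal c2 * ?L \<le> besov_norm \<phi>0 \<tau> (ereal p2) q2 (schwartz_distr v)"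
      using test[of J b', OF J b'] unfolding s t .
    then obtain v where v: "v \<in> schwartz" "besov_norm \<phi>0 \<sigma> (ereal p1) q1 (schwartz_distr v) \<le> ennreal c1 * ?R"
      "ennreal c2 * ?L \<le> besov_norm \<phi>0 \<tau> (ereal p2) q2 (schwartz_distr v)"
      by (elim bexE conjE)
    have "ennreal c2 * ?L \<le> ennreal C * (ennreal c1 * ?R)"
      using v(2) by (intro order_trans[OF v(3)] order_trans[OF bound[OF v(1)]] mult_left_mono) auto
    then have "ennreal (inverse c2) * (ennreal c2 * ?L) \<le> ennreal (inverse c2) * (ennreal C * (ennreal c1 * ?R))"
      by (rule mult_left_mono) simp
    moreover have "ennreal (inverse c2) * (ennreal c2 * ?L) = ?L"
      using c by (simp add: mult.assoc[symmetric] ennreal_mult[symmetric])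
    moreover have "ennreal (inverse c2) * (ennreal C * (ennreal c1 * ?R)) = ennreal (C * c1 / c2) * ?R"
    proof -
      have "ennreal (inverse c2 * (C * c1)) * ?R = ennreal (inverse c2) * (ennreal C * (ennreal c1 * ?R))"
        using c C by (simp only: ennreal_mult less_imp_le inverse_nonnegative_iff_nonnegative mult_nonneg_nonneg mult.assoc)
      then show ?thesis by (simp only: divide_inverse mult.commute[of "inverse c2"])
    qed
    ultimately show "?L \<le> ennreal (C * c1 / c2) * ?R" by simp
  qed
qed

end

section \<open>Failure of compactness\<close>

context littlewood_paley
begin

text \<open>The witnesses are widely separated translates of one function with spectrum in the unit ball.\<close>

lemma separated_sequence:
  assumes p: "0 < p1" "0 < p2" and q: "0 < q1" "0 < q2" and pos: "0 < \<sigma> 0" "0 < \<tau> 0"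
  obtains w :: "nat \<Rightarrow> real^'n \<Rightarrow> complex" and c where "0 < c" "\<And>k. w k \<in> schwartz"
    "\<And>k. besov_norm \<phi>0 \<sigma> (ereal p1) q1 (schwartz_distr (w k)) \<le> 1"
    "\<And>k l. k \<noteq> l \<Longrightarrow> ennreal c \<le> besov_norm \<phi>0 \<tau> (ereal p2) q2 (\<lambda>f. schwartz_distr (w k) f - schwartz_distr (w l) f)"
proof -
  obtain v :: "real^'n \<Rightarrow> complex" and z where v: "v \<in> schwartz" "\<And>\<xi>. norm \<xi> > 1 \<Longrightarrow> fourier v \<xi> = 0" "v z \<noteq> 0"
    using low_frequency_function by blast
  note [measurable] = schwartz_measurable[OF v(1)]
  obtain N where N: "0 \<le> N" "Lp_norm (ereal p1) v = ennreal N" using Lp_norm_schwartz[OF v(1) p(1)] by blast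
  define a where "a = norm (v z)"
  have a: "0 < a" using v(3) by (simp add: a_def)
  have "isCont v z" using schwartz_differentiable[OF v(1)] differentiable_imp_continuous_within by blast
  then obtain r where r: "r > 0" "\<And>x. dist x z < r \<Longrightarrow> dist (v x) (v z) < a / 4"
    unfolding continuous_at_eps_delta using a by (metis zero_less_divide_iff zero_less_numeral)
  have near: "a * (3 / 4) \<le> norm (v x)" if "dist x z < r" for x
    using r(2)[OF that] norm_triangle_ineq2[of "v z" "v x"] by (simp add: a_def dist_norm norm_minus_commute)
  obtain M where M: "M > 0" "\<And>x. (1 + norm x) ^ 1 * norm (v x) \<le> M" using schwartz_decay[OF v(1)] by metis
  \<comment> \<open>Beyond this radius the decay bound \<open>M\<close> forces
    \<open>norm (v x)\<close> below \<open>a / 4\<close>.\<close>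
  define R where "R = 4 * M / a"
  have R: "0 < R" using M a by (simp add: R_def)
  have far: "norm (v x) \<le> a / 4" if "R \<le> norm x" for x
  proof -
    have "R * norm (v x) \<le> (1 + norm x) ^ 1 * norm (v x)" using that by (intro mult_right_mono) auto
    also have "\<dots> \<le> M" by (rule M(2))
    finally show ?thesis using a M by (simp add: R_def field_simps)
  qed
  obtain i :: 'n where True by blast
  \<comment> \<open>With translations at least \<open>D\<close> apart, a point within
    \<open>r\<close> of \<open>z + s k\<close> has distance at least \<open>R\<close> from every
    other \<open>s l\<close>.\<close>
  define D where "D = R + r + norm z"
  have D: "0 < D" using R r by (simp add: D_def add_pos_nonneg)
  define s :: "nat \<Rightarrow> real^'n" where "s k = (real k * D) *\<^sub>R axis i 1" for k
  have s: "D \<le> norm (s k - s l)" if "k \<noteq> l" for k l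
  proof -
    have "norm (s k - s l) = \<bar>real k - real l\<bar> * D"
      using D by (simp add: s_def scaleR_left_diff_distrib[symmetric] norm_axis_1 left_diff_distrib[symmetric] abs_mult)
    moreover have "1 \<le> \<bar>real k - real l\<bar>" using that by linarith
    ultimately show ?thesis using D by simp
  qed
  \<comment> \<open>This normalises the translates into the unit ball of the source; the summand 1
    keeps the denominator positive.\<close>
  define c where "c = 1 / (\<sigma> 0 * N + 1)"
  have c: "0 < c" using pos N by (simp add: c_def add_nonneg_pos less_imp_le)
  define w where "w k x = of_real c * v (x + - s k)" for k x
  have vs: "(\<lambda>x. v (x + - s k)) \<in> schwartz" for k
    using schwartz_affine[OF v(1), of 1 "- s k"] by simp
  have w: "w k \<in> schwartz" for k unfolding w_def[abs_def] by (intro schwartz_cmult vs)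
  have Fw: "fourier (w k) \<xi> = of_real c * (cis (- s k \<bullet> \<xi>) * fourier v \<xi>)" for k \<xi>
    unfolding w_def[abs_def] by (subst fourier_cmult, subst fourier_translate) auto
  have low: "fourier (w k) \<xi> = 0" if "norm \<xi> > 1" for k \<xi> by (simp add: Fw v(2)[OF that])
  have "besov_norm \<phi>0 \<sigma> (ereal p1) q1 (schwartz_distr (w k)) \<le> 1" for k
  proof -
    have "Lp_norm (ereal p1) (w k) = ennreal c * ennreal N"
      unfolding w_def[abs_def] using c N
      by (subst Lp_norm_cmult[OF p(1) schwartz_measurable[OF vs]], subst Lp_norm_translate) auto
    then have "besov_norm \<phi>0 \<sigma> (ereal p1) q1 (schwartz_distr (w k)) = ennreal (\<sigma> 0 * (c * N))"
      using besov_norm_low_frequency[OF w low q(1)] pos c N by (simp add: ennreal_mult)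
    also have "\<sigma> 0 * (c * N) \<le> 1"
      using pos N by (simp add: c_def divide_le_eq add_nonneg_pos)
    finally show ?thesis by (simp add: ennreal_leI)
  qed
  moreover
  \<comment> \<open>Before scaling by \<open>c\<close>, on a ball of radius \<open>r\<close> one
    translate is at least \<open>a * (3 / 4)\<close> in modulus and the other at most
    \<open>a / 4\<close>, so their difference is at least \<open>a / 2\<close> there, uniformly in
    \<open>k\<close> and \<open>l\<close>.\<close>
  define b where "b = \<tau> 0 * ((c * (a / 2)) * (unit_ball_vol (real CARD('n)) * r ^ CARD('n)) powr (1 / p2))"
  have "0 < unit_ball_vol (real CARD('n))" by (intro unit_ball_vol_pos) simp
  then have "unit_ball_vol (real CARD('n)) \<noteq> 0" by (rule less_imp_neq[THEN not_sym])
  then have b: "0 < b" using pos c a r by (simp add: b_def)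
  moreover have "ennreal b \<le> besov_norm \<phi>0 \<tau> (ereal p2) q2 (\<lambda>f. schwartz_distr (w k) f - schwartz_distr (w l) f)" if kl: "k \<noteq> l" for k l
  proof -
    let ?d = "\<lambda>x. w k x - w l x"
    have d: "?d \<in> schwartz" by (intro schwartz_diff w)
    have eq: "(\<lambda>f. schwartz_distr (w k) f - schwartz_distr (w l) f) = schwartz_distr ?d"
      by (auto simp: schwartz_distr_def left_diff_distrib schwartz_product_integrable w)
    have lowd: "fourier ?d \<xi> = 0" if "norm \<xi> > 1" for \<xi>
      using fourier_add[OF schwartz_integrable[OF w[of k]] schwartz_integrable[OF schwartz_cmult[OF w[of l], of "-1"]], of \<xi>]
        fourier_cmult[of "-1" "w l" \<xi>] low[OF that] by simp
    have "c * (a / 2) \<le> norm (?d x)" if x: "x \<in> ball (z + s k) r" for x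
    proof -
      have "dist (x - s k) z < r" using x by (simp add: dist_norm norm_minus_commute algebra_simps)
      then have n: "a * (3 / 4) \<le> norm (v (x - s k))" by (rule near)
      have "norm (s k - s l) \<le> norm (x - s l) + norm (x - s k)"
        using norm_triangle_ineq4[of "x - s l" "x - s k"] by simp
      moreover have "norm (x - s k) \<le> norm (x - s k - z) + norm z"
        using norm_triangle_ineq[of "x - s k - z" z] by simp
      moreover have "norm (x - s k - z) < r" using \<open>dist (x - s k) z < r\<close> by (simp add: dist_norm)
      ultimately have "R \<le> norm (x - s l)" using s[OF kl] by (simp add: D_def)
      then have f: "norm (v (x - s l)) \<le> a / 4" by (rule far)
      have "a / 2 \<le> norm (v (x - s k) - v (x - s l))"
        using n f norm_triangle_ineq2[of "v (x - s k)" "v (x - s l)"] by linarith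
      then have "c * (a / 2) \<le> c * norm (v (x - s k) - v (x - s l))" using c by (intro mult_left_mono) auto
      also have "\<dots> = norm (?d x)" using c by (simp add: w_def right_diff_distrib[symmetric] norm_mult)
      finally show ?thesis .
    qed
    then have "ennreal (c * (a / 2) * (unit_ball_vol (real CARD('n)) * r ^ CARD('n)) powr (1 / p2)) \<le> Lp_norm (ereal p2) ?d"
      using c a r schwartz_measurable[OF d] by (intro Lp_norm_ge_on_ball[OF p(2)]) auto
    then have "ennreal (\<tau> 0) * ennreal (c * (a / 2) * (unit_ball_vol (real CARD('n)) * r ^ CARD('n)) powr (1 / p2)) \<le> ennreal (\<tau> 0) * Lp_norm (ereal p2) ?d"
      by (rule mult_left_mono) simp
    moreover have "besov_norm \<phi>0 \<tau> (ereal p2) q2 (schwartz_distr ?d) = ennreal (\<tau> 0) * Lp_norm (ereal p2) ?d"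
      by (rule besov_norm_low_frequency[OF d lowd q(2)])
    moreover have "ennreal b = ennreal (\<tau> 0) * ennreal (c * (a / 2) * (unit_ball_vol (real CARD('n)) * r ^ CARD('n)) powr (1 / p2))"
      unfolding b_def using pos by (intro ennreal_mult') simp
    ultimately show ?thesis unfolding eq by (simp only:)
  qed
  ultimately show thesis using that[of b w] w by blast
qed

text \<open>Every point of the target has an open neighbourhood containing at most one member of the
  separated sequence. Finitely many such sets cannot cover infinitely many members, all of which lie
  in the image of the unit ball.\<close>

lemma not_besov_embedding_compact:
  assumes p: "0 < p1" "0 < p2" and q: "0 < q1" "0 < q2" and pos: "0 < \<sigma> 0" "0 < \<tau> 0"
  shows "\<not> besov_embedding_compact \<phi>0 \<sigma> (ereal p1) q1 \<tau> (ereal p2) q2"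
proof
  let ?N = "besov_norm \<phi>0 \<tau> (ereal p2) q2" and ?T = "besov_topology \<phi>0 \<tau> (ereal p2) q2"
  let ?B = "{u \<in> besov \<phi>0 \<sigma> (ereal p1) q1. besov_norm \<phi>0 \<sigma> (ereal p1) q1 u \<le> 1}"
  assume "besov_embedding_compact \<phi>0 \<sigma> (ereal p1) q1 \<tau> (ereal p2) q2"
  then have sub: "besov \<phi>0 \<sigma> (ereal p1) q1 \<subseteq> besov \<phi>0 \<tau> (ereal p2) q2" and cpt: "compactin ?T (?T closure_of ?B)"
    by (auto simp: besov_embedding_compact_def)
  obtain w :: "nat \<Rightarrow> real^'n \<Rightarrow> complex" and c where c: "0 < c" and w: "\<And>k. w k \<in> schwartz"
    "\<And>k. besov_norm \<phi>0 \<sigma> (ereal p1) q1 (schwartz_distr (w k)) \<le> 1"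
    "\<And>k l. k \<noteq> l \<Longrightarrow> ennreal c \<le> ?N (\<lambda>f. schwartz_distr (w k) f - schwartz_distr (w l) f)"
    by (rule separated_sequence[of p1 p2 q1 q2 \<sigma> \<tau>, OF p q pos]) blast
  define u where "u k = schwartz_distr (w k)" for k
  obtain K where K: "0 < K" "\<And>u v. ?N (\<lambda>f. u f - v f) \<le> ennreal K * (?N u + ?N v)"
    by (rule besov_norm_diff[OF p(2) q(2), of \<tau>]) blast
  have uB: "u k \<in> ?B" for k
  proof -
    have "besov_norm \<phi>0 \<sigma> (ereal p1) q1 (u k) < \<infinity>" using w(2)[of k] by (simp add: u_def le_less_trans)
    then show ?thesis using w(2)[of k] schwartz_distr_tempered[OF w(1)[of k]] unfolding besov_def u_def by blast
  qed
  have uK: "u k \<in> ?T closure_of ?B" for k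
  proof -
    have "?B \<subseteq> topspace ?T" using sub by auto
    from subsetD[OF closure_of_subset[OF this] uB] show ?thesis .
  qed
  define \<U> where "\<U> = {U. openin ?T U \<and> (\<forall>k l. u k \<in> U \<and> u l \<in> U \<longrightarrow> k = l)}"
  have cover: "?T closure_of ?B \<subseteq> \<Union>\<U>"
  proof
    fix x assume "x \<in> ?T closure_of ?B"
    then have x: "x \<in> besov \<phi>0 \<tau> (ereal p2) q2" using closure_of_subset_topspace[of ?T ?B] by auto
    \<comment> \<open>Two members within this radius of \<open>x\<close> would be closer than
      \<open>c\<close> by the quasi-triangle inequality with constant \<open>K\<close>.\<close>
    have e: "0 < c / (2 * K)" using c K by simp
    obtain U where U: "openin ?T U" "x \<in> U" "\<And>y. y \<in> U \<Longrightarrow> ?N (\<lambda>f. y f - x f) < ennreal (c / (2 * K))"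
      by (rule besov_ball_neighbourhood[OF p(2) q(2) e x]) blast
    have "k = l" if "u k \<in> U" "u l \<in> U" for k l
    proof (rule ccontr)
      assume "k \<noteq> l"
      have "ennreal c \<le> ?N (\<lambda>f. u k f - u l f)" unfolding u_def by (rule w(3)[OF \<open>k \<noteq> l\<close>])
      also have "\<dots> = ?N (\<lambda>f. (u k f - x f) - (u l f - x f))" by simp
      also have "\<dots> \<le> ennreal K * (?N (\<lambda>f. u k f - x f) + ?N (\<lambda>f. u l f - x f))" by (rule K(2))
      also have "\<dots> < ennreal K * (ennreal (c / (2 * K)) + ennreal (c / (2 * K)))"
        using U(3)[OF that(1)] U(3)[OF that(2)] K by (intro ennreal_mult_strict_left_mono add_strict_mono) auto
      also have "\<dots> = ennreal c" using K c by (simp add: ennreal_plus[symmetric] ennreal_mult[symmetric] del: ennreal_plus)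
      finally show False by simp
    qed
    then show "x \<in> \<Union>\<U>" using U by (auto simp: \<U>_def)
  qed
  have "\<forall>U\<in>\<U>. openin ?T U" by (auto simp: \<U>_def)
  then obtain F where F: "finite F" "F \<subseteq> \<U>" "?T closure_of ?B \<subseteq> \<Union>F"
    using cpt cover unfolding compactin_def by blast
  then have "\<forall>k. \<exists>U\<in>F. u k \<in> U" using uK by blast
  then obtain g where g: "\<And>k. g k \<in> F" "\<And>k. u k \<in> g k" by metis
  have "inj g"
  proof (rule injI)
    fix k l assume "g k = g l"
    then have "u k \<in> g k" "u l \<in> g k" "g k \<in> \<U>" using g[of k] g[of l] F by auto
    then show "k = l" by (auto simp: \<U>_def)
  qed
  then have "finite (UNIV :: nat set)"
    using F(1) g(1) by (metis finite_imageD finite_subset image_subset_iff)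
  then show False by simp
qed

end

theorem theorem3p1:
  fixes \<phi>0 :: "real^'n::finite \<Rightarrow> complex"
    and \<sigma> \<tau> :: "nat \<Rightarrow> real"
    and p1 p2 :: real
    and q1 q2 qstar :: ereal
  assumes "LP_generator \<phi>0"
    and "admissible \<sigma>" and "admissible \<tau>"
    and "0 < p1" and "0 < p2"
    and "0 < q1" and "0 < q2"
    and "0 < qstar" and "1 / qstar = max (1 / q2 - 1 / q1) 0"
  shows "(besov_embedding_continuous \<phi>0 \<sigma> (ereal p1) q1 \<tau> (ereal p2) q2 \<longleftrightarrow>
            p1 \<le> p2 \<and>
            lq_norm qstar (\<lambda>j. ennreal (inverse (\<sigma> j) * \<tau> j *
              2 powr (real j * real CARD('n) * (1 / p1 - 1 / p2)))) < \<infinity>)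
         \<and> \<not> besov_embedding_compact \<phi>0 \<sigma> (ereal p1) q1 \<tau> (ereal p2) q2"
proof -
  interpret littlewood_paley \<phi>0 by unfold_locales (rule assms(1))
  have pos: "0 < \<sigma> j" "0 < \<tau> j" for j using assms(2,3) by (auto simp: admissible_def)
  obtain d where d: "0 < d" "\<And>j. \<sigma> (Suc j) \<le> d * \<sigma> j" using assms(2) unfolding admissible_def by blast
  let ?a = "\<lambda>j. ennreal (inverse (\<sigma> j) * \<tau> j * 2 powr (real j * real CARD('n) * (1 / p1 - 1 / p2)))"
  have "p1 \<le> p2 \<and> lq_norm qstar ?a < \<infinity>"
    if cont: "besov_embedding_continuous \<phi>0 \<sigma> (ereal p1) q1 \<tau> (ereal p2) q2"
  proof -
    obtain C where C: "0 < C" "\<And>v. v \<in> schwartz \<Longrightarrow>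
        besov_norm \<phi>0 \<tau> (ereal p2) q2 (schwartz_distr v) \<le> ennreal C * besov_norm \<phi>0 \<sigma> (ereal p1) q1 (schwartz_distr v)"
      by (rule besov_embedding_bound_schwartz[OF assms(4-7) cont]) blast
    show ?thesis
      using embedding_exponents_le[of p1 p2 q1 q2 \<sigma> \<tau> C, OF assms(4-7) pos C]
        multiplier_finite_if_bounded[of p1 p2 q1 q2 qstar \<sigma> \<tau> d C, OF assms(4-9) pos d C] by blast
  qed
  moreover have "besov_embedding_continuous \<phi>0 \<sigma> (ereal p1) q1 \<tau> (ereal p2) q2"
    if le: "p1 \<le> p2" and fin: "lq_norm qstar ?a < \<infinity>"
  proof -
    obtain C where "0 < C" "\<And>u. u (\<lambda>x. 0) = 0 \<Longrightarrow>
        besov_norm \<phi>0 \<tau> (ereal p2) q2 u \<le> ennreal C * besov_norm \<phi>0 \<sigma> (ereal p1) q1 u"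
      using besov_norm_le_if_multiplier_finite[of p1 p2 q1 q2 qstar \<sigma> \<tau>, OF assms(4) le assms(6-9) pos fin] by blast
    then show ?thesis by (rule besov_embedding_continuous_if_bounded)
  qed
  moreover have "\<not> besov_embedding_compact \<phi>0 \<sigma> (ereal p1) q1 \<tau> (ereal p2) q2"
    by (rule not_besov_embedding_compact[OF assms(4-7) pos])
  ultimately show ?thesis by blast
qed

end
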